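(* Let $n\ge 1$ and let $\Pi_n^w$ be the poset of weighted partitions of $\{1,\dots,n\}$. For $0\le i\le n-1$, $$\operatorname{rank}\tilde H_{n-2}(\Pi_n^w\setminus\{\hat 0\})=(n-1)^{n-1},$$ $$\operatorname{rank}\tilde H_{n-3}((\hat 0,[n]^i))=|\mathcal T_{n,i}|,$$ $$\operatorname{rank}\bigoplus_{i=0}^{n-1}\tilde H_{n-3}((\hat 0,[n]^i))=n^{n-1},$$ where $\mathcal T_{n,i}$ is the set of rooted trees on node set $\{1,\dots,n\}$ with exactly $i$ descents.
   Context: Let $[n]=\{1,\dots,n\}$. A weighted partition of $[n]$ is a set $\{B_1^{v_1},\dots,B_t^{v_t}\}$ where $\{B_1,\dots,B_t\}$ is a partition of $[n]$ and $v_i\in\{0,1,\dots,|B_i|-1\}$ for all $i$. The poset $\Pi_n^w$ is the set of weighted partitions of $[n]$ ordered by: $\{A_1^{w_1},\dots,A_s^{w_s}\}\le\{B_1^{v_1},\dots,B_t^{v_t}\}$ iff (a) $\{A_1,\dots,A_s\}$ refines $\{B_1,\dots,B_t\}$, and (b) whenever $B_k=A_{i_1}\cup\cdots\cup A_{i_l}$, then $v_k-(w_{i_1}+\cdots+w_{i_l})\in\{0,1,\dots,l-1\}$. Its minimum element is $\hat 0=\{\{1\}^0,\dots,\{n\}^0\}$, and its maximal elements are the one-block weighted partitions $[n]^i:=\{[n]^i\}$, $0\le i\le n-1$. $\tilde H_r(P)$ is the reduced simplicial homology of the order complex of $P$ (faces = chains of $P$), with coefficients in $\mathbf k$, an arbitrary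 field or $\mathbb Z$; rank is rank as a free $\mathbf k$-module. A descent of a rooted tree on node set $[n]$ is a non-root node whose label is smaller than that of its parent. Conventions: $0^0=1$; the empty poset has $\tilde H_{-1}=\mathbf k$ (spanned by the empty chain); for a degenerate interval $(x,x)$, $\tilde H_r((x,x))=\mathbf k$ if $r=-2$ and $0$ otherwise. *)

theory Defs
  imports
    "Jordan_Normal_Form.VS_Connect"
    "HOL-Algebra.QuotRing"
    "HOL-Algebra.IntRing"
    "HOL-Library.Poly_Mapping"
    "HOL-Library.Set_Algebras"
    "HOL-Library.Disjoint_Sets"
begin

hide_const (open) Multiset.mult Polynomial.smult Modules.module

section \<open>Free modules and direct sums\<close>

definition free_of_rank ::
    "'k ring \<Rightarrow> ('k, 'm) module \<Rightarrow> nat \<Rightarrow> bool" where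
  "free_of_rank R M d \<longleftrightarrow> Module.module R M \<and>
     (\<exists>B \<subseteq> carrier M. finite B \<and> card B = d \<and>
        \<not> LinearCombinations.module.lin_dep R M B \<and>
        LinearCombinations.module.span R M B = carrier M)"

definition direct_sum_module ::
    "'i set \<Rightarrow> ('i \<Rightarrow> ('k, 'm) module) \<Rightarrow> ('k, 'i \<Rightarrow> 'm) module" where
  "direct_sum_module I M =
     \<lparr> carrier = {f \<in> (\<Pi>\<^sub>E i\<in>I. carrier (M i)). finite {i \<in> I. f i \<noteq> \<zero>\<^bsub>M i\<^esub>}},
       mult = undefined,
       one = undefined,
       zero = (\<lambda>i\<in>I. \<zero>\<^bsub>M i\<^esub>),
       add = (\<lambda>f g. \<lambda>i\<in>I. f i \<oplus>\<^bsub>M i\<^esub> g i),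
       smult = (\<lambda>a f. \<lambda>i\<in>I. a \<odot>\<^bsub>M i\<^esub> f i) \<rparr>"

text \<open>
  The quotient \<open>Z / B\<close> of submodules \<open>B \<subseteq> Z\<close> of a module of finitely supported functions, with
  the cosets \<open>z +o B\<close> as elements. Since \<open>B + B = B\<close>, the elementwise sum of two cosets is a coset;
  the summand \<open>B\<close> in the scalar multiplication turns the image of a coset, which is only a coset of
  a multiple of \<open>B\<close>, into a coset of \<open>B\<close>.
\<close>

definition quotient_module ::
    "('b \<Rightarrow>\<^sub>0 'k::comm_ring_1) set \<Rightarrow> ('b \<Rightarrow>\<^sub>0 'k) set \<Rightarrow> ('k, ('b \<Rightarrow>\<^sub>0 'k) set) module" where
  "quotient_module Z B =
     \<lparr> carrier = (\<lambda>z. z +o B) ` Z,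
       mult = undefined,
       one = undefined,
       zero = B,
       add = (\<lambda>X Y. X + Y),
       smult = (\<lambda>a X. Poly_Mapping.map ((*) a) ` X + B) \<rparr>"

section \<open>Reduced simplicial homology of order complexes\<close>

text \<open>
  A poset is given by its carrier \<open>P\<close> and its strict order \<open>lt\<close>. The order complex contains the
  empty chain, as the unique face of dimension \<open>-1\<close>; this makes the homology reduced.
\<close>

definition order_complex :: "'a set \<Rightarrow> ('a \<Rightarrow> 'a \<Rightarrow> bool) \<Rightarrow> 'a set set" where
  "order_complex P lt =
     {C. C \<subseteq> P \<and> finite C \<and> (\<forall>x\<in>C. \<forall>y\<in>C. x \<noteq> y \<longrightarrow> lt x y \<or> lt y x)}"

definition simplicial_chains ::
    "'a set \<Rightarrow> ('a \<Rightarrow> 'a \<Rightarrow> bool) \<Rightarrow> int \<Rightarrow> ('a set \<Rightarrow>\<^sub>0 'k::comm_ring_1) set" where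
  "simplicial_chains P lt r =
     {c. Poly_Mapping.keys c \<subseteq> {C \<in> order_complex P lt. int (card C) = r + 1}}"

text \<open>
  A face \<open>x\<^sub>0 < \<dots> < x\<^sub>r\<close> is oriented by the order of \<open>P\<close>, so the coefficient of the face omitting
  \<open>x\<^sub>j\<close> is \<open>(-1)^j\<close>, where \<open>j\<close> is the number of elements of the face below \<open>x\<^sub>j\<close>.
\<close>

definition simplicial_boundary ::
    "('a \<Rightarrow> 'a \<Rightarrow> bool) \<Rightarrow> ('a set \<Rightarrow>\<^sub>0 'k::comm_ring_1) \<Rightarrow> ('a set \<Rightarrow>\<^sub>0 'k)" where
  "simplicial_boundary lt c =
     (\<Sum>C\<in>Poly_Mapping.keys c. \<Sum>x\<in>C.
        Poly_Mapping.single (C - {x})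
          ((- 1) ^ card {y \<in> C. lt y x} * Poly_Mapping.lookup c C))"

definition reduced_homology ::
    "'a set \<Rightarrow> ('a \<Rightarrow> 'a \<Rightarrow> bool) \<Rightarrow> int \<Rightarrow> ('k::comm_ring_1, ('a set \<Rightarrow>\<^sub>0 'k) set) module" where
  "reduced_homology P lt r =
     quotient_module
       {c \<in> simplicial_chains P lt r. simplicial_boundary lt c = 0}
       (simplicial_boundary lt ` simplicial_chains P lt (r + 1))"

text \<open>
  Homology of the open interval \<open>(x, y)\<close>. By convention the degenerate interval \<open>(x, x)\<close> has
  homology the coefficient ring in degree \<open>-2\<close> and \<open>0\<close> otherwise, which is the reduced homology of the empty poset
  (the coefficient ring in degree \<open>-1\<close>, \<open>0\<close> otherwise) with the degree shifted by one.
\<close>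

definition interval_homology ::
    "'a set \<Rightarrow> ('a \<Rightarrow> 'a \<Rightarrow> bool) \<Rightarrow> 'a \<Rightarrow> 'a \<Rightarrow> int \<Rightarrow>
       ('k::comm_ring_1, ('a set \<Rightarrow>\<^sub>0 'k) set) module" where
  "interval_homology P lt x y r =
     (if x = y then reduced_homology {} lt (r + 1)
      else reduced_homology {z \<in> P. lt x z \<and> lt z y} lt r)"

section \<open>Weighted partitions\<close>

text \<open>A weighted block \<open>B\<^sup>v\<close> is the pair \<open>(B, v)\<close>.\<close>

type_synonym weighted_partition = "(nat set \<times> nat) set"

definition weighted_partitions :: "nat \<Rightarrow> weighted_partition set" where
  "weighted_partitions n =
     {W. partition_on {1..n} (fst ` W) \<and> inj_on fst W \<and> (\<forall>(B, v)\<in>W. v \<in> {0..card B - 1})}"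

definition wp_le :: "nat \<Rightarrow> weighted_partition \<Rightarrow> weighted_partition \<Rightarrow> bool" where
  "wp_le n X Y \<longleftrightarrow>
     refines {1..n} (fst ` X) (fst ` Y) \<and>
     (\<forall>(B, v)\<in>Y. \<forall>S\<subseteq>X. B = \<Union>(fst ` S) \<longrightarrow>
        int v - (\<Sum>(A, w)\<in>S. int w) \<in> {0..int (card S) - 1})"

definition wp_less :: "nat \<Rightarrow> weighted_partition \<Rightarrow> weighted_partition \<Rightarrow> bool" where
  "wp_less n X Y \<longleftrightarrow> wp_le n X Y \<and> X \<noteq> Y"

definition wp_bot :: "nat \<Rightarrow> weighted_partition" where
  "wp_bot n = (\<lambda>j. ({j}, 0)) ` {1..n}"

definition wp_top :: "nat \<Rightarrow> nat \<Rightarrow> weighted_partition" where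
  "wp_top n i = {({1..n}, i)}"

section \<open>Rooted trees and descents\<close>

text \<open>
  A rooted tree on \<open>V\<close> is given by its root \<open>r\<close> and the set \<open>E\<close> of pairs (node, parent of the node).
\<close>

definition rooted_tree :: "'a set \<Rightarrow> 'a \<Rightarrow> ('a \<times> 'a) set \<Rightarrow> bool" where
  "rooted_tree V r E \<longleftrightarrow>
     r \<in> V \<and> E \<subseteq> (V - {r}) \<times> V \<and>
     (\<forall>v\<in>V - {r}. \<exists>!p. (v, p) \<in> E) \<and> (\<forall>v\<in>V. (v, r) \<in> E\<^sup>*)"

definition descents :: "('a::linorder \<times> 'a) set \<Rightarrow> 'a set" where
  "descents E = {v. \<exists>p. (v, p) \<in> E \<and> v < p}"

definition trees_with_descents :: "nat \<Rightarrow> nat \<Rightarrow> (nat \<times> (nat \<times> nat) set) set" where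
  "trees_with_descents n i = {(r, E). rooted_tree {1..n} r E \<and> card (descents E) = i}"

end

theory Submission
  imports Defs
begin

text \<open>
  A maximal chain from the bottom element merges two blocks at a time, and is encoded by the word of
  labels \<open>(a, b, u)\<close>, where \<open>a < b\<close> are the minima of the merged blocks and \<open>u \<in> {0, 1}\<close> is the weight that is
  added. This labelling behaves like an EL-labelling: in every interval of rank two exactly one chain is
  ascending, and it comes first. Hence a cycle of top degree is determined by its values on the
  ascent-free chains, which can be prescribed arbitrarily, and the homology is free on these chains.

  Ascent-free words use their labels in the order of decreasing \<open>a\<close>. Removing an ascending prefix of
  labels with the largest possible \<open>a\<close>, with signs, gives a recurrence for their generating function by
  weight, with solution \<open>\<Prod>\<^sub>j (j + t (n - j) + s)\<close>, \<open>1 \<le> j < n\<close>. Here \<open>s = 0\<close> for the intervals, and \<open>s = -1\<close> for the whole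
  poset, where the last merge counts as an ascent unless it has weight \<open>1\<close>. Forests, counted by descents
  and roots, satisfy a recurrence under insertion of a new smallest node; it gives the same product
  for trees.
\<close>

section \<open>Modules with a finite coordinate system\<close>

text \<open>In the top degree there are no boundaries, so homology consists of cycles: functions on
  the maximal chains whose sum vanishes over all chains that differ at most at one given rank. Each
  ascent of a chain turns one such equation into a formula for the value at that chain in terms of
  later chains, with pivot 1, so nothing is divided. The obstacle is a chain with several ascents,
  whose value is prescribed several times. That the prescriptions agree is a question about two
  ranks at once: about intervals of rank two if the ranks are apart, and of rank three if they are
  adjacent. Hence the lemmas on labels compare a label with an arbitrary upper bound instead of the
  next element of the chain.

  In the count, an ascending prefix with fixed first entry and k letters contributes 1 + t + ... +
  t^k. Multiplying by 1 - t turns this into 1 - t^(k+1), and binomial sums become differences of two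
  translations of a polynomial. The factor 1 - t has to be cancelled afterwards, so t is kept as an
  indeterminate and set to 1 only at the end.\<close>

definition coordinate_system ::
    "('k::comm_ring_1, 'm) module \<Rightarrow> 'i set \<Rightarrow> ('m \<Rightarrow> 'i \<Rightarrow> 'k) \<Rightarrow> bool" where
  "coordinate_system M I \<phi> \<longleftrightarrow>
     bij_betw \<phi> (carrier M) (I \<rightarrow>\<^sub>E UNIV) \<and>
     (\<forall>x\<in>carrier M. \<forall>y\<in>carrier M.
        x \<oplus>\<^bsub>M\<^esub> y \<in> carrier M \<and> \<phi> (x \<oplus>\<^bsub>M\<^esub> y) = (\<lambda>i\<in>I. \<phi> x i + \<phi> y i)) \<and>
     (\<forall>a. \<forall>x\<in>carrier M.
        a \<odot>\<^bsub>M\<^esub> x \<in> carrier M \<and> \<phi> (a \<odot>\<^bsub>M\<^esub> x) = (\<lambda>i\<in>I. a * \<phi> x i)) \<and>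
     \<zero>\<^bsub>M\<^esub> \<in> carrier M \<and> \<phi> \<zero>\<^bsub>M\<^esub> = (\<lambda>i\<in>I. 0)"

lemma coordinate_systemI:
  assumes "bij_betw \<phi> (carrier M) (I \<rightarrow>\<^sub>E UNIV)"
    and "\<And>x y. x \<in> carrier M \<Longrightarrow> y \<in> carrier M \<Longrightarrow> x \<oplus>\<^bsub>M\<^esub> y \<in> carrier M"
    and "\<And>x y. x \<in> carrier M \<Longrightarrow> y \<in> carrier M \<Longrightarrow> \<phi> (x \<oplus>\<^bsub>M\<^esub> y) = (\<lambda>i\<in>I. \<phi> x i + \<phi> y i)"
    and "\<And>a x. x \<in> carrier M \<Longrightarrow> a \<odot>\<^bsub>M\<^esub> x \<in> carrier M"
    and "\<And>a x. x \<in> carrier M \<Longrightarrow> \<phi> (a \<odot>\<^bsub>M\<^esub> x) = (\<lambda>i\<in>I. a * \<phi> x i)"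
    and "\<zero>\<^bsub>M\<^esub> \<in> carrier M" "\<phi> \<zero>\<^bsub>M\<^esub> = (\<lambda>i\<in>I. 0)"
  shows "coordinate_system M I \<phi>"
  using assms unfolding coordinate_system_def by auto

context
  fixes M :: "('k::comm_ring_1, 'm) module" and I :: "'i set" and \<phi> :: "'m \<Rightarrow> 'i \<Rightarrow> 'k"
  assumes cs: "coordinate_system M I \<phi>"
begin

lemma coord_bij: "bij_betw \<phi> (carrier M) (I \<rightarrow>\<^sub>E UNIV)"
  and coord_add_closed: "x \<in> carrier M \<Longrightarrow> y \<in> carrier M \<Longrightarrow> x \<oplus>\<^bsub>M\<^esub> y \<in> carrier M"
  and coord_add: "x \<in> carrier M \<Longrightarrow> y \<in> carrier M \<Longrightarrow> \<phi> (x \<oplus>\<^bsub>M\<^esub> y) = (\<lambda>i\<in>I. \<phi> x i + \<phi> y i)"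
  and coord_smult_closed: "x \<in> carrier M \<Longrightarrow> a \<odot>\<^bsub>M\<^esub> x \<in> carrier M"
  and coord_smult: "x \<in> carrier M \<Longrightarrow> \<phi> (a \<odot>\<^bsub>M\<^esub> x) = (\<lambda>i\<in>I. a * \<phi> x i)"
  and coord_zero_closed: "\<zero>\<^bsub>M\<^esub> \<in> carrier M"
  and coord_zero: "\<phi> \<zero>\<^bsub>M\<^esub> = (\<lambda>i\<in>I. 0)"
  using cs by (auto simp: coordinate_system_def)

lemma coord_eqI:
  assumes "x \<in> carrier M" "y \<in> carrier M" "\<And>i. i \<in> I \<Longrightarrow> \<phi> x i = \<phi> y i"
  shows "x = y"
proof -
  have "\<phi> x \<in> I \<rightarrow>\<^sub>E UNIV" "\<phi> y \<in> I \<rightarrow>\<^sub>E UNIV"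
    using coord_bij assms by (auto dest: bij_betwE)
  then have "\<phi> x = \<phi> y"
    using assms(3) by (metis PiE_ext)
  then show ?thesis
    using coord_bij assms by (auto simp: bij_betw_def inj_on_def)
qed

lemma coord_surj:
  obtains x where "x \<in> carrier M" "\<And>i. i \<in> I \<Longrightarrow> \<phi> x i = f i"
proof -
  have "restrict f I \<in> \<phi> ` carrier M"
    using coord_bij by (auto simp: bij_betw_def)
  then obtain x where "x \<in> carrier M" "\<phi> x = restrict f I"
    by auto
  then show ?thesis
    using that by simp
qed

text \<open>Homology groups and direct sums are bare records here. Their module laws are pulled back
  along \<open>\<phi>\<close> from functions on \<open>I\<close>.\<close>

lemma coordinate_system_module: "Module.module (class_ring :: 'k ring) M"
proof (rule moduleI)
  show "cring (class_ring :: 'k ring)"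
    by (rule class_cring.is_cring)
  show "abelian_group M"
  proof (rule abelian_groupI)
    fix x assume x: "x \<in> carrier M"
    have "(- 1) \<odot>\<^bsub>M\<^esub> x \<oplus>\<^bsub>M\<^esub> x = \<zero>\<^bsub>M\<^esub>"
      by (rule coord_eqI)
        (auto simp: x coord_add_closed coord_smult_closed coord_zero_closed coord_add coord_smult
          coord_zero)
    then show "\<exists>y\<in>carrier M. y \<oplus>\<^bsub>M\<^esub> x = \<zero>\<^bsub>M\<^esub>"
      using x coord_smult_closed by blast
  qed (auto intro!: coord_eqI simp: coord_add_closed coord_zero_closed coord_add coord_zero
      algebra_simps)
qed (auto intro!: coord_eqI simp: coord_add_closed coord_smult_closed coord_add coord_smult
    algebra_simps)

lemma coord_lincomb:
  assumes "finite A" "A \<subseteq> carrier M" "i \<in> I"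
  shows "LinearCombinations.module.lincomb M c A \<in> carrier M"
    and "\<phi> (LinearCombinations.module.lincomb M c A) i = (\<Sum>v\<in>A. c v * \<phi> v i)"
proof -
  interpret Module.module "class_ring :: 'k ring" M
    by (rule coordinate_system_module)
  have "lincomb c A \<in> carrier M \<and> \<phi> (lincomb c A) i = (\<Sum>v\<in>A. c v * \<phi> v i)"
    using assms(1,2)
  proof (induction A)
    case empty
    then show ?case
      using assms(3) by (simp add: lincomb_def coord_zero)
  next
    case (insert x A)
    have "(\<lambda>v. c v \<odot>\<^bsub>M\<^esub> v) \<in> A \<rightarrow> carrier M" "c x \<odot>\<^bsub>M\<^esub> x \<in> carrier M"
      using insert.prems by (auto simp: coord_smult_closed)
    then have "lincomb c (insert x A) = c x \<odot>\<^bsub>M\<^esub> x \<oplus>\<^bsub>M\<^esub> lincomb c A"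
      using insert.hyps by (simp add: lincomb_def)
    then show ?case
      using insert assms(3) by (simp add: coord_add coord_add_closed coord_smult coord_smult_closed)
  qed
  then show "lincomb c A \<in> carrier M" "\<phi> (lincomb c A) i = (\<Sum>v\<in>A. c v * \<phi> v i)"
    by auto
qed

text \<open>The basis consists of the elements \<open>e i\<close> with unit coordinate vectors; they
  are distinct because 1 and 0 differ. The case \<open>I = {}\<close> is split off wherever
  \<open>coord_lincomb\<close> would need an index.\<close>

lemma coordinate_system_free:
  assumes "finite I"
  shows "free_of_rank (class_ring :: 'k ring) M (card I)"
proof -
  interpret Module.module "class_ring :: 'k ring" M
    by (rule coordinate_system_module)
  have "\<exists>x. x \<in> carrier M \<and> (\<forall>j\<in>I. \<phi> x j = (if j = i then 1 else 0))" for i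
    by (rule coord_surj[of "\<lambda>j. if j = i then 1 else 0"]) auto
  then obtain e where e: "\<And>i. e i \<in> carrier M"
    and e_coord: "\<And>i j. j \<in> I \<Longrightarrow> \<phi> (e i) j = (if j = i then 1 else 0)"
    by metis
  have inj: "inj_on e I"
    by (intro inj_onI) (metis e_coord zero_neq_one)
  have "\<not> lin_dep (e ` I)"
  proof
    assume "lin_dep (e ` I)"
    then obtain A a v where A: "finite A" "A \<subseteq> e ` I" "lincomb a A = \<zero>\<^bsub>M\<^esub>" "v \<in> A" "a v \<noteq> 0"
      by (auto simp: lin_dep_def)
    obtain i where i: "i \<in> I" "v = e i"
      using A by auto
    have "0 = (\<Sum>v\<in>A. a v * \<phi> v i)"
      using coord_lincomb(2)[of A i a] A e i coord_zero by (metis (no_types, lifting) image_subset_iff restrict_apply' subset_iff imageE)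
    also have "\<dots> = (\<Sum>w\<in>A. if w = v then a v else 0)"
    proof (rule sum.cong)
      fix w assume "w \<in> A"
      then obtain j where "j \<in> I" "w = e j"
        using A by auto
      then show "a w * \<phi> w i = (if w = v then a v else 0)"
        using i e_coord inj by (auto simp: inj_on_def)
    qed simp
    also have "\<dots> = a v"
      using A by simp
    finally show False
      using A by simp
  qed
  moreover have "span (e ` I) = carrier M"
  proof
    have "lincomb a A \<in> carrier M" if "finite A" "A \<subseteq> e ` I" for a A
    proof (cases "I = {}")
      case True
      then show ?thesis
        using that by (simp add: lincomb_def)
    next
      case False
      then show ?thesis
        using that e coord_lincomb(1)[of A] by (metis all_not_in_conv image_subset_iff subset_iff imageE)
    qed
    then show "span (e ` I) \<subseteq> carrier M"
      by (auto simp: span_def)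
    show "carrier M \<subseteq> span (e ` I)"
    proof
      fix x assume x: "x \<in> carrier M"
      define a where "a v = \<phi> x (inv_into I e v)" for v
      have "x = lincomb a (e ` I)"
      proof (cases "I = {}")
        case True
        then show ?thesis
          using x coord_eqI[of x "\<zero>\<^bsub>M\<^esub>"] by (simp add: lincomb_def)
      next
        case False
        then obtain i0 where "i0 \<in> I"
          by auto
        then have "lincomb a (e ` I) \<in> carrier M"
          using assms e by (intro coord_lincomb(1)) auto
        then show ?thesis
        proof (rule coord_eqI[OF x])
          fix i assume i: "i \<in> I"
          have "\<phi> (lincomb a (e ` I)) i = (\<Sum>v\<in>e ` I. a v * \<phi> v i)"
            using assms e i by (intro coord_lincomb(2)) auto
          also have "\<dots> = (\<Sum>j\<in>I. \<phi> x j * (if i = j then 1 else 0))"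
            using inj e_coord i by (simp add: sum.reindex a_def)
          also have "\<dots> = \<phi> x i"
            using assms i by (simp add: if_distrib[of "(*) _"] cong: if_cong)
          finally show "\<phi> x i = \<phi> (lincomb a (e ` I)) i"
            by simp
        qed
      qed
      then show "x \<in> span (e ` I)"
        using assms by (auto simp: span_def)
    qed
  qed
  moreover have "e ` I \<subseteq> carrier M" "finite (e ` I)" "card (e ` I) = card I"
    using assms e inj by (auto simp: card_image)
  ultimately show ?thesis
    unfolding free_of_rank_def using module_axioms by blast
qed

end

lemma coordinate_system_direct_sum:
  fixes M :: "'i \<Rightarrow> ('k::comm_ring_1, 'm) module"
  assumes "finite I" and cs: "\<And>i. i \<in> I \<Longrightarrow> coordinate_system (M i) (J i) (\<phi> i)"
  shows "coordinate_system (direct_sum_module I M) (Sigma I J) (\<lambda>f. \<lambda>(i, j)\<in>Sigma I J. \<phi> i (f i) j)"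
    (is "coordinate_system ?D ?S ?\<psi>")
proof (rule coordinate_systemI)
  have car: "carrier ?D = (\<Pi>\<^sub>E i\<in>I. carrier (M i))"
    using assms(1) by (auto simp: direct_sum_module_def)
  note ops = coord_add_closed[OF cs] coord_smult_closed[OF cs] coord_zero_closed[OF cs]
    coord_add[OF cs] coord_smult[OF cs] coord_zero[OF cs]
  show "bij_betw ?\<psi> (carrier ?D) (?S \<rightarrow>\<^sub>E UNIV)"
    unfolding bij_betw_def
  proof
    show "inj_on ?\<psi> (carrier ?D)"
    proof (rule inj_onI)
      fix f g assume fg: "f \<in> carrier ?D" "g \<in> carrier ?D" and eq: "?\<psi> f = ?\<psi> g"
      have "f i = g i" if "i \<in> I" for i
      proof (rule coord_eqI[OF cs[OF that]])
        show "\<phi> i (f i) j = \<phi> i (g i) j" if "j \<in> J i" for j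
          using fun_cong[OF eq, of "(i, j)"] that \<open>i \<in> I\<close> by auto
      qed (use fg that car in auto)
      then show "f = g"
        using fg car by (metis PiE_ext)
    qed
    show "?\<psi> ` carrier ?D = ?S \<rightarrow>\<^sub>E UNIV"
    proof
      show "?\<psi> ` carrier ?D \<subseteq> ?S \<rightarrow>\<^sub>E UNIV"
        by (auto simp: PiE_def extensional_def split: if_splits)
      show "?S \<rightarrow>\<^sub>E UNIV \<subseteq> ?\<psi> ` carrier ?D"
      proof
        fix h :: "'i \<times> _ \<Rightarrow> 'k" assume h: "h \<in> ?S \<rightarrow>\<^sub>E UNIV"
        have "\<exists>x. x \<in> carrier (M i) \<and> (\<forall>j\<in>J i. \<phi> i x j = h (i, j))" if "i \<in> I" for i
          by (rule coord_surj[OF cs[OF that], of "\<lambda>j. h (i, j)"]) auto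
        then obtain x where x: "\<And>i. i \<in> I \<Longrightarrow> x i \<in> carrier (M i)"
          "\<And>i j. i \<in> I \<Longrightarrow> j \<in> J i \<Longrightarrow> \<phi> i (x i) j = h (i, j)"
          by metis
        have "h = ?\<psi> (restrict x I)"
          using h x(2) by (auto simp: fun_eq_iff PiE_def extensional_def)
        then show "h \<in> ?\<psi> ` carrier ?D"
          using x(1) car by auto
      qed
    qed
  qed
  show "\<zero>\<^bsub>?D\<^esub> \<in> carrier ?D" "?\<psi> \<zero>\<^bsub>?D\<^esub> = (\<lambda>i\<in>?S. 0)"
    unfolding car by (auto simp: direct_sum_module_def ops)
  fix f assume f: "f \<in> carrier ?D"
  then have f': "f i \<in> carrier (M i)" if "i \<in> I" for i
    using that car by auto
  show "f \<oplus>\<^bsub>?D\<^esub> g \<in> carrier ?D" "?\<psi> (f \<oplus>\<^bsub>?D\<^esub> g) = (\<lambda>i\<in>?S. ?\<psi> f i + ?\<psi> g i)"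
    if g: "g \<in> carrier ?D" for g
  proof -
    have g': "g i \<in> carrier (M i)" if "i \<in> I" for i
      using that g car by auto
    show "f \<oplus>\<^bsub>?D\<^esub> g \<in> carrier ?D"
      unfolding car by (auto simp: direct_sum_module_def ops f' g')
    show "?\<psi> (f \<oplus>\<^bsub>?D\<^esub> g) = (\<lambda>i\<in>?S. ?\<psi> f i + ?\<psi> g i)"
      by (rule ext) (auto simp: direct_sum_module_def ops f' g')
  qed
  show "a \<odot>\<^bsub>?D\<^esub> f \<in> carrier ?D" for a
    unfolding car by (auto simp: direct_sum_module_def ops f')
  show "?\<psi> (a \<odot>\<^bsub>?D\<^esub> f) = (\<lambda>i\<in>?S. a * ?\<psi> f i)" for a
    by (rule ext) (auto simp: direct_sum_module_def ops f')
qed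

section \<open>Labelled maximal chains\<close>

text \<open>
  The index set \<open>M\<close> lists the maximal chains, \<open>S w j\<close> being the element of rank \<open>j\<close> of the chain \<open>w\<close>.
  An ascent-free chain has no position with \<open>asc\<close>. As in the theory of EL-labellings, the ascents
  allow the values of a cycle on all other chains to be computed from those on the ascent-free ones;
  the last axiom makes the result independent of the ascent that is used.
\<close>

locale chain_labelling =
  fixes m :: nat and M :: "'w set" and S :: "'w \<Rightarrow> nat \<Rightarrow> 'a"
    and asc :: "'w \<Rightarrow> nat \<Rightarrow> bool" and R :: "'w rel"
  assumes finite_M: "finite M"
    and trans_R: "trans R" and irrefl_R: "irrefl R"
    and ascent_exists: "\<And>w j. w \<in> M \<Longrightarrow> j \<in> {1..m} \<Longrightarrow>
      \<exists>w'\<in>M. (\<forall>i\<in>{1..m} - {j}. S w' i = S w i) \<and> asc w' j"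
    and ascents_least: "\<And>w w' j k. w \<in> M \<Longrightarrow> w' \<in> M \<Longrightarrow> j \<in> {1..m} \<Longrightarrow> k \<in> {1..m} \<Longrightarrow>
      asc w j \<Longrightarrow> asc w k \<Longrightarrow> (\<And>i. i \<in> {1..m} - {j, k} \<Longrightarrow> S w' i = S w i) \<Longrightarrow> w' \<noteq> w \<Longrightarrow>
      (w, w') \<in> R"
begin

text \<open>For \<open>K = {j}\<close> these are the maximal chains through one ridge, the face left
  when rank \<open>j\<close> is dropped.\<close>

definition cls :: "nat set \<Rightarrow> 'w \<Rightarrow> 'w set" where
  "cls K w = {w' \<in> M. \<forall>i\<in>{1..m} - K. S w' i = S w i}"

definition ascent_free :: "'w set" where
  "ascent_free = {w \<in> M. \<forall>j\<in>{1..m}. \<not> asc w j}"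

lemma finite_cls: "finite (cls K w)"
  using finite_M by (simp add: cls_def)

lemma cls_eq: "w' \<in> cls K w \<Longrightarrow> cls K w' = cls K w"
  by (auto simp: cls_def)

lemma mem_cls: "w \<in> M \<Longrightarrow> w \<in> cls K w"
  by (simp add: cls_def)

lemma ascent_in_cls:
  assumes "w \<in> M" "j \<in> {1..m}"
  obtains w' where "w' \<in> cls {j} w" "asc w' j"
  using ascent_exists[OF assms] by (auto simp: cls_def)

lemma cls_greater:
  assumes "w \<in> M" "j \<in> {1..m}" "k \<in> {1..m}" "asc w j" "asc w k" "w' \<in> cls {j, k} w" "w' \<noteq> w"
  shows "(w, w') \<in> R"
  using assms by (intro ascents_least[of w w' j k]) (auto simp: cls_def)

lemma cls_greater1:
  assumes "w \<in> M" "j \<in> {1..m}" "asc w j" "w' \<in> cls {j} w" "w' \<noteq> w"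
  shows "(w, w') \<in> R"
  using assms cls_greater[of w j j w'] by simp

lemma obtain_minimal:
  assumes "U \<subseteq> M" "U \<noteq> {}"
  obtains w where "w \<in> U" "\<And>w'. w' \<in> U \<Longrightarrow> (w', w) \<notin> R"
proof -
  have "acyclic R"
    using trans_R irrefl_R by (auto simp: acyclic_def irrefl_def)
  then have "acyclic (R \<inter> U \<times> U)"
    by (rule acyclic_subset) auto
  then have "wf (R \<inter> U \<times> U)"
    using finite_subset[OF assms(1) finite_M] by (intro finite_acyclic_wf) auto
  then obtain w where "w \<in> U" "\<And>w'. (w', w) \<in> R \<inter> U \<times> U \<Longrightarrow> w' \<notin> U"
    using assms(2) by (metis wfE_min all_not_in_conv)
  then show ?thesis
    using that by blast
qed

text \<open>Induction from the \<open>R\<close>-greatest chains downwards: at an ascent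
  \<open>j\<close> of \<open>w\<close> all other chains of \<open>cls {j} w\<close> are greater, so
  the equation of this class leaves only \<open>c w\<close>.\<close>

lemma cycle_zero:
  fixes c :: "'w \<Rightarrow> 'k::ab_group_add"
  assumes cyc: "\<And>w j. w \<in> M \<Longrightarrow> j \<in> {1..m} \<Longrightarrow> (\<Sum>w'\<in>cls {j} w. c w') = 0"
    and zero: "\<And>w. w \<in> ascent_free \<Longrightarrow> c w = 0"
    and "w \<in> M"
  shows "c w = 0"
proof -
  have "acyclic R"
    using trans_R irrefl_R by (auto simp: acyclic_def irrefl_def)
  then have "acyclic ((R \<inter> M \<times> M)\<inverse>)"
    by (metis acyclic_converse acyclic_subset inf_le1)
  then have "wf ((R \<inter> M \<times> M)\<inverse>)"
    using finite_M by (intro finite_acyclic_wf) auto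
  then show ?thesis
    using \<open>w \<in> M\<close>
  proof (induction w)
    case (less w)
    show ?case
    proof (cases "w \<in> ascent_free")
      case False
      then obtain j where j: "j \<in> {1..m}" "asc w j"
        using less.prems by (auto simp: ascent_free_def)
      have "c w' = 0" if "w' \<in> cls {j} w - {w}" for w'
        using that less.prems j by (intro less.IH) (auto intro: cls_greater1 simp: cls_def[of _ w])
      then have "(\<Sum>w'\<in>cls {j} w. c w') = c w"
        using finite_cls mem_cls[OF less.prems, of "{j}"] by (subst sum.remove[of _ w]) auto
      then show ?thesis
        using cyc less.prems j by simp
    qed (rule zero)
  qed
qed

text \<open>The values are built up along sets closed under going up in \<open>R\<close>, adding a
  minimal chain \<open>w\<close> each time. If \<open>w\<close> has an ascent, its value is forced
  by the class equation there; the work is to show that all its ascents force the same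
  value.\<close>

lemma cycle_exists:
  fixes v :: "'w \<Rightarrow> 'k::ab_group_add"
  obtains c where "\<And>w. w \<in> ascent_free \<Longrightarrow> c w = v w"
    and "\<And>w j. w \<in> M \<Longrightarrow> j \<in> {1..m} \<Longrightarrow> (\<Sum>w'\<in>cls {j} w. c w') = 0"
proof -
  \<comment> \<open>Equations are recorded only at ascents. This is enough in the end, since every
    class contains a chain that ascends at the rank in question.\<close>
  define good :: "'w set \<Rightarrow> ('w \<Rightarrow> 'k) \<Rightarrow> bool" where
    "good U c \<longleftrightarrow> (\<forall>w\<in>U \<inter> ascent_free. c w = v w) \<and>
       (\<forall>w\<in>U. \<forall>j\<in>{1..m}. asc w j \<longrightarrow> (\<Sum>w'\<in>cls {j} w. c w') = 0)" for U c
  have "\<exists>c. good U c" if "U \<subseteq> M" "\<And>w w'. w \<in> U \<Longrightarrow> (w, w') \<in> R \<Longrightarrow> w' \<in> M \<Longrightarrow> w' \<in> U" for U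
    using that
  proof (induction "card U" arbitrary: U)
    case 0
    then have "U = {}"
      using finite_subset finite_M by fastforce
    then show ?case
      by (simp add: good_def)
  next
    case (Suc n)
    have "U \<noteq> {}"
      using Suc.hyps(2) by auto
    then obtain w where w: "w \<in> U" "\<And>w'. w' \<in> U \<Longrightarrow> (w', w) \<notin> R"
      using obtain_minimal Suc.prems(1) by metis
    let ?U = "U - {w}"
    have "n = card ?U"
      using Suc.hyps(2) w(1) by simp
    moreover have "w'' \<in> ?U" if "w' \<in> ?U" "(w', w'') \<in> R" "w'' \<in> M" for w' w''
      using that Suc.prems(2) w(2) by blast
    ultimately obtain c where c: "good ?U c"
      using Suc.hyps(1)[of ?U] Suc.prems(1) by blast
    have wM: "w \<in> M"
      using w(1) Suc.prems(1) by auto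
    \<comment> \<open>The equation at an ascent \<open>j\<close> reads
      \<open>c w = - T j\<close>.\<close>
    define T where "T j = (\<Sum>w'\<in>cls {j} w - {w}. c w')" for j
    have T_pair: "T j = (\<Sum>w'\<in>cls {j, k} w - {w}. c w')"
      if jk: "j \<in> {1..m}" "k \<in> {1..m}" "asc w j" "asc w k" for j k
    proof -
      \<comment> \<open>This difference is a disjoint union of classes \<open>cls {j} x0\<close>,
        and \<open>g\<close> separates them. Its sum vanishes class by class, so \<open>T j\<close>
        equals an expression symmetric in \<open>j\<close> and \<open>k\<close>.\<close>
      let ?X = "cls {j, k} w - cls {j} w"
      define g where "g w' = restrict (S w') ({1..m} - {j})" for w'
      have fibre: "{x \<in> ?X. g x = g x0} = cls {j} x0" if "x0 \<in> ?X" for x0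
      proof -
        have g_iff: "g x = g x0 \<longleftrightarrow> (\<forall>i\<in>{1..m} - {j}. S x i = S x0 i)" for x
          by (auto simp: g_def restrict_def fun_eq_iff)
        show ?thesis
          using that unfolding g_iff by (auto simp: cls_def)
      qed
      have "(\<Sum>x\<in>?X. c x) = (\<Sum>y\<in>g ` ?X. \<Sum>x\<in>{x \<in> ?X. g x = y}. c x)"
        using finite_cls by (intro sum.group[symmetric]) auto
      also have "\<dots> = (\<Sum>y\<in>g ` ?X. 0)"
      proof (rule sum.cong)
        fix y assume "y \<in> g ` ?X"
        then obtain x0 where x0: "x0 \<in> ?X" "y = g x0"
          by auto
        then have "x0 \<in> M"
          by (auto simp: cls_def)
        then obtain x1 where x1: "x1 \<in> cls {j} x0" "asc x1 j"
          using ascent_in_cls jk(1) by metis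
        have "x1 \<in> ?X"
          using x1(1) fibre[OF x0(1)] by auto
        \<comment> \<open>By \<open>ascents_least\<close> the ascending member of such a class lies
          above \<open>w\<close>, hence in the part of \<open>U\<close> where the equations already
          hold.\<close>
        moreover have "x1 \<noteq> w"
          using \<open>x1 \<in> ?X\<close> mem_cls[OF wM] by auto
        ultimately have "(w, x1) \<in> R"
          using cls_greater[of w j k x1] jk wM x1(2) by auto
        then have "x1 \<in> ?U"
          using \<open>x1 \<in> ?X\<close> \<open>x1 \<noteq> w\<close> Suc.prems(2) w(1) by (auto simp: cls_def)
        then have "(\<Sum>x\<in>cls {j} x1. c x) = 0"
          using c x1(2) jk(1) by (auto simp: good_def)
        then show "(\<Sum>x\<in>{x \<in> ?X. g x = y}. c x) = 0"
          using x0 fibre cls_eq[OF x1(1)] by simp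
      qed simp
      finally have X0: "(\<Sum>x\<in>?X. c x) = 0"
        by simp
      have "cls {j, k} w - {w} = (cls {j} w - {w}) \<union> ?X"
        using mem_cls[OF wM] by (auto simp: cls_def)
      then have "(\<Sum>x\<in>cls {j, k} w - {w}. c x) = T j + (\<Sum>x\<in>?X. c x)"
        using finite_cls unfolding T_def by (subst sum.union_disjoint[symmetric]) auto
      then show ?thesis
        using X0 by simp
    qed
    have T_eq: "T j = T k" if "j \<in> {1..m}" "k \<in> {1..m}" "asc w j" "asc w k" for j k
      using T_pair[of j k] T_pair[of k j] that by (simp add: insert_commute)
    define x where
      "x = (if w \<in> ascent_free then v w else - T (SOME j. j \<in> {1..m} \<and> asc w j))"
    have x: "x = - T j" if "j \<in> {1..m}" "asc w j" for j
    proof -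
      define k where "k = (SOME j. j \<in> {1..m} \<and> asc w j)"
      have "k \<in> {1..m} \<and> asc w k"
        unfolding k_def by (rule someI[of "\<lambda>j. j \<in> {1..m} \<and> asc w j" j]) (use that in simp)
      then have "T k = T j"
        using T_eq that by blast
      moreover have "w \<notin> ascent_free"
        using that by (auto simp: ascent_free_def)
      ultimately show ?thesis
        by (simp add: x_def k_def)
    qed
    have "good U (c(w := x))"
      unfolding good_def
    proof (intro conjI ballI impI)
      fix w' assume w': "w' \<in> U \<inter> ascent_free"
      then show "(c(w := x)) w' = v w'"
        using c by (cases "w' = w") (auto simp: x_def good_def)
    next
      fix w' j assume w': "w' \<in> U" "j \<in> {1..m}" "asc w' j"
      show "(\<Sum>y\<in>cls {j} w'. (c(w := x)) y) = 0"
      proof (cases "w' = w")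
        case True
        have "(\<Sum>y\<in>cls {j} w. (c(w := x)) y) = x + (\<Sum>y\<in>cls {j} w - {w}. (c(w := x)) y)"
          using finite_cls mem_cls[OF wM] by (subst sum.remove[of _ w]) auto
        also have "(\<Sum>y\<in>cls {j} w - {w}. (c(w := x)) y) = T j"
          unfolding T_def by (intro sum.cong) auto
        also have "x + T j = 0"
          using x[of j] w' True by simp
        finally show ?thesis
          using True by simp
      next
        case False
        then have "w' \<in> ?U" "w' \<in> M"
          using w' Suc.prems(1) by auto
        \<comment> \<open>Minimality of \<open>w\<close> in \<open>U\<close>: changing the value
          there disturbs no equation recorded earlier.\<close>
        have "w \<notin> cls {j} w'"
          using cls_greater1[of w' j w] w' w(2) \<open>w' \<in> M\<close> False by blast
        then have "(\<Sum>y\<in>cls {j} w'. (c(w := x)) y) = (\<Sum>y\<in>cls {j} w'. c y)"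
          by (intro sum.cong) auto
        then show ?thesis
          using c \<open>w' \<in> ?U\<close> w' by (simp add: good_def)
      qed
    qed
    then show ?case
      by blast
  qed
  then obtain c where c: "good M c"
    by blast
  show ?thesis
  proof
    show "c w = v w" if "w \<in> ascent_free" for w
      using that c by (auto simp: good_def ascent_free_def)
    show "(\<Sum>w'\<in>cls {j} w. c w') = 0" if w: "w \<in> M" "j \<in> {1..m}" for w j
    proof -
      obtain w' where "w' \<in> cls {j} w" "asc w' j"
        using ascent_in_cls w by metis
      moreover from this have "w' \<in> M"
        by (simp add: cls_def)
      ultimately show ?thesis
        using c w cls_eq by (metis good_def)
    qed
  qed
qed

end

section \<open>Top homology of the order complex\<close>

locale order_complex_labelling = chain_labelling m M S asc R
  for m :: nat and M :: "'w set" and S :: "'w \<Rightarrow> nat \<Rightarrow> 'a"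
    and asc :: "'w \<Rightarrow> nat \<Rightarrow> bool" and R :: "'w rel" +
  fixes P :: "'a set" and lt :: "'a \<Rightarrow> 'a \<Rightarrow> bool" and rk :: "'a \<Rightarrow> nat"
  assumes rank_less: "\<And>x y. x \<in> P \<Longrightarrow> y \<in> P \<Longrightarrow> lt x y \<Longrightarrow> rk x < rk y"
    and rank_range: "\<And>x. x \<in> P \<Longrightarrow> rk x \<in> {1..m}"
    and S_in: "\<And>w j. w \<in> M \<Longrightarrow> j \<in> {1..m} \<Longrightarrow> S w j \<in> P"
    and S_rank: "\<And>w j. w \<in> M \<Longrightarrow> j \<in> {1..m} \<Longrightarrow> rk (S w j) = j"
    and S_less: "\<And>w i j. w \<in> M \<Longrightarrow> i \<in> {1..m} \<Longrightarrow> j \<in> {1..m} \<Longrightarrow> i < j \<Longrightarrow> lt (S w i) (S w j)"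
    and S_inj: "\<And>w w'. w \<in> M \<Longrightarrow> w' \<in> M \<Longrightarrow> (\<And>j. j \<in> {1..m} \<Longrightarrow> S w j = S w' j) \<Longrightarrow> w = w'"
    and S_complete: "\<And>C. C \<in> order_complex P lt \<Longrightarrow> card C = m \<Longrightarrow> \<exists>w\<in>M. C = S w ` {1..m}"
begin

definition facet :: "'w \<Rightarrow> 'a set" where
  "facet w = S w ` {1..m}"

lemma S_eqD:
  assumes "S w i = S w' j" "w \<in> M" "w' \<in> M" "i \<in> {1..m}" "j \<in> {1..m}"
  shows "i = j"
  using S_rank assms by metis

lemma S_inj_on: "w \<in> M \<Longrightarrow> inj_on (S w) {1..m}"
  by (intro inj_onI) (rule S_eqD)

text \<open>The ranks present in a ridge reveal which rank was dropped, and rank by rank the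
  remaining elements must agree.\<close>

lemma facet_minus_eq_iff:
  assumes "w \<in> M" "w' \<in> M" "i \<in> {1..m}" "j \<in> {1..m}"
  shows "facet w - {S w i} = facet w' - {S w' j} \<longleftrightarrow> i = j \<and> w' \<in> cls {i} w"
proof -
  have f: "facet w - {S w i} = S w ` ({1..m} - {i})" if "w \<in> M" "i \<in> {1..m}" for w i
    using inj_on_image_set_diff[OF S_inj_on[OF that(1)], of "{1..m}" "{i}"] that(2)
    by (simp add: facet_def)
  have r: "rk ` (S w ` ({1..m} - {i})) = {1..m} - {i}" if "w \<in> M" for w i
    using that S_rank by (force simp: image_iff)
  show ?thesis
  proof
    assume eq: "facet w - {S w i} = facet w' - {S w' j}"
    then have eq': "S w ` ({1..m} - {i}) = S w' ` ({1..m} - {j})"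
      using f assms by simp
    then have ij: "i = j"
      using r[of w i] r[of w' j] assms by (metis Diff_iff insertI1 insert_Diff insertE singletonD)
    have "S w' k = S w k" if "k \<in> {1..m} - {i}" for k
    proof -
      have "S w' k \<in> S w ` ({1..m} - {i})"
        using eq' ij that by auto
      then obtain l where l: "l \<in> {1..m} - {i}" "S w' k = S w l"
        by blast
      then have "k = l"
        using S_eqD[of w' k w l] assms that by simp
      then show ?thesis
        using l by simp
    qed
    then show "i = j \<and> w' \<in> cls {i} w"
      using ij assms by (simp add: cls_def)
  next
    assume "i = j \<and> w' \<in> cls {i} w"
    then show "facet w - {S w i} = facet w' - {S w' j}"
      using f assms by (auto simp: cls_def)
  qed
qed

lemma inj_facet: "inj_on facet M"
proof (rule inj_onI)
  fix w w' assume w: "w \<in> M" "w' \<in> M" and eq: "facet w = facet w'"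
  show "w = w'"
  proof (rule S_inj[OF w])
    fix j assume j: "j \<in> {1..m}"
    then have "S w j \<in> S w' ` {1..m}"
      using eq j by (auto simp: facet_def)
    then obtain l where l: "l \<in> {1..m}" "S w j = S w' l"
      by auto
    then have "j = l"
      using S_eqD[of w j w' l] w j by simp
    then show "S w j = S w' j"
      using l by simp
  qed
qed

lemma order_complex_card:
  assumes "C \<in> order_complex P lt"
  shows "card C \<le> m"
proof -
  have "inj_on rk C"
  proof (rule inj_onI, rule ccontr)
    fix x y assume xy: "x \<in> C" "y \<in> C" "rk x = rk y" "x \<noteq> y"
    then have "x \<in> P" "y \<in> P" "lt x y \<or> lt y x"
      using assms by (auto simp: order_complex_def)
    then show False
      using rank_less[of x y] rank_less[of y x] xy(3) by auto
  qed
  moreover have "rk ` C \<subseteq> {1..m}"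
    using assms rank_range by (auto simp: order_complex_def)
  ultimately show ?thesis
    using card_inj_on_le[of rk C "{1..m}"] by simp
qed

lemma facets: "{C \<in> order_complex P lt. card C = m} = facet ` M"
proof -
  have "facet w \<in> order_complex P lt \<and> card (facet w) = m" if w: "w \<in> M" for w
  proof -
    have "card (facet w) = m"
      unfolding facet_def using card_image[OF S_inj_on[OF w]] by simp
    moreover have "lt (S w i) (S w j) \<or> lt (S w j) (S w i)"
      if "i \<in> {1..m}" "j \<in> {1..m}" "S w i \<noteq> S w j" for i j
    proof (cases i j rule: linorder_cases)
      case equal
      then show ?thesis
        using that by simp
    qed (use S_less w that in blast)+
    ultimately show ?thesis
      using w S_in by (auto simp: order_complex_def facet_def)
  qed
  moreover have "C \<in> facet ` M" if "C \<in> order_complex P lt" "card C = m" for C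
    using S_complete[OF that] by (auto simp: facet_def)
  ultimately show ?thesis
    by blast
qed

lemma simplicial_chains_top:
  "simplicial_chains P lt (int m - 1) = {c. Poly_Mapping.keys c \<subseteq> facet ` M}"
  using facets by (auto simp: simplicial_chains_def)

text \<open>Ranks are injective on a chain and lie in \<open>{1..m}\<close>, so no face has
  \<open>m + 1\<close> elements. Hence no nonzero boundaries occur in the top degree.\<close>

lemma simplicial_chains_above: "simplicial_chains P lt (int m - 1 + 1) = {0}"
proof -
  have none: "{C \<in> order_complex P lt. int (card C) = int m - 1 + 1 + 1} = {}"
    using order_complex_card by force
  show ?thesis
    unfolding simplicial_chains_def none by auto
qed

lemma lookup_boundary:
  fixes c :: "'a set \<Rightarrow>\<^sub>0 'k::comm_ring_1"
  assumes "c \<in> simplicial_chains P lt (int m - 1)"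
  shows "Poly_Mapping.lookup (simplicial_boundary lt c) F =
    (\<Sum>w\<in>M. \<Sum>j\<in>{1..m}. if facet w - {S w j} = F
       then (- 1) ^ (j - 1) * Poly_Mapping.lookup c (facet w) else 0)"
proof -
  have keys: "Poly_Mapping.keys c \<subseteq> facet ` M"
    using assms by (simp add: simplicial_chains_top)
  have "Poly_Mapping.lookup (simplicial_boundary lt c) F =
    (\<Sum>C\<in>Poly_Mapping.keys c. \<Sum>x\<in>C. if C - {x} = F
       then (- 1) ^ card {y \<in> C. lt y x} * Poly_Mapping.lookup c C else 0)"
    unfolding simplicial_boundary_def lookup_sum lookup_single when_def ..
  also have "\<dots> = (\<Sum>C\<in>facet ` M. \<Sum>x\<in>C. if C - {x} = F
       then (- 1) ^ card {y \<in> C. lt y x} * Poly_Mapping.lookup c C else 0)"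
    using keys finite_M by (intro sum.mono_neutral_left) (auto simp: in_keys_iff intro!: sum.neutral)
  also have "\<dots> = (\<Sum>w\<in>M. \<Sum>x\<in>facet w. if facet w - {x} = F
       then (- 1) ^ card {y \<in> facet w. lt y x} * Poly_Mapping.lookup c (facet w) else 0)"
    using inj_facet by (simp add: sum.reindex)
  also have "\<dots> = (\<Sum>w\<in>M. \<Sum>j\<in>{1..m}. if facet w - {S w j} = F
       then (- 1) ^ (j - 1) * Poly_Mapping.lookup c (facet w) else 0)"
  proof (rule sum.cong[OF refl])
    fix w assume w: "w \<in> M"
    have inj: "inj_on (S w) {1..m}"
      using S_inj_on w by blast
    \<comment> \<open>The elements below \<open>S w j\<close> are those of ranks 1 to
      \<open>j - 1\<close>, which makes the sign depend on the rank alone.\<close>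
    have card_below: "card {y \<in> facet w. lt y (S w j)} = j - 1" if j: "j \<in> {1..m}" for j
    proof -
      have "lt (S w i) (S w j) \<longleftrightarrow> i < j" if "i \<in> {1..m}" for i
        using S_less[OF w that j] rank_less[OF S_in[OF w that] S_in[OF w j]] S_rank[OF w that]
          S_rank[OF w j] by auto
      then have "{y \<in> facet w. lt y (S w j)} = S w ` {1..<j}"
        using j by (auto simp: facet_def)
      moreover have "inj_on (S w) {1..<j}"
        using inj by (rule inj_on_subset) (use j in auto)
      ultimately show ?thesis
        by (simp add: card_image)
    qed
    have sum_facet: "(\<Sum>x\<in>facet w. h x) = (\<Sum>j\<in>{1..m}. h (S w j))" for h :: "'a \<Rightarrow> 'k"
      unfolding facet_def sum.reindex[OF inj] by simp
    show "(\<Sum>x\<in>facet w. if facet w - {x} = F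
        then (- 1) ^ card {y \<in> facet w. lt y x} * Poly_Mapping.lookup c (facet w) else 0) =
      (\<Sum>j\<in>{1..m}. if facet w - {S w j} = F
        then (- 1) ^ (j - 1) * Poly_Mapping.lookup c (facet w) else 0)"
      unfolding sum_facet by (intro sum.cong refl) (simp only: card_below)
  qed
  finally show ?thesis .
qed

text \<open>A ridge arises only by dropping the same rank \<open>j\<close> from the members of one
  class, so all its contributions carry the common sign \<open>(- 1) ^ (j - 1)\<close>, which can be
  removed.\<close>

lemma boundary_eq_0_iff:
  fixes c :: "'a set \<Rightarrow>\<^sub>0 'k::comm_ring_1"
  assumes "c \<in> simplicial_chains P lt (int m - 1)"
  shows "simplicial_boundary lt c = 0 \<longleftrightarrow>
    (\<forall>w\<in>M. \<forall>j\<in>{1..m}. (\<Sum>w'\<in>cls {j} w. Poly_Mapping.lookup c (facet w')) = 0)"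
proof -
  let ?s = "\<lambda>j w. \<Sum>w'\<in>cls {j} w. Poly_Mapping.lookup c (facet w')"
  have face: "Poly_Mapping.lookup (simplicial_boundary lt c) (facet w0 - {S w0 j0}) =
      (- 1) ^ (j0 - 1) * ?s j0 w0" if w0: "w0 \<in> M" "j0 \<in> {1..m}" for w0 j0
  proof -
    have "Poly_Mapping.lookup (simplicial_boundary lt c) (facet w0 - {S w0 j0}) =
      (\<Sum>w\<in>M. \<Sum>j\<in>{1..m}. if j = j0 then if w \<in> cls {j0} w0
         then (- 1) ^ (j - 1) * Poly_Mapping.lookup c (facet w) else 0 else 0)"
      unfolding lookup_boundary[OF assms]
    proof (intro sum.cong refl)
      fix w j assume wj: "w \<in> M" "j \<in> {1..m}"
      have "facet w - {S w j} = facet w0 - {S w0 j0} \<longleftrightarrow> j = j0 \<and> w \<in> cls {j0} w0"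
        using facet_minus_eq_iff[OF w0(1) wj(1) w0(2) wj(2)] by auto
      then show "(if facet w - {S w j} = facet w0 - {S w0 j0}
          then (- 1) ^ (j - 1) * Poly_Mapping.lookup c (facet w) else 0) =
        (if j = j0 then if w \<in> cls {j0} w0
         then (- 1) ^ (j - 1) * Poly_Mapping.lookup c (facet w) else 0 else 0)"
        by simp
    qed
    also have "\<dots> = (\<Sum>w\<in>M. if w \<in> cls {j0} w0
         then (- 1) ^ (j0 - 1) * Poly_Mapping.lookup c (facet w) else 0)"
      using w0 by simp
    also have "\<dots> = (\<Sum>w\<in>cls {j0} w0. (- 1) ^ (j0 - 1) * Poly_Mapping.lookup c (facet w))"
      using finite_M by (simp add: sum.If_cases cls_def Int_def)
    finally show ?thesis
      by (simp add: sum_distrib_left)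
  qed
  show ?thesis
  proof
    assume z: "simplicial_boundary lt c = 0"
    show "\<forall>w\<in>M. \<forall>j\<in>{1..m}. ?s j w = 0"
    proof (intro ballI)
      fix w j assume "w \<in> M" "j \<in> {1..m}"
      then have "(- 1) ^ (j - 1) * ?s j w = 0"
        using face[of w j] z by simp
      \<comment> \<open>The sign is its own inverse, so a second multiplication cancels it.\<close>
      then have "(- 1) ^ (j - 1) * ((- 1) ^ (j - 1) * ?s j w) = 0"
        by simp
      then show "?s j w = 0"
        by (simp add: mult.assoc[symmetric] power_add[symmetric] mult_2[symmetric])
    qed
  next
    assume z: "\<forall>w\<in>M. \<forall>j\<in>{1..m}. ?s j w = 0"
    have "Poly_Mapping.lookup (simplicial_boundary lt c) F = 0" for F
    proof (cases "\<exists>w\<in>M. \<exists>j\<in>{1..m}. facet w - {S w j} = F")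
      case True
      then show ?thesis
        using face z by fastforce
    next
      case False
      then show ?thesis
        unfolding lookup_boundary[OF assms] by (intro sum.neutral ballI) auto
    qed
    then show "simplicial_boundary lt c = 0"
      by (simp add: poly_mapping_eqI)
  qed
qed

text \<open>Cosets of the zero submodule are singletons, so \<open>the_elem\<close> returns the
  cycle itself. Injectivity is \<open>cycle_zero\<close> for a difference of cycles, surjectivity is
  \<open>cycle_exists\<close>.\<close>

theorem coordinate_system_top_homology:
  "coordinate_system (reduced_homology P lt (int m - 1) :: ('k::comm_ring_1, _) module) ascent_free
     (\<lambda>X. \<lambda>w\<in>ascent_free. Poly_Mapping.lookup (the_elem X) (facet w))"
proof -
  define Z where "Z = {c \<in> simplicial_chains P lt (int m - 1).
    simplicial_boundary lt c = (0 :: 'a set \<Rightarrow>\<^sub>0 'k)}"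
  have bd0: "simplicial_boundary lt (0 :: 'a set \<Rightarrow>\<^sub>0 'k) = 0"
    by (simp add: simplicial_boundary_def)
  have coset: "z +o {0} = {z}" for z :: "'a set \<Rightarrow>\<^sub>0 'k"
    by (simp add: elt_set_plus_def)
  have H: "reduced_homology P lt (int m - 1) = quotient_module Z {0}"
    unfolding reduced_homology_def simplicial_chains_above Z_def by (simp add: bd0)
  have Z_iff: "c \<in> Z \<longleftrightarrow> Poly_Mapping.keys c \<subseteq> facet ` M \<and>
      (\<forall>w\<in>M. \<forall>j\<in>{1..m}. (\<Sum>w'\<in>cls {j} w. Poly_Mapping.lookup c (facet w')) = 0)" for c
    using boundary_eq_0_iff[of c] by (auto simp: Z_def simplicial_chains_top)
  have Z0: "0 \<in> Z"
    by (simp add: Z_iff)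
  have Zadd: "c + d \<in> Z" if "c \<in> Z" "d \<in> Z" for c d
  proof -
    have "Poly_Mapping.keys (c + d) \<subseteq> facet ` M"
      using that Poly_Mapping.keys_add[of c d] by (auto simp: Z_iff)
    then show ?thesis
      using that by (simp add: Z_iff lookup_add sum.distrib)
  qed
  have lookup_smult: "Poly_Mapping.lookup (Poly_Mapping.map ((*) a) c) x = a * Poly_Mapping.lookup c x"
    for a :: 'k and c :: "'a set \<Rightarrow>\<^sub>0 'k" and x
    by (simp add: Poly_Mapping.map.rep_eq when_def)
  have Zsmult: "Poly_Mapping.map ((*) a) c \<in> Z" if "c \<in> Z" for a c
  proof -
    have "Poly_Mapping.keys (Poly_Mapping.map ((*) a) c) \<subseteq> facet ` M"
      using that by (auto simp: Z_iff in_keys_iff lookup_smult subset_iff) (metis mult_zero_right)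
    then show ?thesis
      using that by (simp add: Z_iff lookup_smult sum_distrib_left[symmetric])
  qed
  let ?\<phi> = "\<lambda>X. \<lambda>w\<in>ascent_free. Poly_Mapping.lookup (the_elem X) (facet w)"
  have car: "carrier (quotient_module Z {0}) = (\<lambda>z. {z}) ` Z"
    by (simp add: quotient_module_def coset)
  have ops: "x \<oplus>\<^bsub>quotient_module Z {0}\<^esub> y = x + y" "\<zero>\<^bsub>quotient_module Z {0}\<^esub> = {0}"
    "a \<odot>\<^bsub>quotient_module Z {0}\<^esub> x = Poly_Mapping.map ((*) a) ` x + {0}" for a x y
    by (simp_all add: quotient_module_def)
  show ?thesis
    unfolding H
  proof (rule coordinate_systemI)
    show "bij_betw ?\<phi> (carrier (quotient_module Z {0})) (ascent_free \<rightarrow>\<^sub>E UNIV)"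
      unfolding bij_betw_def
    proof
      show "inj_on ?\<phi> (carrier (quotient_module Z {0}))"
      proof (rule inj_onI)
        fix X Y assume "X \<in> carrier (quotient_module Z {0})" "Y \<in> carrier (quotient_module Z {0})"
          and eq: "?\<phi> X = ?\<phi> Y"
        then obtain c d where cd: "c \<in> Z" "d \<in> Z" "X = {c}" "Y = {d}"
          unfolding car by auto
        have "Poly_Mapping.lookup c (facet w) - Poly_Mapping.lookup d (facet w) = 0" if "w \<in> M" for w
          using that
        proof (rule cycle_zero[rotated 2])
          fix w assume "w \<in> ascent_free"
          then show "Poly_Mapping.lookup c (facet w) - Poly_Mapping.lookup d (facet w) = 0"
            using fun_cong[OF eq, of w] cd by simp
        qed (use cd in \<open>simp add: Z_iff sum_subtractf\<close>)
        then have "Poly_Mapping.lookup c C = Poly_Mapping.lookup d C" for C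
          using cd(1,2) by (cases "C \<in> facet ` M") (auto simp: Z_iff in_keys_iff subset_iff, metis)
        then show "X = Y"
          using cd by (simp add: poly_mapping_eqI)
      qed
      show "?\<phi> ` carrier (quotient_module Z {0}) = ascent_free \<rightarrow>\<^sub>E UNIV"
      proof
        show "ascent_free \<rightarrow>\<^sub>E UNIV \<subseteq> ?\<phi> ` carrier (quotient_module Z {0})"
        proof
          fix v :: "'w \<Rightarrow> 'k" assume v: "v \<in> ascent_free \<rightarrow>\<^sub>E UNIV"
          obtain c where c: "\<And>w. w \<in> ascent_free \<Longrightarrow> c w = v w"
            "\<And>w j. w \<in> M \<Longrightarrow> j \<in> {1..m} \<Longrightarrow> (\<Sum>w'\<in>cls {j} w. c w') = 0"
            using cycle_exists[of v] by metis
          define d where "d = (\<Sum>w\<in>M. Poly_Mapping.single (facet w) (c w))"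
          have d: "Poly_Mapping.lookup d (facet w) = c w" if "w \<in> M" for w
          proof -
            have "Poly_Mapping.lookup d (facet w) = (\<Sum>w'\<in>M. if w' = w then c w else 0)"
              unfolding d_def lookup_sum
              using that inj_facet by (intro sum.cong) (auto simp: lookup_single when_def inj_on_def)
            then show ?thesis
              using that finite_M by simp
          qed
          have "Poly_Mapping.lookup d C = 0" if "C \<notin> facet ` M" for C
            unfolding d_def lookup_sum using that by (intro sum.neutral) (auto simp: lookup_single when_def)
          then have "Poly_Mapping.keys d \<subseteq> facet ` M"
            by (auto simp: in_keys_iff)
          moreover have "(\<Sum>w'\<in>cls {j} w. Poly_Mapping.lookup d (facet w')) = 0"
            if "w \<in> M" "j \<in> {1..m}" for w j
            using c(2)[OF that] d by (simp add: cls_def)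
          ultimately have "d \<in> Z"
            by (simp add: Z_iff)
          moreover have "?\<phi> {d} = v"
            using v c(1) d by (auto simp: fun_eq_iff PiE_def extensional_def ascent_free_def)
          ultimately show "v \<in> ?\<phi> ` carrier (quotient_module Z {0})"
            unfolding car by (intro image_eqI[of _ _ "{d}"]) auto
        qed
      qed auto
    qed
  qed (use Z0 Zadd Zsmult in \<open>auto simp: car ops lookup_add lookup_smult set_plus_def\<close>)
qed

end

section \<open>Merging blocks\<close>

text \<open>
  A weighted partition of \<open>{1..n}\<close> is encoded by the map sending every element to the minimum of its
  block, and the map sending the minimum of a block to the weight of the block. Outside \<open>{1..n}\<close> the
  former is the identity, and the latter vanishes at all other arguments. A label \<open>(a, b, u)\<close> merges
  the blocks with minima \<open>a < b\<close> and adds \<open>u\<close> to the sum of their weights.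
\<close>

type_synonym state = "(nat \<Rightarrow> nat) \<times> (nat \<Rightarrow> nat)"

type_synonym label = "nat \<times> nat \<times> nat"

definition raw_state :: "nat \<Rightarrow> state \<Rightarrow> bool" where
  "raw_state n X \<longleftrightarrow>
     (\<forall>x. fst X x \<le> x) \<and> (\<forall>x. fst X (fst X x) = fst X x) \<and>
     (\<forall>x\<in>{1..n}. fst X x \<in> {1..n}) \<and> (\<forall>x. x \<notin> {1..n} \<longrightarrow> fst X x = x) \<and>
     (\<forall>a. a \<notin> {1..n} \<or> fst X a \<noteq> a \<longrightarrow> snd X a = 0)"

definition mins :: "nat \<Rightarrow> state \<Rightarrow> nat set" where
  "mins n X = {a \<in> {1..n}. fst X a = a}"

definition parts :: "nat \<Rightarrow> state \<Rightarrow> state \<Rightarrow> nat \<Rightarrow> nat set" where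
  "parts n X Z c = {a \<in> mins n X. fst Z a = c}"

definition wsum :: "nat \<Rightarrow> state \<Rightarrow> state \<Rightarrow> nat \<Rightarrow> nat" where
  "wsum n X Z c = (\<Sum>a\<in>parts n X Z c. snd X a)"

definition state_le :: "nat \<Rightarrow> state \<Rightarrow> state \<Rightarrow> bool" where
  "state_le n X Z \<longleftrightarrow> (\<forall>x. fst Z (fst X x) = fst Z x) \<and>
     (\<forall>c\<in>mins n Z. wsum n X Z c \<le> snd Z c \<and> snd Z c < wsum n X Z c + card (parts n X Z c))"

definition bot_state :: state where
  "bot_state = (\<lambda>x. x, \<lambda>_. 0)"

text \<open>The bound on the block weights is the relation to the bottom element, as every block of
  \<open>bot_state\<close> is a singleton of weight 0. In this form it passes to larger states by
  transitivity.\<close>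

definition is_state :: "nat \<Rightarrow> state \<Rightarrow> bool" where
  "is_state n X \<longleftrightarrow> raw_state n X \<and> state_le n bot_state X"

fun merge :: "state \<Rightarrow> label \<Rightarrow> state" where
  "merge X (a, b, u) = (\<lambda>x. if fst X x = b then a else fst X x,
     (snd X)(a := snd X a + snd X b + u, b := 0))"

fun valid_label :: "nat set \<Rightarrow> label \<Rightarrow> bool" where
  "valid_label L (a, b, u) \<longleftrightarrow> a \<in> L \<and> b \<in> L \<and> a < b \<and> u \<le> 1"

fun ascent :: "label \<Rightarrow> label \<Rightarrow> bool" where
  "ascent (a, b, u) (a', b', u') \<longleftrightarrow> a < a' \<or> a = a' \<and> b < b' \<and> u \<le> u'"

text \<open>A linear order containing \<open>ascent\<close>. Chains are compared with it, while
  ascents are judged by the partial relation, in which weight 1 followed by weight 0 at the same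
  \<open>a\<close> is no ascent.\<close>

definition label_less :: "label rel" where
  "label_less = less_than <*lex*> less_than <*lex*> less_than"

definition nontriv :: "nat \<Rightarrow> state \<Rightarrow> state \<Rightarrow> nat set" where
  "nontriv n X Z = {c \<in> mins n Z. 2 \<le> card (parts n X Z c)}"

text \<open>
  The least label of a merge from \<open>X\<close> that stays below an upper bound. The bound \<open>None\<close> is an artificial top
  element; it behaves like a last merge, of weight \<open>0\<close>, with an extra element \<open>n + 1\<close>.
\<close>

fun least_label :: "nat \<Rightarrow> state \<Rightarrow> state option \<Rightarrow> label" where
  "least_label n X None = (1, Min (insert (n + 1) (mins n X) - {1}), 0)"
| "least_label n X (Some Z) =
    (let c = Min (nontriv n X Z) in
       (c, Min (parts n X Z c - {c}), if snd Z c + 1 = wsum n X Z c + card (parts n X Z c) then 1 else 0))"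

fun below :: "nat \<Rightarrow> state \<Rightarrow> state option \<Rightarrow> bool" where
  "below n X None \<longleftrightarrow> True"
| "below n X (Some Z) \<longleftrightarrow> raw_state n Z \<and> state_le n X Z"

fun mergeable :: "nat \<Rightarrow> state \<Rightarrow> state option \<Rightarrow> bool" where
  "mergeable n X None \<longleftrightarrow> 2 \<le> card (mins n X)"
| "mergeable n X (Some Z) \<longleftrightarrow> nontriv n X Z \<noteq> {}"

section \<open>The order on states\<close>

lemma finite_mins [simp]: "finite (mins n X)"
  and finite_parts [simp]: "finite (parts n X Z c)"
  and finite_nontriv [simp]: "finite (nontriv n X Z)"
  by (auto simp: mins_def parts_def nontriv_def)

lemma raw_stateD:
  assumes "raw_state n X"
  shows "fst X x \<le> x" "fst X (fst X x) = fst X x" "x \<in> {1..n} \<Longrightarrow> fst X x \<in> {1..n}"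
    "x \<notin> {1..n} \<Longrightarrow> fst X x = x" "a \<notin> mins n X \<Longrightarrow> snd X a = 0"
  using assms unfolding raw_state_def mins_def by blast+

lemma raw_state_eqI:
  assumes "raw_state n X" "raw_state n Y" "\<And>x. x \<in> {1..n} \<Longrightarrow> fst X x = fst Y x"
    and "\<And>a. a \<in> mins n X \<Longrightarrow> snd X a = snd Y a"
  shows "X = Y"
proof (rule prod_eqI; rule ext)
  show p: "fst X x = fst Y x" for x
    using assms raw_stateD(4) by (cases "x \<in> {1..n}") auto
  then have "mins n X = mins n Y"
    by (simp add: mins_def)
  then show "snd X a = snd Y a" for a
    using assms raw_stateD(5) by (cases "a \<in> mins n X") auto
qed

lemma raw_bot: "raw_state n bot_state"
  and mins_bot: "mins n bot_state = {1..n}"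
  by (auto simp: raw_state_def bot_state_def mins_def)

lemma is_state_raw: "is_state n X \<Longrightarrow> raw_state n X"
  by (simp add: is_state_def)

lemma rep_mem_mins: "raw_state n X \<Longrightarrow> x \<in> {1..n} \<Longrightarrow> fst X x \<in> mins n X"
  using raw_stateD unfolding mins_def by blast

lemma one_mem_mins: "raw_state n X \<Longrightarrow> 1 \<le> n \<Longrightarrow> 1 \<in> mins n X"
  using raw_stateD(1)[of n X 1] raw_stateD(3)[of n X 1] by (auto simp: mins_def)

lemma state_le_refl:
  assumes "raw_state n X"
  shows "state_le n X X"
proof -
  have "parts n X X c = {c}" if "c \<in> mins n X" for c
    using that by (auto simp: parts_def mins_def)
  then show ?thesis
    using raw_stateD[OF assms] by (simp add: state_le_def wsum_def)
qed

lemma is_state_bot: "is_state n bot_state"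
  using state_le_refl raw_bot by (simp add: is_state_def)

lemma state_le_rep: "state_le n X Z \<Longrightarrow> fst Z (fst X x) = fst Z x"
  by (simp add: state_le_def)

lemma mem_parts_self:
  assumes "raw_state n X" "raw_state n Z" "state_le n X Z" "c \<in> mins n Z"
  shows "c \<in> parts n X Z c"
proof -
  have "fst Z c = c" "c \<in> {1..n}"
    using assms(4) by (auto simp: mins_def)
  then have "c = fst Z (fst X c)"
    using state_le_rep[OF assms(3)] by simp
  then have "c \<le> fst X c"
    using raw_stateD(1)[OF assms(2), of "fst X c"] by simp
  then have "fst X c = c"
    using raw_stateD(1)[OF assms(1), of c] by simp
  then show ?thesis
    using \<open>fst Z c = c\<close> \<open>c \<in> {1..n}\<close> by (simp add: parts_def mins_def)
qed

lemma mins_antimono: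
  assumes "raw_state n X" "raw_state n Z" "state_le n X Z"
  shows "mins n Z \<subseteq> mins n X"
  using mem_parts_self[OF assms] by (auto simp: parts_def)

text \<open>The minima of \<open>Z\<close> are among those of \<open>X\<close>, so equal numbers
  force equal sets. Then every block of \<open>Z\<close> is a single block of \<open>X\<close>, and
  the weight condition leaves no freedom.\<close>

lemma state_le_eqI:
  assumes "raw_state n X" "raw_state n Z" "state_le n X Z" "card (mins n X) \<le> card (mins n Z)"
  shows "X = Z"
proof (rule raw_state_eqI[OF assms(1,2)])
  have eq: "mins n Z = mins n X"
    using mins_antimono[OF assms(1-3)] assms(4) by (intro card_seteq) auto
  have fixed: "fst Z y = y" if "y \<in> mins n X" for y
    using that unfolding eq[symmetric] by (simp add: mins_def)
  show "fst X x = fst Z x" if "x \<in> {1..n}" for x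
    using fixed[OF rep_mem_mins[OF assms(1) that]] state_le_rep[OF assms(3), of x] by simp
  show "snd X c = snd Z c" if c: "c \<in> mins n X" for c
  proof -
    have "parts n X Z c = {c}"
      using c fixed by (auto simp: parts_def)
    then show ?thesis
      using assms(3) c eq by (auto simp: state_le_def wsum_def)
  qed
qed

lemma state_le_less_card:
  assumes "raw_state n X" "raw_state n Z" "state_le n X Z" "X \<noteq> Z"
  shows "card (mins n Z) < card (mins n X)"
  using state_le_eqI[OF assms(1-3)] assms(4) by (meson not_less)

text \<open>The parts of a block of \<open>W\<close> in \<open>X\<close> are the disjoint union of
  the parts of its \<open>Z\<close>-parts. Lower bounds add up directly; upper bounds add up when
  written as weight plus 1 at most \<open>wsum\<close> plus number of parts.\<close>

lemma state_le_trans: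
  assumes "raw_state n X" "raw_state n Z" "raw_state n W" "state_le n X Z" "state_le n Z W"
  shows "state_le n X W"
  unfolding state_le_def
proof (intro conjI allI ballI)
  show "fst W (fst X x) = fst W x" for x
    using state_le_rep[OF assms(4), of x] state_le_rep[OF assms(5), of x] state_le_rep[OF assms(5), of "fst X x"]
    by simp
  fix c assume c: "c \<in> mins n W"
  have un: "parts n X W c = (\<Union>d\<in>parts n Z W c. parts n X Z d)"
    using rep_mem_mins[OF assms(2)] state_le_rep[OF assms(5)] by (auto simp: parts_def mins_def)
  have disj: "\<forall>d\<in>parts n Z W c. \<forall>d'\<in>parts n Z W c. d \<noteq> d' \<longrightarrow> parts n X Z d \<inter> parts n X Z d' = {}"
    by (auto simp: parts_def)
  have ws: "wsum n X W c = (\<Sum>d\<in>parts n Z W c. wsum n X Z d)"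
    unfolding wsum_def un using disj by (intro sum.UNION_disjoint) auto
  have cd: "card (parts n X W c) = (\<Sum>d\<in>parts n Z W c. card (parts n X Z d))"
    unfolding un using disj by (intro card_UN_disjoint) auto
  have d: "wsum n X Z d \<le> snd Z d" "snd Z d + 1 \<le> wsum n X Z d + card (parts n X Z d)"
    if "d \<in> parts n Z W c" for d
  proof -
    have "d \<in> mins n Z"
      using that by (simp add: parts_def)
    then show "wsum n X Z d \<le> snd Z d" "snd Z d + 1 \<le> wsum n X Z d + card (parts n X Z d)"
      using assms(4) by (auto simp: state_le_def)
  qed
  have W: "wsum n Z W c \<le> snd W c" "snd W c < wsum n Z W c + card (parts n Z W c)"
    using assms(5) c by (auto simp: state_le_def)
  have "wsum n X W c \<le> wsum n Z W c"
    unfolding ws wsum_def[of n Z W c] by (intro sum_mono d)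
  then show "wsum n X W c \<le> snd W c"
    using W(1) by simp
  have "wsum n Z W c + card (parts n Z W c) = (\<Sum>d\<in>parts n Z W c. snd Z d + 1)"
    unfolding wsum_def by (simp only: sum.distrib card_eq_sum)
  also have "\<dots> \<le> (\<Sum>d\<in>parts n Z W c. wsum n X Z d + card (parts n X Z d))"
    by (intro sum_mono d)
  also have "\<dots> = wsum n X W c + card (parts n X W c)"
    unfolding ws cd by (simp add: sum.distrib)
  finally show "snd W c < wsum n X W c + card (parts n X W c)"
    using W(2) by simp
qed

section \<open>Merges and the order\<close>

lemma fst_merge: "fst (merge X (a, b, u)) x = (if fst X x = b then a else fst X x)"
  by simp

lemma raw_merge:
  assumes X: "raw_state n X" and "valid_label (mins n X) l"
  shows "raw_state n (merge X l)"
proof -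
  obtain a b u where l: "l = (a, b, u)"
    by (cases l)
  then have ab: "a \<in> {1..n}" "b \<in> {1..n}" "fst X a = a" "fst X b = b" "a < b"
    using assms(2) by (auto simp: mins_def)
  show ?thesis
    unfolding raw_state_def l
  proof (intro conjI allI ballI impI)
    show "fst (merge X (a, b, u)) x \<le> x" for x
      using raw_stateD(1)[OF X, of x] ab by auto
    show "fst (merge X (a, b, u)) (fst (merge X (a, b, u)) x) = fst (merge X (a, b, u)) x" for x
      using raw_stateD(2)[OF X, of x] ab by auto
    show "fst (merge X (a, b, u)) x \<in> {1..n}" if "x \<in> {1..n}" for x
      using raw_stateD(3)[OF X, of x] ab that by auto
    show "fst (merge X (a, b, u)) x = x" if "x \<notin> {1..n}" for x
      using raw_stateD(4)[OF X, of x] ab that by auto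
    fix x assume "x \<notin> {1..n} \<or> fst (merge X (a, b, u)) x \<noteq> x"
    then have "x = b \<or> x \<noteq> a \<and> x \<notin> mins n X"
      using ab by (auto simp: mins_def split: if_splits)
    then show "snd (merge X (a, b, u)) x = 0"
      using raw_stateD(5)[OF X, of x] by auto
  qed
qed

lemma mins_merge:
  assumes "raw_state n X" "valid_label (mins n X) (a, b, u)"
  shows "mins n (merge X (a, b, u)) = mins n X - {b}"
  using assms raw_stateD(2)[OF assms(1)] by (auto simp: mins_def)

lemma ball_replace:
  assumes "\<And>c. c \<noteq> z \<Longrightarrow> P c = Q c" "P z = C" "C \<Longrightarrow> Q z" "z \<in> A"
  shows "(\<forall>c\<in>A. P c) \<longleftrightarrow> (\<forall>c\<in>A. Q c) \<and> C"
  using assms by metis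

context
  fixes n X Z a b u
  assumes X: "raw_state n X" and Z: "raw_state n Z" and ok: "valid_label (mins n X) (a, b, u)"
begin

lemma parts_merge:
  "parts n (merge X (a, b, u)) Z c = parts n X Z c - {b}"
  unfolding parts_def mins_merge[OF X ok] by auto

lemma wsum_merge:
  assumes "fst Z a = fst Z b"
  shows "wsum n (merge X (a, b, u)) Z c = wsum n X Z c + (if c = fst Z a then u else 0)"
proof (cases "c = fst Z a")
  case True
  then have ab: "a \<in> parts n X Z c" "b \<in> parts n X Z c - {a}" "a \<in> parts n X Z c - {b}" "a \<noteq> b"
    using ok assms by (auto simp: parts_def)
  have "wsum n X Z c = snd X a + (snd X b + (\<Sum>d\<in>parts n X Z c - {a} - {b}. snd X d))"
    unfolding wsum_def using ab by (simp add: sum.remove[of _ a] sum.remove[of _ b])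
  moreover have "wsum n (merge X (a, b, u)) Z c =
      (snd X a + snd X b + u) + (\<Sum>d\<in>parts n X Z c - {b} - {a}. snd (merge X (a, b, u)) d)"
    unfolding wsum_def parts_merge using ab by (subst sum.remove[of _ a]) auto
  moreover have "(\<Sum>d\<in>parts n X Z c - {b} - {a}. snd (merge X (a, b, u)) d) =
      (\<Sum>d\<in>parts n X Z c - {a} - {b}. snd X d)"
    by (intro sum.cong) auto
  ultimately show ?thesis
    using True by simp
next
  case False
  then have "a \<notin> parts n X Z c" "b \<notin> parts n X Z c"
    using assms by (auto simp: parts_def)
  then show ?thesis
    using False unfolding wsum_def parts_merge by (auto intro!: sum.cong)
qed

lemma card_parts_merge:
  "card (parts n (merge X (a, b, u)) Z c) = card (parts n X Z c) - (if c = fst Z b then 1 else 0)"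
  unfolding parts_merge using ok by (auto simp: parts_def card_Diff_singleton)

text \<open>Only the block of \<open>Z\<close> containing \<open>a\<close> notices the merge: it has
  one part fewer and its parts weigh \<open>u\<close> more. As \<open>u\<close> is at most 1, the
  new bounds imply the old ones, so \<open>state_le n X Z\<close> can be split off.\<close>

lemma state_le_merge_iff:
  "state_le n (merge X (a, b, u)) Z \<longleftrightarrow> state_le n X Z \<and> fst Z a = fst Z b \<and>
     wsum n X Z (fst Z a) + u \<le> snd Z (fst Z a) \<and>
     snd Z (fst Z a) + 1 < wsum n X Z (fst Z a) + u + card (parts n X Z (fst Z a))"
    (is "?L \<longleftrightarrow> ?R")
proof -
  have ab: "a \<in> {1..n}" "fst X b = b" "fst X a = a" "a < b" "a \<in> mins n X" "b \<in> mins n X"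
    using ok by (auto simp: mins_def)
  have za: "fst Z a \<in> mins n Z"
    using rep_mem_mins[OF Z] ab by simp
  have refs: "(\<forall>x. fst Z (fst (merge X (a, b, u)) x) = fst Z x) \<longleftrightarrow>
      (\<forall>x. fst Z (fst X x) = fst Z x) \<and> fst Z a = fst Z b"
    using ab by (simp only: fst_merge) (smt (verit) ab(2))
  have card2: "2 \<le> card (parts n X Z (fst Z a))" if "fst Z a = fst Z b"
  proof -
    have "{a, b} \<subseteq> parts n X Z (fst Z a)"
      using ab that by (auto simp: parts_def)
    then have "card {a, b} \<le> card (parts n X Z (fst Z a))"
      by (intro card_mono) auto
    then show ?thesis
      using ab by simp
  qed
  show ?thesis
  proof (cases "fst Z a = fst Z b")
    case True
    have "(\<forall>c\<in>mins n Z. wsum n (merge X (a, b, u)) Z c \<le> snd Z c \<and>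
        snd Z c < wsum n (merge X (a, b, u)) Z c + card (parts n (merge X (a, b, u)) Z c)) \<longleftrightarrow>
      (\<forall>c\<in>mins n Z. wsum n X Z c \<le> snd Z c \<and> snd Z c < wsum n X Z c + card (parts n X Z c)) \<and>
       wsum n X Z (fst Z a) + u \<le> snd Z (fst Z a) \<and>
       snd Z (fst Z a) + 1 < wsum n X Z (fst Z a) + u + card (parts n X Z (fst Z a))"
      (is "(\<forall>c\<in>_. ?P c) \<longleftrightarrow> (\<forall>c\<in>_. ?Q c) \<and> ?C")
    proof -
      have "?P c \<longleftrightarrow> ?Q c" if "c \<noteq> fst Z a" for c
        using that True unfolding wsum_merge[OF True] card_parts_merge by simp
      moreover have "?P (fst Z a) \<longleftrightarrow> ?C"
        using card2[OF True] True unfolding wsum_merge[OF True] card_parts_merge by auto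
      moreover have "?C \<Longrightarrow> ?Q (fst Z a)"
        using ok by auto
      ultimately show ?thesis
        using za by (intro ball_replace[where z = "fst Z a"]) blast+
    qed
    then show ?thesis
      unfolding state_le_def refs using True by blast
  next
    case False
    then show ?thesis
      unfolding state_le_def refs by blast
  qed
qed

end

lemma state_le_merge:
  assumes "raw_state n X" "valid_label (mins n X) l"
  shows "state_le n X (merge X l)"
proof -
  obtain a b u where l: "l = (a, b, u)"
    by (cases l)
  show ?thesis
    using state_le_merge_iff[of n X "merge X l" a b u] state_le_refl[OF raw_merge[OF assms]] raw_merge[OF assms] assms
    unfolding l by blast
qed

lemma is_state_merge: "is_state n X \<Longrightarrow> valid_label (mins n X) l \<Longrightarrow> is_state n (merge X l)"
  unfolding is_state_def using state_le_merge state_le_trans raw_bot raw_merge by blast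

text \<open>\<open>b\<close> is the minimum that disappears, \<open>a\<close> is its new
  representative, and \<open>u\<close> is the gain in weight.\<close>

lemma merge_inj:
  assumes "raw_state n X" "valid_label (mins n X) l" "valid_label (mins n X) l'" "merge X l = merge X l'"
  shows "l = l'"
proof -
  obtain a b u a' b' u' where l: "l = (a, b, u)" "l' = (a', b', u')"
    by (cases l, cases l')
  have "mins n X - {b} = mins n X - {b'}"
    using assms mins_merge[of n X a b u] mins_merge[of n X a' b' u'] l by metis
  then have b: "b = b'"
    using assms l by auto
  have "fst (merge X l) b = a" "fst (merge X l') b = a'"
    using assms(2,3) l b by (auto simp: mins_def)
  then have a: "a = a'"
    using assms(4) by simp
  have "snd (merge X l) a = snd X a + snd X b + u" "snd (merge X l') a = snd X a + snd X b + u'"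
    using assms(2,3) l a b by auto
  then have "snd X a + snd X b + u = snd X a + snd X b + u'"
    using assms(4) by metis
  then show ?thesis
    using l a b by simp
qed

section \<open>Least labels and ascents\<close>

lemma nontriv_merge:
  assumes "raw_state n X" "raw_state n Z" "valid_label (mins n X) (a, b, u)"
  shows "nontriv n (merge X (a, b, u)) Z \<subseteq> nontriv n X Z"
    "c \<in> nontriv n X Z \<Longrightarrow> c \<noteq> fst Z b \<Longrightarrow> c \<in> nontriv n (merge X (a, b, u)) Z"
  using card_parts_merge[OF assms] by (auto simp: nontriv_def)

text \<open>The merged blocks lie in a nontrivial block of the bound, whose minimum is at most
  \<open>a\<close>. If \<open>a\<close> is least possible, \<open>b\<close> is at least the second
  smallest part, and weight 0 is ruled out when all remaining merges of that block must add
  1.\<close>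

lemma least_label_le_label:
  assumes X: "raw_state n X" and ok: "valid_label (mins n X) l" and le: "below n (merge X l) U"
  shows "l = least_label n X U \<or> (least_label n X U, l) \<in> label_less"
proof -
  obtain a b u where l: "l = (a, b, u)"
    by (cases l)
  have ab: "a \<in> mins n X" "b \<in> mins n X" "a < b" "1 \<le> a"
    using ok by (auto simp: l mins_def)
  show ?thesis
  proof (cases U)
    case None
    define m where "m = Min (insert (n + 1) (mins n X) - {1})"
    have "m \<le> b"
      unfolding m_def using ab by (intro Min_le) auto
    then show ?thesis
      using ab unfolding None l least_label.simps m_def[symmetric] by (auto simp: label_less_def)
  next
    case (Some Z)
    have Z: "raw_state n Z" and le': "state_le n (merge X (a, b, u)) Z"
      using le Some l by auto
    note iff = state_le_merge_iff[OF X Z ok[unfolded l], THEN iffD1, OF le']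
    define c where "c = fst Z a"
    have cab: "a \<in> parts n X Z c" "b \<in> parts n X Z c"
      using ab iff by (auto simp: parts_def c_def)
    then have "card {a, b} \<le> card (parts n X Z c)"
      by (intro card_mono) auto
    moreover have "c \<in> mins n Z"
      using rep_mem_mins[OF Z] ab by (auto simp: c_def mins_def)
    ultimately have "c \<in> nontriv n X Z"
      using ab by (simp add: nontriv_def)
    then have m: "Min (nontriv n X Z) \<le> c"
      by (intro Min_le) auto
    have "c \<le> a"
      using raw_stateD(1)[OF Z] by (simp add: c_def)
    show ?thesis
    proof (cases "Min (nontriv n X Z) = a")
      case True
      then have c: "c = a"
        using m \<open>c \<le> a\<close> by simp
      then have "Min (parts n X Z a - {a}) \<le> b"
        using cab ab by (intro Min_le) auto
      moreover have "snd Z c + 1 < wsum n X Z c + u + card (parts n X Z c)"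
        using iff unfolding c_def by blast
      then have "0 < u" if "snd Z a + 1 = wsum n X Z a + card (parts n X Z a)"
        using that c by simp
      moreover have "u \<le> 1"
        using ok l by simp
      ultimately show ?thesis
        unfolding l Some least_label.simps True Let_def by (auto simp: label_less_def)
    next
      case False
      then show ?thesis
        using m \<open>c \<le> a\<close> unfolding l Some least_label.simps Let_def by (auto simp: label_less_def)
    qed
  qed
qed

text \<open>The local heart of the labelling: a label that ascends into the least label after it was
  itself least. Mergeability ensures that, below a genuine state, the next least label is a minimum
  over a nonempty set.\<close>

lemma label_eq_least_label:
  assumes X: "raw_state n X" and ok: "valid_label (mins n X) l" and le: "below n (merge X l) U"
    and asc: "ascent l (least_label n (merge X l) U)" and mrg: "U \<noteq> None \<Longrightarrow> mergeable n (merge X l) U"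
  shows "l = least_label n X U"
proof -
  obtain a b u where l: "l = (a, b, u)"
    by (cases l)
  have ab: "a \<in> mins n X" "b \<in> mins n X" "a < b" "1 \<le> a" "u \<le> 1"
    using ok by (auto simp: l mins_def)
  show ?thesis
  proof (cases U)
    case None
    let ?B = "insert (n + 1) (mins n X - {b}) - {1}"
    have "ascent (a, b, u) (1, Min ?B, 0)"
      using asc unfolding None l least_label.simps mins_merge[OF X ok[unfolded l]] .
    then have asc': "a = 1" "b < Min ?B" "u = 0"
      using ab(4) by (auto simp del: Min_insert)
    have "insert (n + 1) (mins n X) - {1} = insert b ?B"
      using ab by auto
    moreover have "\<forall>y\<in>?B. b < y"
      using asc'(2) by (subst (asm) Min_gr_iff) (use ab in \<open>auto simp: mins_def\<close>)
    then have "\<And>y. y \<in> insert b ?B \<Longrightarrow> b \<le> y"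
      by (metis insertE less_imp_le order_refl)
    then have "Min (insert b ?B) = b"
      by (intro Min_eqI) simp_all
    ultimately show ?thesis
      using asc' by (simp add: None l del: Min_insert)
  next
    case (Some Z)
    have Z: "raw_state n Z" and le': "state_le n (merge X (a, b, u)) Z"
      using le Some l by auto
    note ok' = ok[unfolded l]
    note iff = state_le_merge_iff[OF X Z ok', THEN iffD1, OF le']
    define c where "c = fst Z a"
    let ?Y = "merge X (a, b, u)"
    have cb: "c = fst Z b"
      using iff by (simp add: c_def)
    have cab: "a \<in> parts n X Z c" "b \<in> parts n X Z c"
      using ab iff by (auto simp: parts_def c_def)
    have cZ: "c \<in> mins n Z"
      using rep_mem_mins[OF Z] ab by (auto simp: c_def mins_def)
    have csub: "c \<in> parts n X Z c"
      using mem_parts_self[OF X Z _ cZ] iff by blast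
    have "c \<le> a"
      using raw_stateD(1)[OF Z] by (simp add: c_def)
    have ineq: "wsum n X Z c + u \<le> snd Z c" "snd Z c + 1 < wsum n X Z c + u + card (parts n X Z c)"
      using iff by (auto simp: c_def)
    have "card {a, b} \<le> card (parts n X Z c)"
      using cab by (intro card_mono) auto
    then have c2: "2 \<le> card (parts n X Z c)"
      using ab by simp
    then have cnt: "c \<in> nontriv n X Z"
      using cZ by (simp add: nontriv_def)
    have nt: "nontriv n ?Y Z \<subseteq> nontriv n X Z" "nontriv n X Z \<subseteq> insert c (nontriv n ?Y Z)"
      using nontriv_merge[OF X Z ok'] cb by auto
    have ne: "nontriv n ?Y Z \<noteq> {}"
      using mrg Some l by simp
    define a' where "a' = Min (nontriv n ?Y Z)"
    have a': "a' \<in> nontriv n ?Y Z" "\<And>d. d \<in> nontriv n ?Y Z \<Longrightarrow> a' \<le> d"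
      unfolding a'_def using ne by auto
    consider "a < a'" | "a = a'" "b < Min (parts n ?Y Z a - {a})"
      "u \<le> (if snd Z a + 1 = wsum n ?Y Z a + card (parts n ?Y Z a) then 1 else 0)"
      using asc unfolding l Some least_label.simps Let_def a'_def[symmetric] by (auto simp: Let_def)
    then show ?thesis
    proof cases
      \<comment> \<open>The merge has completed its block, so this block had only the two parts
        \<open>a\<close> and \<open>b\<close>; its minimum is \<open>a\<close>, and the missing
        weight determines \<open>u\<close>.\<close>
      case 1
      have "c \<notin> nontriv n ?Y Z"
        using a'(2)[of c] \<open>c \<le> a\<close> 1 by auto
      then have "card (parts n X Z c) \<le> 2"
        using card_parts_merge[OF X Z ok', of c] cZ cb by (simp add: nontriv_def)
      then have card2: "card (parts n X Z c) = 2"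
        using c2 by simp
      have sub: "parts n X Z c = {a, b}"
        using cab card2 ab by (intro card_seteq[symmetric]) auto
      then have ca: "c = a"
        using csub \<open>c \<le> a\<close> ab by auto
      have "Min (nontriv n X Z) = a"
        using cnt nt(2) a'(2) 1 ca by (intro Min_eqI) fastforce+
      moreover have "parts n X Z a - {a} = {b}"
        using sub ca ab by auto
      ultimately show ?thesis
        using ineq card2 ca ab(5) unfolding l Some least_label.simps Let_def by auto
    next
      \<comment> \<open>The same block is still being assembled: \<open>b\<close> precedes all parts
        that are left, and a forced later weight 1 together with \<open>u = 0\<close> would exceed
        the bound.\<close>
      case 2
      have "a \<in> mins n Z"
        using 2 a'(1) by (simp add: nontriv_def)
      then have ca: "c = a"
        by (simp add: c_def mins_def)
      have "Min (nontriv n X Z) = a"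
        using cnt nt(2) a'(2) 2 ca by (intro Min_eqI) fastforce+
      moreover have "Min (parts n X Z a - {a}) = b"
      proof (rule Min_eqI)
        show "b \<in> parts n X Z a - {a}"
          using cab ca ab by auto
        fix y assume y: "y \<in> parts n X Z a - {a}"
        show "b \<le> y"
        proof (cases "y = b")
          case False
          then have "y \<in> parts n ?Y Z a - {a}"
            using y parts_merge[OF X Z ok'] by auto
          then have "Min (parts n ?Y Z a - {a}) \<le> y"
            by (intro Min_le) auto
          then show ?thesis
            using 2(2) by simp
        qed simp
      qed simp
      moreover have "wsum n ?Y Z a = wsum n X Z a + u"
        "card (parts n ?Y Z a) + 1 = card (parts n X Z a)"
        using wsum_merge[OF X Z ok', of a] card_parts_merge[OF X Z ok', of a] iff ca c2 cb c_def by auto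
      ultimately show ?thesis
        using ineq 2(3) ca ab(5) unfolding l Some least_label.simps Let_def by (auto split: if_splits)
    qed
  qed
qed

text \<open>The converse direction: taking the least label is always possible and ascends into the
  next least label. Inside one block this takes the parts in increasing order and adds weight 0 as
  long as the bound permits.\<close>

lemma least_label_ok:
  assumes X: "raw_state n X" and n: "1 \<le> n" and le: "below n X U" and mrg: "mergeable n X U"
  shows "valid_label (mins n X) (least_label n X U)" "below n (merge X (least_label n X U)) U"
    "U = None \<or> mergeable n (merge X (least_label n X U)) U \<Longrightarrow>
      ascent (least_label n X U) (least_label n (merge X (least_label n X U)) U)"
proof -
  have "valid_label (mins n X) (least_label n X U) \<and> below n (merge X (least_label n X U)) U \<and>
    (U = None \<or> mergeable n (merge X (least_label n X U)) U \<longrightarrow>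
      ascent (least_label n X U) (least_label n (merge X (least_label n X U)) U))"
  proof (cases U)
    case None
    define b where "b = Min (insert (n + 1) (mins n X) - {1})"
    have one: "1 \<in> mins n X"
      using one_mem_mins[OF X n] .
    have "mins n X - {1} \<noteq> {}"
      using mrg None card_mono[of "{1}" "mins n X"] by auto
    then obtain y where y: "y \<in> mins n X - {1}"
      by auto
    have b_in: "b \<in> insert (n + 1) (mins n X) - {1}"
      unfolding b_def using y by (intro Min_in) auto
    have b_le: "\<And>y. y \<in> insert (n + 1) (mins n X) - {1} \<Longrightarrow> b \<le> y"
      unfolding b_def by (intro Min_le) auto
    have "b \<le> y" "y \<le> n"
      using b_le y by (auto simp: mins_def)
    then have b: "b \<in> mins n X" "1 < b"
      using b_in by (auto simp: mins_def)
    have ok: "valid_label (mins n X) (1, b, 0)"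
      using one b by simp
    have "b < Min (insert (n + 1) (mins n X - {b}) - {1})"
    proof -
      have "Min (insert (n + 1) (mins n X - {b}) - {1}) \<in> insert (n + 1) (mins n X - {b}) - {1}"
        using n by (intro Min_in) auto
      then show ?thesis
        using b_le[of "Min (insert (n + 1) (mins n X - {b}) - {1})"] \<open>b \<le> y\<close> \<open>y \<le> n\<close> by force
    qed
    then show ?thesis
      unfolding None least_label.simps b_def[symmetric] using ok mins_merge[OF X ok] by auto
  next
    case (Some Z)
    have Z: "raw_state n Z" and leZ: "state_le n X Z"
      using le Some by auto
    define c where "c = Min (nontriv n X Z)"
    have c: "c \<in> nontriv n X Z" "\<And>d. d \<in> nontriv n X Z \<Longrightarrow> c \<le> d"
      unfolding c_def using mrg Some by auto
    then have cZ: "c \<in> mins n Z" "fst Z c = c" and card2: "2 \<le> card (parts n X Z c)"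
      by (auto simp: nontriv_def mins_def)
    have csub: "c \<in> parts n X Z c"
      using mem_parts_self[OF X Z leZ] cZ by simp
    define b where "b = Min (parts n X Z c - {c})"
    have "card (parts n X Z c - {c}) \<ge> 1"
      using card2 csub by (simp add: card_Diff_singleton)
    then have ne: "parts n X Z c - {c} \<noteq> {}"
      by (metis card.empty not_one_le_zero)
    then have b: "b \<in> parts n X Z c - {c}" "\<And>y. y \<in> parts n X Z c - {c} \<Longrightarrow> b \<le> y"
      unfolding b_def using Min_in[of "parts n X Z c - {c}"] by auto
    have bZ: "fst Z b = c" "b \<in> mins n X" "b \<noteq> c"
      using b by (auto simp: parts_def)
    then have "c < b"
      using raw_stateD(1)[OF Z, of b] by simp
    \<comment> \<open>Equality means that the missing weight equals the number of merges left in
      this block, so that each of them must add 1.\<close>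
    define u :: nat where "u = (if snd Z c + 1 = wsum n X Z c + card (parts n X Z c) then 1 else 0)"
    have lead: "least_label n X U = (c, b, u)"
      unfolding Some least_label.simps Let_def c_def[symmetric] b_def u_def ..
    have ok: "valid_label (mins n X) (c, b, u)"
      using csub bZ \<open>c < b\<close> by (auto simp: parts_def u_def)
    have "wsum n X Z c \<le> snd Z c" "snd Z c < wsum n X Z c + card (parts n X Z c)"
      using leZ cZ by (auto simp: state_le_def)
    then have le': "state_le n (merge X (c, b, u)) Z"
      unfolding state_le_merge_iff[OF X Z ok] using leZ cZ bZ card2 by (auto simp: u_def)
    let ?Y = "merge X (c, b, u)"
    have "ascent (c, b, u) (least_label n ?Y U)" if m: "nontriv n ?Y Z \<noteq> {}"
    proof -
      define d where "d = Min (nontriv n ?Y Z)"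
      have d: "d \<in> nontriv n ?Y Z"
        unfolding d_def using m by simp
      then have "c \<le> d"
        using nontriv_merge(1)[OF X Z ok] c(2) by auto
      show ?thesis
      proof (cases "c = d")
        case True
        have sub: "parts n ?Y Z c = parts n X Z c - {b}"
          by (rule parts_merge[OF X Z ok])
        have "2 \<le> card (parts n ?Y Z c)"
          using d True by (simp add: nontriv_def)
        then have "1 \<le> card (parts n ?Y Z c - {c})"
          using diff_card_le_card_Diff[of "{c}" "parts n ?Y Z c"] by simp
        then have "parts n ?Y Z c - {c} \<noteq> {}"
          by (metis card.empty not_one_le_zero)
        then have "Min (parts n ?Y Z c - {c}) \<in> parts n ?Y Z c - {c}"
          by (intro Min_in) auto
        then have "b < Min (parts n ?Y Z c - {c})"
          using b(2)[of "Min (parts n ?Y Z c - {c})"] sub by fastforce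
        moreover have "wsum n ?Y Z c = wsum n X Z c + u" "card (parts n ?Y Z c) + 1 = card (parts n X Z c)"
          using wsum_merge[OF X Z ok, of c] card_parts_merge[OF X Z ok, of c] card2 cZ bZ by auto
        ultimately show ?thesis
          unfolding Some least_label.simps Let_def d_def[symmetric] True[symmetric]
          by (auto simp: u_def)
      next
        case False
        then show ?thesis
          using \<open>c \<le> d\<close> unfolding Some least_label.simps Let_def d_def[symmetric] by auto
      qed
    qed
    then show ?thesis
      unfolding lead using ok le' Some Z by auto
  qed
  then show "valid_label (mins n X) (least_label n X U)" "below n (merge X (least_label n X U)) U"
    "U = None \<or> mergeable n (merge X (least_label n X U)) U \<Longrightarrow>
      ascent (least_label n X U) (least_label n (merge X (least_label n X U)) U)"
    by auto
qed

text \<open>Pigeonhole: if every block of \<open>Z\<close> had at most one part,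
  \<open>fst Z\<close> would embed the minima of \<open>X\<close> into those of
  \<open>Z\<close>.\<close>

lemma mergeable_if_le:
  assumes X: "raw_state n X" and Z: "raw_state n Z" and le: "state_le n X Z"
    and card: "card (mins n Z) < card (mins n X)"
  shows "mergeable n X (Some Z)"
proof (rule ccontr)
  assume "\<not> mergeable n X (Some Z)"
  then have one: "card (parts n X Z c) \<le> 1" if "c \<in> mins n Z" for c
    using that by (force simp: nontriv_def)
  have "inj_on (fst Z) (mins n X)"
  proof (rule inj_onI)
    fix x y assume xy: "x \<in> mins n X" "y \<in> mins n X" "fst Z x = fst Z y"
    have "fst Z x \<in> mins n Z"
      using rep_mem_mins[OF Z] xy by (auto simp: mins_def)
    then have "card (parts n X Z (fst Z x)) \<le> 1"
      by (rule one)
    moreover have "x \<in> parts n X Z (fst Z x)" "y \<in> parts n X Z (fst Z x)"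
      using xy by (auto simp: parts_def)
    ultimately show "x = y"
      using card_le_Suc0_iff_eq[of "parts n X Z (fst Z x)"] by auto
  qed
  moreover have "fst Z ` mins n X \<subseteq> mins n Z"
    using rep_mem_mins[OF Z] by (auto simp: mins_def)
  ultimately show False
    using card card_inj_on_le[of "fst Z" "mins n X" "mins n Z"] by simp
qed

lemma merge_least_label_cover:
  assumes X: "raw_state n X" and n: "1 \<le> n" and Z: "raw_state n Z" and le: "state_le n X Z"
    and card: "card (mins n X) = card (mins n Z) + 1"
  shows "valid_label (mins n X) (least_label n X (Some Z))" "merge X (least_label n X (Some Z)) = Z"
proof -
  have m: "mergeable n X (Some Z)"
    using mergeable_if_le[OF X Z le] card by simp
  obtain a b u where l: "least_label n X (Some Z) = (a, b, u)"
    by (metis prod_cases3)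
  have ok: "valid_label (mins n X) (a, b, u)" and le': "state_le n (merge X (a, b, u)) Z"
    using least_label_ok(1,2)[OF X n _ m] Z le unfolding l by auto
  then show "valid_label (mins n X) (least_label n X (Some Z))"
    unfolding l by simp
  have "card (mins n (merge X (a, b, u))) = card (mins n Z)"
    using mins_merge[OF X ok] card ok by (auto simp: card_Diff_singleton)
  then show "merge X (least_label n X (Some Z)) = Z"
    unfolding l using state_le_eqI[OF raw_merge[OF X ok] Z le'] by simp
qed

text \<open>A covering step has only one label. Thus the labels of a chain are recovered from its
  states, and every label is the least one of a rank-one interval, which lets all comparisons be
  made with \<open>least_label\<close>.\<close>

lemma least_label_merge:
  assumes X: "raw_state n X" and n: "1 \<le> n" and ok: "valid_label (mins n X) l"
  shows "least_label n X (Some (merge X l)) = l"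
proof -
  obtain a b u where l: "l = (a, b, u)"
    by (cases l)
  have "card (mins n X) = card (mins n (merge X l)) + 1"
    using mins_merge[OF X ok[unfolded l]] ok l card.remove[of "mins n X" b] by simp
  then show ?thesis
    using merge_least_label_cover[OF X n raw_merge[OF X ok] state_le_merge[OF X ok]] merge_inj[OF X _ ok] by simp
qed

section \<open>States as weighted partitions\<close>

definition block :: "nat \<Rightarrow> state \<Rightarrow> nat \<Rightarrow> nat set" where
  "block n X a = {x \<in> {1..n}. fst X x = a}"

definition to_wp :: "nat \<Rightarrow> state \<Rightarrow> weighted_partition" where
  "to_wp n X = (\<lambda>a. (block n X a, snd X a)) ` mins n X"

definition total_weight :: "nat \<Rightarrow> state \<Rightarrow> nat" where
  "total_weight n X = (\<Sum>a\<in>mins n X. snd X a)"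

lemma mem_block_self: "a \<in> mins n X \<Longrightarrow> a \<in> block n X a"
  by (simp add: block_def mins_def)

lemma inj_on_block: "inj_on (block n X) (mins n X)"
proof (rule inj_onI)
  fix a b assume a: "a \<in> mins n X" "block n X a = block n X b"
  then have "a \<in> block n X b"
    using mem_block_self by blast
  then show "a = b"
    using a(1) by (simp add: block_def mins_def)
qed

lemma inj_on_wblock: "inj_on (\<lambda>a. (block n X a, snd X a)) (mins n X)"
  by (rule inj_onI) (metis (no_types, lifting) prod.inject inj_onD inj_on_block)

lemma card_to_wp: "card (to_wp n X) = card (mins n X)"
  unfolding to_wp_def by (rule card_image[OF inj_on_wblock])

lemma fst_to_wp: "fst ` to_wp n X = block n X ` mins n X"
  by (auto simp: to_wp_def image_image)

lemma partition_on_blocks: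
  assumes "raw_state n X"
  shows "partition_on {1..n} (block n X ` mins n X)"
proof (rule partition_onI)
  show "\<Union> (block n X ` mins n X) = {1..n}"
    using rep_mem_mins[OF assms] by (auto simp: block_def)
  show "disjnt p q" if "p \<in> block n X ` mins n X" "q \<in> block n X ` mins n X" "p \<noteq> q" for p q
    using that by (auto simp: block_def disjnt_def)
  show "{} \<notin> block n X ` mins n X"
    using mem_block_self by fastforce
qed

lemma parts_bot: "parts n bot_state X c = block n X c"
  by (simp add: parts_def block_def mins_bot)

lemma state_le_bot_iff:
  "state_le n bot_state X \<longleftrightarrow> (\<forall>c\<in>mins n X. snd X c < card (block n X c))"
  by (simp add: state_le_def parts_bot wsum_def) (simp add: bot_state_def)

lemma to_wp_mem:
  assumes "is_state n X"
  shows "to_wp n X \<in> weighted_partitions n"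
proof -
  have raw: "raw_state n X" and le: "\<And>c. c \<in> mins n X \<Longrightarrow> snd X c < card (block n X c)"
    using assms by (auto simp: is_state_def state_le_bot_iff)
  have "inj_on fst (to_wp n X)"
    unfolding to_wp_def by (rule inj_onI) (auto dest: inj_onD[OF inj_on_block])
  then show ?thesis
    using partition_on_blocks[OF raw] le fst_to_wp
    by (fastforce simp: weighted_partitions_def to_wp_def image_image)
qed

lemma to_wp_inj:
  assumes "raw_state n X" "raw_state n Y" and eq: "to_wp n X = to_wp n Y"
  shows "X = Y"
proof (rule raw_state_eqI[OF assms(1,2)])
  have *: "block n X (fst X x) = block n Y (fst Y x)" "snd X (fst X x) = snd Y (fst Y x)"
    if "x \<in> {1..n}" for x
  proof -
    have "(block n X (fst X x), snd X (fst X x)) \<in> to_wp n Y"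
      using rep_mem_mins[OF assms(1) that] unfolding eq[symmetric] by (auto simp: to_wp_def)
    then obtain a where a: "block n X (fst X x) = block n Y a" "snd X (fst X x) = snd Y a"
      by (auto simp: to_wp_def)
    have "x \<in> block n Y a"
      unfolding a(1)[symmetric] using that by (simp add: block_def)
    then have "fst Y x = a"
      by (simp add: block_def)
    then show "block n X (fst X x) = block n Y (fst Y x)" "snd X (fst X x) = snd Y (fst Y x)"
      using a by auto
  qed
  show p: "fst X x = fst Y x" if "x \<in> {1..n}" for x
  proof -
    have "fst X x \<in> block n Y (fst Y x)" "fst Y x \<in> block n X (fst X x)"
      using mem_block_self[OF rep_mem_mins[OF assms(1) that]]
        mem_block_self[OF rep_mem_mins[OF assms(2) that]] *(1)[OF that] by auto
    then have "fst Y (fst X x) = fst Y x" "fst X (fst Y x) = fst X x"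
      by (auto simp: block_def)
    then show ?thesis
      using raw_stateD(1)[OF assms(1), of "fst Y x"] raw_stateD(1)[OF assms(2), of "fst X x"] by simp
  qed
  show "snd X a = snd Y a" if "a \<in> mins n X" for a
  proof -
    have "a \<in> {1..n}" "fst X a = a"
      using that by (auto simp: mins_def)
    then show ?thesis
      using *(2)[of a] p[of a] by simp
  qed
qed

lemma to_wp_surj:
  assumes W: "W \<in> weighted_partitions n"
  obtains X where "is_state n X" "to_wp n X = W"
proof -
  have part: "partition_on {1..n} (fst ` W)" and inj: "inj_on fst W"
    and wt: "\<And>B v. (B, v) \<in> W \<Longrightarrow> v \<le> card B - 1"
    using W by (auto simp: weighted_partitions_def)
  have "\<exists>T\<in>W. x \<in> fst T" if "x \<in> {1..n}" for x
    using that partition_onD1[OF part] by auto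
  then obtain T where T: "\<And>x. x \<in> {1..n} \<Longrightarrow> T x \<in> W" "\<And>x. x \<in> {1..n} \<Longrightarrow> x \<in> fst (T x)"
    by metis
  have uniq: "T x = V" if "V \<in> W" "x \<in> fst V" for x V
  proof -
    have x: "x \<in> {1..n}"
      using that partition_onD1[OF part] by auto
    have "fst (T x) = fst V"
      using T[OF x] that partition_onD2[OF part] by (auto simp: disjoint_def)
    then show ?thesis
      using inj T(1)[OF x] that by (auto simp: inj_on_def)
  qed
  have bl: "fst (T x) \<subseteq> {1..n}" and ne: "fst (T x) \<noteq> {}" if "x \<in> {1..n}" for x
    using T[OF that] partition_onD1[OF part] by auto
  then have fin: "finite (fst (T x))" if "x \<in> {1..n}" for x
    using that finite_subset by (metis finite_atLeastAtMost)
  define p where "p x = (if x \<in> {1..n} then Min (fst (T x)) else x)" for x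
  have p_in: "p x \<in> fst (T x)" "p x \<in> {1..n}" "p x \<le> x" "T (p x) = T x" if "x \<in> {1..n}" for x
  proof -
    show px: "p x \<in> fst (T x)"
      using that fin ne by (auto simp: p_def intro: Min_in)
    then show "p x \<in> {1..n}"
      using bl[OF that] px by blast
    show "p x \<le> x"
      using that fin T by (auto simp: p_def intro: Min_le)
    show "T (p x) = T x"
      using uniq[OF T(1)[OF that] px] .
  qed
  have p_idem: "p (p x) = p x" for x
    using p_in[of x] by (cases "x \<in> {1..n}") (auto simp: p_def)
  define q where "q a = (if a \<in> {1..n} \<and> p a = a then snd (T a) else 0)" for a
  let ?X = "(p, q)"
  have raw: "raw_state n ?X"
    using p_in p_idem by (auto simp: raw_state_def q_def) (auto simp: p_def)
  have blk: "block n ?X a = fst (T a)" if "a \<in> mins n ?X" for a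
  proof
    have a: "a \<in> {1..n}" "p a = a"
      using that by (auto simp: mins_def)
    show "block n ?X a \<subseteq> fst (T a)"
      using p_in T by (auto simp: block_def)
    show "fst (T a) \<subseteq> block n ?X a"
    proof
      fix x assume x: "x \<in> fst (T a)"
      then have "T x = T a" "x \<in> {1..n}"
        using uniq[OF T(1)[OF a(1)] x] bl[OF a(1)] by blast+
      then show "x \<in> block n ?X a"
        using a by (simp add: block_def p_def)
    qed
  qed
  have wbl: "(block n ?X a, snd ?X a) = T a" if "a \<in> mins n ?X" for a
    using blk[OF that] that by (simp add: q_def mins_def)
  have "snd ?X c < card (block n ?X c)" if c: "c \<in> mins n ?X" for c
  proof -
    have "c \<in> {1..n}"
      using c by (simp add: mins_def)
    then have "T c \<in> W" "0 < card (fst (T c))"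
      using T fin ne by (auto simp: card_gt_0_iff)
    then show ?thesis
      using wt[of "fst (T c)" "snd (T c)"] wbl[OF c] blk[OF c] by (auto simp: prod_eq_iff)
  qed
  then have st: "is_state n ?X"
    using raw by (simp add: is_state_def state_le_bot_iff)
  have "to_wp n ?X = W"
  proof
    show "to_wp n ?X \<subseteq> W"
      using wbl T(1) by (auto simp: to_wp_def mins_def)
    show "W \<subseteq> to_wp n ?X"
    proof
      fix V assume V: "V \<in> W"
      have "fst V \<noteq> {}"
        using V partition_onD3[OF part] by (metis imageI)
      then obtain x where x: "x \<in> fst V"
        by auto
      then have x1: "x \<in> {1..n}" "T x = V"
        using V partition_onD1[OF part] uniq[OF V x] by auto
      have px: "p x \<in> mins n ?X"
        using p_in[OF x1(1)] p_idem by (simp add: mins_def)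
      have "V = (block n ?X (p x), snd ?X (p x))"
        using wbl[OF px] p_in(4)[OF x1(1)] x1(2) by simp
      then show "V \<in> to_wp n ?X"
        unfolding to_wp_def using px by (rule image_eqI)
    qed
  qed
  then show ?thesis
    using that st by blast
qed

text \<open>The order on weighted partitions quantifies over all families of blocks with a given
  union. Blocks are disjoint and nonempty, so there is only one such family, indexed by
  \<open>parts\<close>.\<close>

lemma Union_blocks_eq_iff:
  assumes X: "raw_state n X" and Z: "raw_state n Z" and ref: "\<And>x. fst Z (fst X x) = fst Z x"
    and T: "T \<subseteq> mins n X" and c: "c \<in> mins n Z"
  shows "block n Z c = \<Union> (block n X ` T) \<longleftrightarrow> T = parts n X Z c"
proof
  assume eq: "block n Z c = \<Union> (block n X ` T)"
  show "T = parts n X Z c"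
  proof
    show "T \<subseteq> parts n X Z c"
    proof
      fix a assume a: "a \<in> T"
      then have "a \<in> block n Z c"
        using eq T mem_block_self by blast
      then show "a \<in> parts n X Z c"
        using T a by (auto simp: parts_def block_def)
    qed
    show "parts n X Z c \<subseteq> T"
    proof
      fix a assume a: "a \<in> parts n X Z c"
      then have "a \<in> block n Z c"
        by (auto simp: parts_def block_def mins_def)
      then obtain a' where "a' \<in> T" "a \<in> block n X a'"
        using eq by auto
      then show "a \<in> T"
        using a by (auto simp: parts_def block_def mins_def)
    qed
  qed
next
  assume T: "T = parts n X Z c"
  show "block n Z c = \<Union> (block n X ` T)"
    unfolding T using rep_mem_mins[OF X] ref by (auto simp: block_def parts_def)
qed

lemma wp_le_iff:
  assumes X: "raw_state n X" and Z: "raw_state n Z"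
  shows "wp_le n (to_wp n X) (to_wp n Z) \<longleftrightarrow> state_le n X Z"
proof -
  have refl: "refines {1..n} (fst ` to_wp n X) (fst ` to_wp n Z) \<longleftrightarrow>
      (\<forall>x. fst Z (fst X x) = fst Z x)" (is "?L \<longleftrightarrow> ?R")
  proof
    assume ?L
    show ?R
    proof
      fix x
      show "fst Z (fst X x) = fst Z x"
      proof (cases "x \<in> {1..n}")
        case True
        then have "block n X (fst X x) \<in> fst ` to_wp n X"
          using rep_mem_mins[OF X] by (auto simp: fst_to_wp)
        then obtain c where c: "block n X (fst X x) \<subseteq> block n Z c"
          using \<open>?L\<close> by (auto simp: refines_def fst_to_wp)
        have "x \<in> block n X (fst X x)" "fst X x \<in> block n X (fst X x)"
          using True raw_stateD(2,3)[OF X, of x] by (auto simp: block_def)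
        then have "x \<in> block n Z c" "fst X x \<in> block n Z c"
          using c by auto
        then show ?thesis
          by (simp add: block_def)
      qed (simp add: raw_stateD(4)[OF X])
    qed
  next
    assume ?R
    have "block n X a \<subseteq> block n Z (fst Z a) \<and> fst Z a \<in> mins n Z" if "a \<in> mins n X" for a
      using that \<open>?R\<close> rep_mem_mins[OF Z] by (auto simp: block_def mins_def)
    then show ?L
      using partition_on_blocks[OF X] partition_on_blocks[OF Z] unfolding refines_def fst_to_wp
      by blast
  qed
  have wts: "(\<forall>(B, v)\<in>to_wp n Z. \<forall>S\<subseteq>to_wp n X. B = \<Union> (fst ` S) \<longrightarrow>
        int v - (\<Sum>(A, w)\<in>S. int w) \<in> {0..int (card S) - 1}) \<longleftrightarrow>
      (\<forall>c\<in>mins n Z. wsum n X Z c \<le> snd Z c \<and> snd Z c < wsum n X Z c + card (parts n X Z c))"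
    if ref: ?R
  proof -
    let ?w = "\<lambda>a. (block n X a, snd X a)"
    have "(\<forall>S\<subseteq>to_wp n X. block n Z c = \<Union> (fst ` S) \<longrightarrow>
        int (snd Z c) - (\<Sum>(A, w)\<in>S. int w) \<in> {0..int (card S) - 1}) \<longleftrightarrow>
      wsum n X Z c \<le> snd Z c \<and> snd Z c < wsum n X Z c + card (parts n X Z c)"
      if c: "c \<in> mins n Z" for c
    proof -
      have inj: "inj_on ?w T" if "T \<subseteq> mins n X" for T
        using inj_on_subset[OF inj_on_wblock that] .
      have "(\<forall>S\<subseteq>to_wp n X. block n Z c = \<Union> (fst ` S) \<longrightarrow>
          int (snd Z c) - (\<Sum>(A, w)\<in>S. int w) \<in> {0..int (card S) - 1}) \<longleftrightarrow>
        (\<forall>T\<subseteq>mins n X. block n Z c = \<Union> (fst ` ?w ` T) \<longrightarrow>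
          int (snd Z c) - (\<Sum>(A, w)\<in>?w ` T. int w) \<in> {0..int (card (?w ` T)) - 1})"
        unfolding to_wp_def all_subset_image ..
      also have "\<dots> \<longleftrightarrow> (\<forall>T\<subseteq>mins n X. T = parts n X Z c \<longrightarrow>
          int (snd Z c) - (\<Sum>a\<in>T. int (snd X a)) \<in> {0..int (card T) - 1})"
      proof -
        have "(block n Z c = \<Union> (fst ` ?w ` T)) = (T = parts n X Z c)"
          "(\<Sum>(A, w)\<in>?w ` T. int w) = (\<Sum>a\<in>T. int (snd X a))" "card (?w ` T) = card T"
          if T: "T \<subseteq> mins n X" for T
        proof -
          show "(block n Z c = \<Union> (fst ` ?w ` T)) = (T = parts n X Z c)"
            using Union_blocks_eq_iff[OF X Z _ T c] ref by (simp add: image_image)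
          show "(\<Sum>(A, w)\<in>?w ` T. int w) = (\<Sum>a\<in>T. int (snd X a))"
            by (subst sum.reindex[OF inj[OF T]]) simp
          show "card (?w ` T) = card T"
            by (rule card_image[OF inj[OF T]])
        qed
        then show ?thesis
          by (metis (no_types, lifting))
      qed
      also have "\<dots> \<longleftrightarrow> int (snd Z c) - (\<Sum>a\<in>parts n X Z c. int (snd X a)) \<in>
          {0..int (card (parts n X Z c)) - 1}"
        by (auto simp: parts_def)
      also have "(\<Sum>a\<in>parts n X Z c. int (snd X a)) = int (wsum n X Z c)"
        by (simp add: wsum_def)
      finally show ?thesis
        by auto
    qed
    then show ?thesis
      by (simp add: to_wp_def[of n Z])
  qed
  show ?thesis
    unfolding wp_le_def state_le_def refl using wts by blast
qed

lemma wp_less_iff: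
  assumes "raw_state n X" "raw_state n Z"
  shows "wp_less n (to_wp n X) (to_wp n Z) \<longleftrightarrow> state_le n X Z \<and> X \<noteq> Z"
  using wp_le_iff[OF assms] to_wp_inj[OF assms] by (auto simp: wp_less_def)

lemma to_wp_bot: "to_wp n bot_state = wp_bot n"
proof -
  have "block n bot_state a = {a}" if "a \<in> {1..n}" for a
    using that by (auto simp: block_def bot_state_def)
  then show ?thesis
    unfolding to_wp_def wp_bot_def mins_bot by (intro image_cong) (auto simp: bot_state_def)
qed

lemma to_wp_top:
  assumes "raw_state n X" "mins n X = {1}"
  shows "to_wp n X = wp_top n (total_weight n X)"
proof -
  have "block n X 1 = {1..n}"
    using rep_mem_mins[OF assms(1)] assms(2) by (auto simp: block_def)
  then show ?thesis
    using assms(2) by (simp add: to_wp_def wp_top_def total_weight_def)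
qed

lemma total_merge:
  assumes "raw_state n X" "valid_label (mins n X) (a, b, u)"
  shows "total_weight n (merge X (a, b, u)) = total_weight n X + u"
proof -
  have ab: "a \<in> mins n X" "b \<in> mins n X - {a}" "a \<in> mins n X - {b}" "a \<noteq> b"
    using assms(2) by auto
  have "total_weight n X = snd X a + (snd X b + (\<Sum>d\<in>mins n X - {a} - {b}. snd X d))"
    unfolding total_weight_def using ab by (simp add: sum.remove[of _ a] sum.remove[of _ b])
  moreover have "total_weight n (merge X (a, b, u)) =
      (snd X a + snd X b + u) + (\<Sum>d\<in>mins n X - {b} - {a}. snd (merge X (a, b, u)) d)"
    unfolding total_weight_def mins_merge[OF assms] using ab by (subst sum.remove[of _ a]) auto
  moreover have "(\<Sum>d\<in>mins n X - {b} - {a}. snd (merge X (a, b, u)) d) =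
      (\<Sum>d\<in>mins n X - {a} - {b}. snd X d)"
    by (intro sum.cong) auto
  ultimately show ?thesis
    by simp
qed

section \<open>Maximal chains as words\<close>

definition state_at :: "label list \<Rightarrow> nat \<Rightarrow> state" where
  "state_at w j = foldl merge bot_state (take j w)"

definition chain_words :: "nat \<Rightarrow> label list set" where
  "chain_words n = {w. length w = n - 1 \<and> (\<forall>i<n - 1. valid_label (mins n (state_at w i)) (w ! i))}"

definition weight :: "label list \<Rightarrow> nat" where
  "weight w = (\<Sum>(a, b, u)\<leftarrow>w. u)"

text \<open>Labels are numbered from 1: number \<open>j\<close> leads from state
  \<open>j - 1\<close> to state \<open>j\<close>. Number \<open>n\<close> is the artificial merge
  into the bound \<open>None\<close>, so that position \<open>n - 1\<close> can ascend as
  well.\<close>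

definition label_at :: "nat \<Rightarrow> label list \<Rightarrow> nat \<Rightarrow> label" where
  "label_at n w j = (if j \<le> n - 1 then w ! (j - 1) else (1, n + 1, 0))"

definition upper :: "nat \<Rightarrow> label list \<Rightarrow> nat \<Rightarrow> state option" where
  "upper n w j = (if j \<le> n - 1 then Some (state_at w j) else None)"

definition asc_at :: "nat \<Rightarrow> label list \<Rightarrow> nat \<Rightarrow> bool" where
  "asc_at n w j \<longleftrightarrow> ascent (label_at n w j) (label_at n w (j + 1))"

lemma state_at_0: "state_at w 0 = bot_state"
  by (simp add: state_at_def)

lemma state_at_Suc: "j < length w \<Longrightarrow> state_at w (Suc j) = merge (state_at w j) (w ! j)"
  by (simp add: state_at_def take_Suc_conv_app_nth)

text \<open>Consecutive states differ by one block, so the least label between them is the merge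
  that leads from one to the next.\<close>

lemma word_of_chain:
  assumes "1 \<le> n" "T 0 = bot_state" "\<And>j. j \<le> n - 1 \<Longrightarrow> raw_state n (T j)"
    and "\<And>j. j < n - 1 \<Longrightarrow> state_le n (T j) (T (Suc j))"
    and "\<And>j. j \<le> n - 1 \<Longrightarrow> card (mins n (T j)) = n - j"
  obtains w where "w \<in> chain_words n" "\<And>j. j \<le> n - 1 \<Longrightarrow> state_at w j = T j"
proof -
  define w where "w = map (\<lambda>j. least_label n (T j) (Some (T (Suc j)))) [0..<n - 1]"
  have step: "valid_label (mins n (T j)) (w ! j)" "merge (T j) (w ! j) = T (Suc j)" if "j < n - 1" for j
  proof -
    have "card (mins n (T j)) = card (mins n (T (Suc j))) + 1"
      using assms(5)[of j] assms(5)[of "Suc j"] that by simp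
    then show "valid_label (mins n (T j)) (w ! j)" "merge (T j) (w ! j) = T (Suc j)"
      using merge_least_label_cover[OF assms(3)[of j] assms(1) assms(3)[of "Suc j"] assms(4)[OF that]] that
      by (simp_all add: w_def)
  qed
  have st: "state_at w j = T j" if "j \<le> n - 1" for j
    using that
  proof (induction j)
    case 0
    then show ?case
      by (simp add: state_at_0 assms(2))
  next
    case (Suc j)
    then show ?case
      using step(2)[of j] by (simp add: state_at_Suc w_def)
  qed
  then have "w \<in> chain_words n"
    using step(1) by (auto simp: chain_words_def w_def)
  then show ?thesis
    using st that by blast
qed

section \<open>Labels along maximal chains\<close>

lemma label_less_order: "trans label_less" "(l, l) \<notin> label_less"
  by (auto simp: label_less_def intro: trans_lex_prod) (cases l, simp)

context
  fixes n :: nat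
  assumes n: "1 \<le> n"
begin

lemma chain_words_step:
  assumes "w \<in> chain_words n" "i < n - 1"
  shows "valid_label (mins n (state_at w i)) (w ! i)" "state_at w (Suc i) = merge (state_at w i) (w ! i)"
  using assms by (auto simp: chain_words_def state_at_Suc)

lemma chain_words_state:
  assumes w: "w \<in> chain_words n" and "j \<le> n - 1"
  shows "is_state n (state_at w j)" "raw_state n (state_at w j)" "card (mins n (state_at w j)) = n - j"
proof -
  have "is_state n (state_at w j) \<and> card (mins n (state_at w j)) = n - j"
    using assms(2)
  proof (induction j)
    case 0
    then show ?case
      by (simp add: state_at_0 is_state_bot mins_bot)
  next
    case (Suc j)
    obtain a b u where l: "w ! j = (a, b, u)"
      by (metis prod_cases3)
    have ok: "valid_label (mins n (state_at w j)) (a, b, u)"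
      using chain_words_step[OF w, of j] Suc.prems l by simp
    have "is_state n (state_at w j)" "card (mins n (state_at w j)) = n - j"
      using Suc by auto
    then show ?case
      using is_state_merge[OF _ ok] mins_merge[OF is_state_raw ok] ok chain_words_step(2)[OF w, of j] Suc.prems l
      by (simp add: card_Diff_singleton del: merge.simps)
  qed
  then show "is_state n (state_at w j)" "raw_state n (state_at w j)" "card (mins n (state_at w j)) = n - j"
    by (auto simp: is_state_def)
qed

lemma chain_words_le:
  assumes w: "w \<in> chain_words n" and "i \<le> j" "j \<le> n - 1"
  shows "state_le n (state_at w i) (state_at w j)"
  using assms(2,3)
proof (induction j rule: dec_induct)
  case base
  then show ?case
    using state_le_refl chain_words_state(2)[OF w] by simp
next
  case (step j)
  have "state_le n (state_at w j) (state_at w (Suc j))"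
    using state_le_merge[OF chain_words_state(2)[OF w]] chain_words_step[OF w, of j] step by simp
  then show ?case
    using state_le_trans[of n "state_at w i" "state_at w j" "state_at w (Suc j)"] chain_words_state(2)[OF w] step by simp
qed

lemma chain_words_eqI:
  assumes "w \<in> chain_words n" "w' \<in> chain_words n" "\<And>j. j \<in> {1..n - 1} \<Longrightarrow> state_at w j = state_at w' j"
  shows "w = w'"
proof (rule nth_equalityI)
  show "length w = length w'"
    using assms by (simp add: chain_words_def)
  have eq: "state_at w j = state_at w' j" if "j \<le> n - 1" for j
    using assms(3)[of j] that by (cases "j = 0") (auto simp: state_at_0)
  fix i assume "i < length w"
  then have i: "i < n - 1"
    using assms by (simp add: chain_words_def)
  have "w ! i = least_label n (state_at w i) (Some (state_at w (Suc i)))" if "w \<in> chain_words n" for w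
    using least_label_merge[OF chain_words_state(2)[OF that] n] chain_words_step[OF that i] i by simp
  then show "w ! i = w' ! i"
    using eq[of i] eq[of "Suc i"] assms i by simp
qed

lemma chain_words_last:
  assumes w: "w \<in> chain_words n"
  shows "mins n (state_at w (n - 1)) = {1}"
proof -
  have "1 \<in> mins n (state_at w (n - 1))" "card (mins n (state_at w (n - 1))) = 1"
    using one_mem_mins[OF chain_words_state(2)[OF w]] chain_words_state(3)[OF w, of "n - 1"] n by auto
  then show ?thesis
    by (metis card_1_singletonE singletonD)
qed

lemma chain_words_total:
  assumes w: "w \<in> chain_words n"
  shows "total_weight n (state_at w (n - 1)) = weight w"
proof -
  have "total_weight n (state_at w j) = weight (take j w)" if "j \<le> n - 1" for j
    using that
  proof (induction j)
    case 0
    then show ?case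
      by (simp add: state_at_0 weight_def total_weight_def bot_state_def)
  next
    case (Suc j)
    obtain a b u where l: "w ! j = (a, b, u)"
      by (metis prod_cases3)
    have "length w = n - 1"
      using w by (simp add: chain_words_def)
    then have "take (Suc j) w = take j w @ [(a, b, u)]"
      using Suc.prems l by (simp add: take_Suc_conv_app_nth)
    moreover have "valid_label (mins n (state_at w j)) (a, b, u)" "state_at w (Suc j) = merge (state_at w j) (a, b, u)"
      using chain_words_step[OF w, of j] Suc.prems l by auto
    ultimately show ?case
      using total_merge[OF chain_words_state(2)[OF w, of j]] Suc by (simp add: weight_def del: merge.simps)
  qed
  from this[of "n - 1"] show ?thesis
    using w by (simp add: chain_words_def)
qed

lemma chain_words_wp_top: "w \<in> chain_words n \<Longrightarrow> to_wp n (state_at w (n - 1)) = wp_top n (weight w)"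
  using to_wp_top[OF chain_words_state(2) chain_words_last] chain_words_total by simp

text \<open>For \<open>j = n\<close> the only minimum left is 1, and the least label towards
  \<open>None\<close> becomes \<open>(1, n + 1, 0)\<close>. The artificial last label thus obeys the
  same rule as the others.\<close>

lemma label_at_eq_least_label:
  assumes w: "w \<in> chain_words n" and "1 \<le> j" "j \<le> n"
  shows "label_at n w j = least_label n (state_at w (j - 1)) (upper n w j)"
proof (cases "j \<le> n - 1")
  case True
  then show ?thesis
    using least_label_merge[OF chain_words_state(2)[OF w] n] chain_words_step[OF w, of "j - 1"] assms
    by (simp add: label_at_def upper_def)
next
  case False
  then have "j = n"
    using assms by simp
  moreover have "insert (n + 1) {1} - {1} = {n + 1}"
    using n by auto
  ultimately show ?thesis
    using chain_words_last[OF w] False by (simp add: label_at_def upper_def)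
qed

lemma below_upper: "w \<in> chain_words n \<Longrightarrow> i \<le> j \<Longrightarrow> below n (state_at w i) (upper n w j)"
  using chain_words_le chain_words_state(2) by (simp add: upper_def)

lemma mergeable_upper:
  assumes w: "w \<in> chain_words n" and "i < j" "i < n - 1"
  shows "mergeable n (state_at w i) (upper n w j)"
proof (cases "j \<le> n - 1")
  case True
  then show ?thesis
    using mergeable_if_le[of n "state_at w i" "state_at w j"] chain_words_state(2,3)[OF w] chain_words_le[OF w]
      assms by (simp add: upper_def del: mergeable.simps)
next
  case False
  then show ?thesis
    using chain_words_state(3)[OF w, of i] assms by (simp add: upper_def)
qed

lemma merge_label_at:
  assumes "w \<in> chain_words n" "1 \<le> j" "j \<le> n - 1"
  shows "valid_label (mins n (state_at w (j - 1))) (label_at n w j)" "merge (state_at w (j - 1)) (label_at n w j) = state_at w j"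
  using chain_words_step[OF assms(1), of "j - 1"] assms by (auto simp: label_at_def)

lemma label_at_eq_least_label_upper:
  assumes w: "w \<in> chain_words n" and j: "1 \<le> j" "j \<le> n - 1" "j < q"
    and asc: "ascent (label_at n w j) (least_label n (state_at w j) (upper n w q))"
  shows "label_at n w j = least_label n (state_at w (j - 1)) (upper n w q)"
proof (rule label_eq_least_label)
  show "raw_state n (state_at w (j - 1))"
    using chain_words_state(2)[OF w, of "j - 1"] j by simp
  show "valid_label (mins n (state_at w (j - 1))) (label_at n w j)"
    by (rule merge_label_at(1)[OF w j(1,2)])
  show "below n (merge (state_at w (j - 1)) (label_at n w j)) (upper n w q)"
    using below_upper[OF w, of j q] merge_label_at(2)[OF w j(1,2)] j by simp
  show "ascent (label_at n w j) (least_label n (merge (state_at w (j - 1)) (label_at n w j)) (upper n w q))"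
    using asc merge_label_at(2)[OF w j(1,2)] by simp
  assume "upper n w q \<noteq> None"
  then have "j < n - 1"
    using j by (auto simp: upper_def split: if_splits)
  then show "mergeable n (merge (state_at w (j - 1)) (label_at n w j)) (upper n w q)"
    using mergeable_upper[OF w j(3)] merge_label_at(2)[OF w j(1,2)] by simp
qed

lemma asc_at_least_label:
  assumes w: "w \<in> chain_words n" and j: "1 \<le> j" "j \<le> n - 1" and asc: "asc_at n w j"
  shows "label_at n w j = least_label n (state_at w (j - 1)) (upper n w (j + 1))"
  using label_at_eq_least_label[OF w, of "j + 1"] asc j
  by (intro label_at_eq_least_label_upper[OF w j]) (auto simp: asc_at_def)

text \<open>This serves adjacent ascents, where a competing chain may differ at both ranks and
  rejoins only at \<open>j + 2\<close>. The second ascent makes label \<open>j + 1\<close> least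
  towards that state, and the first one then makes label \<open>j\<close> least as well.\<close>

lemma asc_at_least_label2:
  assumes w: "w \<in> chain_words n" and j: "1 \<le> j" "j + 1 \<le> n - 1"
    and asc: "asc_at n w j" "asc_at n w (j + 1)"
  shows "label_at n w j = least_label n (state_at w (j - 1)) (upper n w (j + 2))"
  using asc_at_least_label[OF w _ j(2) asc(2)] asc j
  by (intro label_at_eq_least_label_upper[OF w]) (auto simp: asc_at_def)

text \<open>Up to \<open>p - 1\<close> the labels agree because the states do. At \<open>p\<close>
  both words leave the same state and stay below the same bound, and \<open>w\<close> uses the least
  label there.\<close>

lemma first_difference_less:
  assumes w: "w \<in> chain_words n" and w': "w' \<in> chain_words n" and p: "1 \<le> p" "p \<le> n - 1"
    and before: "\<And>i. i < p \<Longrightarrow> state_at w i = state_at w' i" and at: "state_at w p \<noteq> state_at w' p"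
    and q: "p < q" "upper n w q = upper n w' q" and lead: "label_at n w p = least_label n (state_at w (p - 1)) (upper n w q)"
  shows "(w, w') \<in> lexord label_less"
proof -
  have len: "length w = n - 1" "length w' = n - 1"
    using w w' by (auto simp: chain_words_def)
  have "take (p - 1) w = take (p - 1) w'"
  proof (intro nth_take_lemma allI impI)
    fix i assume i: "i < p - 1"
    have "v ! i = least_label n (state_at v i) (Some (state_at v (Suc i)))" if "v \<in> chain_words n" for v
      using least_label_merge[OF chain_words_state(2)[OF that] n] chain_words_step[OF that, of i] i p by simp
    then show "w ! i = w' ! i"
      using before[of i] before[of "Suc i"] i w w' by simp
  qed (use len p in auto)
  moreover have "(w ! (p - 1), w' ! (p - 1)) \<in> label_less"
  proof -
    have eq: "state_at w (p - 1) = state_at w' (p - 1)"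
      using before p by simp
    have "merge (state_at w' (p - 1)) (label_at n w' p) = state_at w' p"
      using merge_label_at(2)[OF w' p] .
    then have "label_at n w' p = least_label n (state_at w' (p - 1)) (upper n w' q) \<or>
        (least_label n (state_at w' (p - 1)) (upper n w' q), label_at n w' p) \<in> label_less"
      using below_upper[OF w', of p q] q(1) p
      by (intro least_label_le_label[OF chain_words_state(2)[OF w'] merge_label_at(1)[OF w' p]]) auto
    moreover have "label_at n w' p \<noteq> label_at n w p"
      using merge_label_at(2)[OF w' p] merge_label_at(2)[OF w p] at eq by metis
    ultimately have "(label_at n w p, label_at n w' p) \<in> label_less"
      using lead eq q(2) by metis
    then show ?thesis
      using p by (simp add: label_at_def)
  qed
  ultimately show ?thesis
    unfolding lexord_take_index_conv using len p by (intro disjI2 exI[of _ "p - 1"]) simp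
qed

text \<open>The words first separate at one of the two ascents of \<open>w\<close>. It remains to
  find a later rank where they have rejoined and below which the label of \<open>w\<close> is
  least.\<close>

lemma ascents_least_words:
  assumes w: "w \<in> chain_words n" and w': "w' \<in> chain_words n" and m: "m \<le> n - 1"
    and top: "upper n w (m + 1) = upper n w' (m + 1)"
    and rest: "\<And>i. i \<in> {m + 1..n - 1} \<Longrightarrow> state_at w' i = state_at w i"
    and jk: "j \<in> {1..m}" "k \<in> {1..m}" "asc_at n w j" "asc_at n w k"
    and agree: "\<And>i. i \<in> {1..m} - {j, k} \<Longrightarrow> state_at w' i = state_at w i" and ne: "w' \<noteq> w"
  shows "(w, w') \<in> lexord label_less"
proof -
  have main: "(w, w') \<in> lexord label_less"
    if jk: "j \<in> {1..m}" "k \<in> {1..m}" "asc_at n w j" "asc_at n w k" "j \<le> k"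
      and agree: "\<And>i. i \<in> {1..m} - {j, k} \<Longrightarrow> state_at w' i = state_at w i" for j k
  proof -
    have eq: "state_at w i = state_at w' i" if "i \<noteq> j" "i \<noteq> k" "i \<le> n - 1" for i
    proof (cases "i = 0")
      case False
      then show ?thesis
        using agree[of i] rest[of i] that by (cases "i \<le> m") auto
    qed (simp add: state_at_0)
    have up: "upper n w i = upper n w' i" if "i \<noteq> j" "i \<noteq> k" for i
      using eq[OF that] by (simp add: upper_def)
    show ?thesis
    proof (cases "state_at w j = state_at w' j")
      case False
      show ?thesis
      \<comment> \<open>For adjacent ascents the states at \<open>j + 1\<close> may differ, so the
        comparison takes place in an interval of rank three.\<close>
      proof (cases "k = j + 1")
        case True
        show ?thesis
          by (rule first_difference_less[OF w w', of j "j + 2"])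
            (use asc_at_least_label2[OF w, of j] True jk m False up eq in auto)
      next
        case neq: False
        show ?thesis
          by (rule first_difference_less[OF w w', of j "j + 1"])
            (use asc_at_least_label[OF w, of j] neq jk m False up eq in auto)
      qed
    next
      case True
      have diff: "state_at w k \<noteq> state_at w' k"
      proof
        assume "state_at w k = state_at w' k"
        then have "w = w'"
          using eq True by (intro chain_words_eqI[OF w w']) (metis atLeastAtMost_iff)
        then show False
          using ne by simp
      qed
      have before: "state_at w i = state_at w' i" if "i < k" for i
        using that eq[of i] True jk m by (cases "i = j") auto
      show ?thesis
        by (rule first_difference_less[OF w w', of k "k + 1"])
          (use asc_at_least_label[OF w, of k] jk m diff up before in auto)
    qed
  qed
  show ?thesis
  proof (cases "j \<le> k")
    case True
    then show ?thesis
      using main[of j k] jk agree by blast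
  next
    case False
    then show ?thesis
      using main[of k j] jk agree by (simp add: insert_commute)
  qed
qed

text \<open>The state at \<open>j\<close> is replaced by the one that the least label towards the
  next state produces; the other states are kept.\<close>

lemma ascent_word_exists:
  assumes w: "w \<in> chain_words n" and j: "j \<in> {1..n - 1}"
  obtains w' where "w' \<in> chain_words n" "\<And>i. i \<le> n - 1 \<Longrightarrow> i \<noteq> j \<Longrightarrow> state_at w' i = state_at w i" "asc_at n w' j"
proof -
  define X where "X = state_at w (j - 1)"
  define U where "U = upper n w (j + 1)"
  define Y where "Y = merge X (least_label n X U)"
  have X: "raw_state n X" "card (mins n X) = n - (j - 1)"
    using chain_words_state(2,3)[OF w, of "j - 1"] j by (auto simp: X_def)
  have le: "below n X U" and mrg: "mergeable n X U"
    using below_upper[OF w, of "j - 1" "j + 1"] mergeable_upper[OF w, of "j - 1" "j + 1"] j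
    by (auto simp: X_def U_def)
  note lead = least_label_ok[OF X(1) n le mrg]
  obtain a b u where l: "least_label n X U = (a, b, u)"
    by (metis prod_cases3)
  have Y: "raw_state n Y" "state_le n X Y" "card (mins n Y) = n - j"
  proof -
    show "raw_state n Y" "state_le n X Y"
      using raw_merge[OF X(1) lead(1)] state_le_merge[OF X(1) lead(1)] by (auto simp: Y_def)
    have "mins n Y = mins n X - {b}" "b \<in> mins n X"
      using mins_merge[OF X(1), of a b u] lead(1) by (auto simp: Y_def l)
    then show "card (mins n Y) = n - j"
      using X(2) j by (simp add: card_Diff_singleton)
  qed
  define T where "T = (state_at w)(j := Y)"
  have T0: "T 0 = bot_state"
    using j by (simp add: T_def state_at_0)
  have T_raw: "raw_state n (T i)" "card (mins n (T i)) = n - i" if "i \<le> n - 1" for i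
    using chain_words_state(2,3)[OF w that] Y by (auto simp: T_def)
  have T_le: "state_le n (T i) (T (Suc i))" if "i < n - 1" for i
  proof -
    consider "Suc i = j" | "i = j" | "i \<noteq> j" "Suc i \<noteq> j"
      by blast
    then show ?thesis
    proof cases
      case 1
      then show ?thesis
        using Y(2) by (auto simp: T_def X_def)
    next
      case 2
      then have "U = Some (state_at w (Suc i))"
        using that by (simp add: U_def upper_def)
      then show ?thesis
        using lead(2) 2 by (simp add: T_def Y_def)
    next
      case 3
      then show ?thesis
        using chain_words_le[OF w, of i "Suc i"] that by (simp add: T_def)
    qed
  qed
  obtain w' where w': "w' \<in> chain_words n" "\<And>i. i \<le> n - 1 \<Longrightarrow> state_at w' i = T i"
    using word_of_chain[OF n, of T] T0 T_raw T_le by blast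
  have st': "state_at w' i = state_at w i" if "i \<le> n - 1" "i \<noteq> j" for i
    using w'(2) that by (simp add: T_def)
  have stj: "state_at w' j = Y"
    using w'(2) j by (simp add: T_def)
  have U': "upper n w' (j + 1) = U"
    using st' by (simp add: U_def upper_def)
  have "j \<le> n" "j + 1 \<le> n"
    using j n by auto
  have "j - 1 \<le> n - 1" "j - 1 \<noteq> j"
    using j by auto
  then have "state_at w' (j - 1) = X"
    using st' by (simp add: X_def)
  moreover have "upper n w' j = Some Y"
    using j stj by (simp add: upper_def)
  ultimately have "label_at n w' j = least_label n X (Some Y)"
    using label_at_eq_least_label[OF w'(1), of j] j \<open>j \<le> n\<close> by (simp del: least_label.simps)
  then have labj: "label_at n w' j = least_label n X U"
    using least_label_merge[OF X(1) n lead(1)] by (simp add: Y_def)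
  have labj1: "label_at n w' (j + 1) = least_label n Y U"
    using label_at_eq_least_label[OF w'(1), of "j + 1"] \<open>j + 1 \<le> n\<close> stj U' by simp
  have "U = None \<or> mergeable n Y U"
  proof (cases "j + 1 \<le> n - 1")
    case True
    then show ?thesis
      using mergeable_upper[OF w'(1), of j "j + 1"] stj U' by simp
  qed (simp add: U_def upper_def)
  then have "asc_at n w' j"
    using lead(3) labj labj1 by (simp add: asc_at_def Y_def)
  then show ?thesis
    using that w'(1) st' by blast
qed

lemma finite_chain_words: "finite (chain_words n)"
proof (rule finite_subset)
  show "chain_words n \<subseteq> {w. set w \<subseteq> {1..n} \<times> {1..n} \<times> {0..1} \<and> length w = n - 1}"
  proof
    fix w assume w: "w \<in> chain_words n"
    have "w ! i \<in> {1..n} \<times> {1..n} \<times> {0..1}" if "i < n - 1" for i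
      using chain_words_step(1)[OF w that] by (cases "w ! i") (auto simp: mins_def)
    moreover have len: "length w = n - 1"
      using w by (simp add: chain_words_def)
    ultimately have "set w \<subseteq> {1..n} \<times> {1..n} \<times> {0..1}"
      by (metis in_set_conv_nth subsetI)
    then show "w \<in> {w. set w \<subseteq> {1..n} \<times> {1..n} \<times> {0..1} \<and> length w = n - 1}"
      using len by simp
  qed
  show "finite {w :: label list. set w \<subseteq> {1..n} \<times> {1..n} \<times> {0..1} \<and> length w = n - 1}"
    by (intro finite_lists_length_eq) auto
qed

section \<open>Chains of weighted partitions as words\<close>

lemma card_wp_le:
  assumes "W \<in> weighted_partitions n"
  shows "card W \<le> n"
proof -
  obtain X where "to_wp n X = W"
    using to_wp_surj[OF assms] by blast
  moreover have "card (mins n X) \<le> card {1..n}"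
    by (intro card_mono) (auto simp: mins_def)
  ultimately show ?thesis
    using card_to_wp[of n X] by simp
qed

lemma wp_less_card:
  assumes "V \<in> weighted_partitions n" "W \<in> weighted_partitions n" "wp_less n V W"
  shows "card W < card V"
proof -
  obtain X Z where "is_state n X" "to_wp n X = V" "is_state n Z" "to_wp n Z = W"
    using to_wp_surj assms(1,2) by metis
  then show ?thesis
    using assms(3) wp_less_iff[of n X Z] state_le_less_card[of n X Z] card_to_wp is_state_raw by metis
qed

lemma wp_rank_less:
  assumes "V \<in> weighted_partitions n" "W \<in> weighted_partitions n" "wp_less n V W"
  shows "n - card V < n - card W"
  using wp_less_card[OF assms] card_wp_le[OF assms(1)] by simp

text \<open>The rank is injective on a chain, so \<open>m\<close> elements with ranks in
  \<open>{1..m}\<close> meet every rank once, and elements of consecutive ranks are comparable in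
  the right direction.\<close>

lemma chain_states:
  assumes C: "C \<subseteq> weighted_partitions n" "card C = m" "finite C"
    and comparable: "\<And>V W. V \<in> C \<Longrightarrow> W \<in> C \<Longrightarrow> V \<noteq> W \<Longrightarrow> wp_less n V W \<or> wp_less n W V"
    and range: "\<And>W. W \<in> C \<Longrightarrow> n - card W \<in> {1..m}" and m: "m \<le> n - 1"
  obtains X where "\<And>j. j \<in> {1..m} \<Longrightarrow> is_state n (X j) \<and> to_wp n (X j) \<in> C \<and> card (mins n (X j)) = n - j"
    and "C = (\<lambda>j. to_wp n (X j)) ` {1..m}"
    and "\<And>j. j \<in> {1..m} \<Longrightarrow> Suc j \<le> m \<Longrightarrow> state_le n (X j) (X (Suc j))"
proof -
  let ?rk = "\<lambda>W::weighted_partition. n - card W"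
  have inj: "inj_on ?rk C"
  proof (rule inj_onI, rule ccontr)
    fix V W assume VW: "V \<in> C" "W \<in> C" "?rk V = ?rk W" "V \<noteq> W"
    then have "wp_less n V W \<or> wp_less n W V"
      using comparable by blast
    then show False
      using wp_rank_less[of V W] wp_rank_less[of W V] VW C(1) by auto
  qed
  have "?rk ` C = {1..m}"
    using range C(2) card_image[OF inj] by (intro card_seteq) auto
  then have "\<exists>W\<in>C. ?rk W = j" if "j \<in> {1..m}" for j
    using that by (metis (no_types, lifting) imageE)
  then have "\<exists>X. is_state n X \<and> to_wp n X \<in> C \<and> ?rk (to_wp n X) = j" if "j \<in> {1..m}" for j
    using that C(1) to_wp_surj by (metis subsetD)
  then obtain X where X: "\<And>j. j \<in> {1..m} \<Longrightarrow> is_state n (X j)" "\<And>j. j \<in> {1..m} \<Longrightarrow> to_wp n (X j) \<in> C"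
    "\<And>j. j \<in> {1..m} \<Longrightarrow> ?rk (to_wp n (X j)) = j"
    by metis
  have card: "card (mins n (X j)) = n - j" if "j \<in> {1..m}" for j
  proof -
    have "card (mins n (X j)) \<le> n"
      using card_wp_le[of "to_wp n (X j)"] X(2)[OF that] C(1) by (auto simp: card_to_wp)
    then show ?thesis
      using X(3)[OF that] by (simp add: card_to_wp)
  qed
  have im: "C = (\<lambda>j. to_wp n (X j)) ` {1..m}"
  proof
    show "(\<lambda>j. to_wp n (X j)) ` {1..m} \<subseteq> C"
      using X(2) by blast
    show "C \<subseteq> (\<lambda>j. to_wp n (X j)) ` {1..m}"
    proof
      fix W assume W: "W \<in> C"
      then have rk: "?rk W \<in> {1..m}"
        by (rule range)
      have "W = to_wp n (X (?rk W))"
        using inj_onD[OF inj X(3)[OF rk, symmetric] W X(2)[OF rk]] .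
      then show "W \<in> (\<lambda>j. to_wp n (X j)) ` {1..m}"
        using rk by blast
    qed
  qed
  have le: "state_le n (X j) (X (Suc j))" if j: "j \<in> {1..m}" "Suc j \<le> m" for j
  proof -
    have j': "Suc j \<in> {1..m}"
      using j by simp
    have r: "raw_state n (X j)" "raw_state n (X (Suc j))"
      using X(1) j(1) j' by (auto simp: is_state_def)
    have ne: "to_wp n (X j) \<noteq> to_wp n (X (Suc j))"
      using X(3)[OF j(1)] X(3)[OF j'] by auto
    have "\<not> wp_less n (to_wp n (X (Suc j))) (to_wp n (X j))"
      using wp_less_card[of "to_wp n (X (Suc j))" "to_wp n (X j)"] X(2) j(1) j' C(1) card m
      by (force simp: card_to_wp)
    then have "wp_less n (to_wp n (X j)) (to_wp n (X (Suc j)))"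
      using comparable X(2) j(1) j' ne by blast
    then show ?thesis
      using wp_less_iff[OF r] by simp
  qed
  show ?thesis
    by (rule that[of X]) (use X card im le in auto)
qed

lemma state_at_eq_iff:
  assumes "w \<in> chain_words n" "w' \<in> chain_words n" "j \<le> n - 1"
  shows "to_wp n (state_at w j) = to_wp n (state_at w' j) \<longleftrightarrow> state_at w j = state_at w' j"
  using to_wp_inj[OF chain_words_state(2)[OF assms(1,3)] chain_words_state(2)[OF assms(2,3)]] by auto

lemma state_at_mem: "w \<in> chain_words n \<Longrightarrow> j \<le> n - 1 \<Longrightarrow> to_wp n (state_at w j) \<in> weighted_partitions n"
  using to_wp_mem chain_words_state(1) by blast

lemma state_at_less:
  assumes w: "w \<in> chain_words n" and "i < j" "j \<le> n - 1"
  shows "wp_less n (to_wp n (state_at w i)) (to_wp n (state_at w j))"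
proof -
  have "state_at w i \<noteq> state_at w j"
    using chain_words_state(3)[OF w, of i] chain_words_state(3)[OF w, of j] assms(2,3) by auto
  then show ?thesis
    using wp_less_iff[of n "state_at w i" "state_at w j"] chain_words_state(2)[OF w] chain_words_le[OF w] assms(2,3)
    by simp
qed

lemma state_at_rank: "w \<in> chain_words n \<Longrightarrow> j \<le> n - 1 \<Longrightarrow> n - card (to_wp n (state_at w j)) = j"
  using chain_words_state(3) n by (simp add: card_to_wp)

lemma bot_card: "card (wp_bot n) = n"
  by (simp add: to_wp_bot[symmetric] card_to_wp mins_bot)

lemma bot_mem: "wp_bot n \<in> weighted_partitions n"
  using to_wp_mem[OF is_state_bot] by (simp add: to_wp_bot)

text \<open>Both applications are treated together. In the full poset the last state varies and the
  bound above it is \<open>None\<close>; in an interval the weight fixes the last state, which is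
  the bound itself.\<close>

lemma chain_labelling_words:
  assumes M: "M = chain_words n \<and> m = n - 1 \<or> M = {w \<in> chain_words n. weight w = i} \<and> m = n - 2"
  shows "chain_labelling m M (\<lambda>w j. to_wp n (state_at w j)) (asc_at n) (lexord label_less)"
proof
  have sub: "M \<subseteq> chain_words n" and m: "m \<le> n - 1"
    using M by auto
  have S_iff: "to_wp n (state_at w' j) = to_wp n (state_at w j) \<longleftrightarrow> state_at w' j = state_at w j"
    if "w \<in> M" "w' \<in> M" "j \<in> {1..m}" for w w' j
    by (rule state_at_eq_iff) (use that sub m in auto)
  show "finite M"
    using finite_subset[OF sub finite_chain_words] .
  show "trans (lexord label_less)"
    by (rule lexord_transI) (rule label_less_order)
  show "irrefl (lexord label_less)"
    by (intro irreflI lexord_irreflexive allI label_less_order)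
  show "\<exists>w'\<in>M. (\<forall>k\<in>{1..m} - {j}. to_wp n (state_at w' k) = to_wp n (state_at w k)) \<and> asc_at n w' j"
    if w: "w \<in> M" and j: "j \<in> {1..m}" for w j
  proof -
    obtain w' where w': "w' \<in> chain_words n" "\<And>k. k \<le> n - 1 \<Longrightarrow> k \<noteq> j \<Longrightarrow> state_at w' k = state_at w k" "asc_at n w' j"
      by (rule ascent_word_exists[of w j]) (use w j sub m in auto)
    have "w' \<in> M"
    proof (cases "m = n - 1 \<and> M = chain_words n")
      case False
      \<comment> \<open>Here \<open>j\<close> is at most \<open>n - 2\<close>, so the last state and
        with it the weight are unchanged.\<close>
      then have M': "M = {w \<in> chain_words n. weight w = i}" "m = n - 2" "m \<noteq> 0"
        using M j by auto
      then have "state_at w' (n - 1) = state_at w (n - 1)"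
        using w'(2)[of "n - 1"] j by auto
      then have "weight w' = weight w"
        using chain_words_total w'(1) w sub by (metis subsetD)
      then show ?thesis
        using M' w w'(1) by simp
    qed (use w' in simp)
    then show ?thesis
      using w' m by (intro bexI[of _ w']) auto
  qed
  fix w w' j k
  assume w: "w \<in> M" "w' \<in> M" and jk: "j \<in> {1..m}" "k \<in> {1..m}" "asc_at n w j" "asc_at n w k"
    and agree: "\<And>l. l \<in> {1..m} - {j, k} \<Longrightarrow> to_wp n (state_at w' l) = to_wp n (state_at w l)" and ne: "w' \<noteq> w"
  have wc: "w \<in> chain_words n" "w' \<in> chain_words n"
    using w sub by auto
  have last: "state_at w' (n - 1) = state_at w (n - 1)" if "m \<noteq> n - 1"
  proof -
    have "weight w' = weight w"
      using M w that by auto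
    then show ?thesis
      using chain_words_wp_top wc state_at_eq_iff[of w' w "n - 1"] by simp
  qed
  show "(w, w') \<in> lexord label_less"
  proof (rule ascents_least_words[OF wc m _ _ jk _ ne])
    show "upper n w (m + 1) = upper n w' (m + 1)"
    proof (cases "m = n - 1")
      case False
      then have "m + 1 = n - 1"
        using M jk by auto
      then show ?thesis
        using last False by (simp add: upper_def)
    qed (simp add: upper_def)
    show "state_at w' l = state_at w l" if "l \<in> {m + 1..n - 1}" for l
    proof -
      have "l = n - 1" "m \<noteq> n - 1"
        using that M by auto
      then show ?thesis
        using last by simp
    qed
    show "state_at w' l = state_at w l" if "l \<in> {1..m} - {j, k}" for l
      using agree[OF that] S_iff[OF w, of l] that by auto
  qed
qed

lemma full_labelling:
  "order_complex_labelling (n - 1) (chain_words n) (\<lambda>w j. to_wp n (state_at w j)) (asc_at n) (lexord label_less)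
     (weighted_partitions n - {wp_bot n}) (wp_less n) (\<lambda>W. n - card W)"
proof (intro order_complex_labelling.intro order_complex_labelling_axioms.intro)
  show "chain_labelling (n - 1) (chain_words n) (\<lambda>w j. to_wp n (state_at w j)) (asc_at n) (lexord label_less)"
    by (rule chain_labelling_words) simp
  show range: "n - card W \<in> {1..n - 1}" if W: "W \<in> weighted_partitions n - {wp_bot n}" for W
  proof -
    obtain X where X: "is_state n X" "to_wp n X = W"
      using to_wp_surj W by blast
    have "bot_state \<noteq> X"
      using W X(2) to_wp_bot by auto
    then have "card (mins n X) < n"
      using state_le_less_card[OF raw_bot is_state_raw[OF X(1)]] X(1) by (simp add: is_state_def mins_bot)
    moreover have "card (mins n X) > 0"
      using one_mem_mins[OF is_state_raw[OF X(1)] n] by (auto simp: card_gt_0_iff)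
    ultimately show ?thesis
      using X(2) card_to_wp[of n X] by auto
  qed
  show "n - card V < n - card W"
    if "V \<in> weighted_partitions n - {wp_bot n}" "W \<in> weighted_partitions n - {wp_bot n}" "wp_less n V W" for V W
    using wp_rank_less that by blast
  show "to_wp n (state_at w j) \<in> weighted_partitions n - {wp_bot n}"
    if "w \<in> chain_words n" "j \<in> {1..n - 1}" for w j
    using state_at_mem[of w j] state_at_rank[of w j] that bot_card by auto
  show "n - card (to_wp n (state_at w j)) = j" if "w \<in> chain_words n" "j \<in> {1..n - 1}" for w j
    using state_at_rank that by simp
  show "wp_less n (to_wp n (state_at w i)) (to_wp n (state_at w j))"
    if "w \<in> chain_words n" "i \<in> {1..n - 1}" "j \<in> {1..n - 1}" "i < j" for w i j
    using state_at_less that by simp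
  show "w = w'" if "w \<in> chain_words n" "w' \<in> chain_words n"
    "\<And>j. j \<in> {1..n - 1} \<Longrightarrow> to_wp n (state_at w j) = to_wp n (state_at w' j)" for w w'
    using chain_words_eqI that state_at_eq_iff by simp
  fix C assume C: "C \<in> order_complex (weighted_partitions n - {wp_bot n}) (wp_less n)" "card C = n - 1"
  obtain X where X: "\<And>j. j \<in> {1..n - 1} \<Longrightarrow>
      is_state n (X j) \<and> to_wp n (X j) \<in> C \<and> card (mins n (X j)) = n - j"
    and im: "C = (\<lambda>j. to_wp n (X j)) ` {1..n - 1}"
    and le: "\<And>j. j \<in> {1..n - 1} \<Longrightarrow> Suc j \<le> n - 1 \<Longrightarrow> state_le n (X j) (X (Suc j))"
    by (rule chain_states[of C "n - 1"]) (use C range in \<open>auto simp: order_complex_def\<close>)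
  define T where "T j = (if j = 0 then bot_state else X j)" for j
  have T: "is_state n (T j)" "card (mins n (T j)) = n - j" if "j \<le> n - 1" for j
    using X[of j] that by (auto simp: T_def is_state_bot mins_bot)
  have "state_le n (T j) (T (Suc j))" if "j < n - 1" for j
    using le[of j] X[of "Suc j"] that by (auto simp: T_def is_state_def)
  note T_le = this
  have T0: "T 0 = bot_state"
    by (simp add: T_def)
  obtain w where w: "w \<in> chain_words n" "\<And>j. j \<le> n - 1 \<Longrightarrow> state_at w j = T j"
    by (rule word_of_chain[of n T]) (use n T0 T(1)[THEN is_state_raw] T(2) T_le in blast)+
  then show "\<exists>w\<in>chain_words n. C = (\<lambda>j. to_wp n (state_at w j)) ` {1..n - 1}"
    unfolding im by (intro bexI[of _ w] image_cong) (auto simp: T_def)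
qed

lemma interval_labelling:
  assumes i: "i \<le> n - 1"
  shows "order_complex_labelling (n - 2) {w \<in> chain_words n. weight w = i} (\<lambda>w j. to_wp n (state_at w j))
     (asc_at n) (lexord label_less)
     {W \<in> weighted_partitions n. wp_less n (wp_bot n) W \<and> wp_less n W (wp_top n i)} (wp_less n)
     (\<lambda>W. n - card W)"
    (is "order_complex_labelling _ ?M _ _ _ ?P _ _")
proof (intro order_complex_labelling.intro order_complex_labelling_axioms.intro)
  have "partition_on {1..n} {{1..n}}"
    using n by (intro partition_onI) auto
  then have top: "wp_top n i \<in> weighted_partitions n"
    using i by (simp add: weighted_partitions_def wp_top_def)
  show "chain_labelling (n - 2) ?M (\<lambda>w j. to_wp n (state_at w j)) (asc_at n) (lexord label_less)"
    by (rule chain_labelling_words[where i = i]) simp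
  show range: "n - card W \<in> {1..n - 2}" if W: "W \<in> ?P" for W
  proof -
    have "card W < n" "1 < card W"
      using W wp_less_card[OF bot_mem, of W] wp_less_card[OF _ top, of W] bot_card
      by (auto simp: wp_top_def)
    then show ?thesis
      by auto
  qed
  show "n - card V < n - card W" if "V \<in> ?P" "W \<in> ?P" "wp_less n V W" for V W
    using wp_rank_less that by blast
  show "to_wp n (state_at w j) \<in> ?P" if "w \<in> ?M" "j \<in> {1..n - 2}" for w j
    using state_at_mem[of w j] state_at_less[of w 0 j] state_at_less[of w j "n - 1"] chain_words_wp_top[of w] that
    by (auto simp: state_at_0 to_wp_bot)
  show "n - card (to_wp n (state_at w j)) = j" if "w \<in> ?M" "j \<in> {1..n - 2}" for w j
    using state_at_rank[of w j] that by auto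
  show "wp_less n (to_wp n (state_at w i)) (to_wp n (state_at w j))"
    if "w \<in> ?M" "i \<in> {1..n - 2}" "j \<in> {1..n - 2}" "i < j" for w i j
    using state_at_less that by simp
  show "w = w'" if w: "w \<in> ?M" "w' \<in> ?M"
    and eq: "\<And>j. j \<in> {1..n - 2} \<Longrightarrow> to_wp n (state_at w j) = to_wp n (state_at w' j)" for w w'
  proof (rule chain_words_eqI)
    show "w \<in> chain_words n" "w' \<in> chain_words n"
      using w by auto
    then have last: "state_at w (n - 1) = state_at w' (n - 1)"
      using chain_words_wp_top state_at_eq_iff[of w w' "n - 1"] w by simp
    show "state_at w j = state_at w' j" if "j \<in> {1..n - 1}" for j
    proof (cases "j = n - 1")
      case False
      then have j: "j \<in> {1..n - 2}" "j \<le> n - 1"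
        using that by auto
      then show ?thesis
        using eq[OF j(1)] state_at_eq_iff[OF _ _ j(2), of w w'] w by simp
    qed (use last in simp)
  qed
  fix C assume C: "C \<in> order_complex ?P (wp_less n)" "card C = n - 2"
  obtain X where X: "\<And>j. j \<in> {1..n - 2} \<Longrightarrow>
      is_state n (X j) \<and> to_wp n (X j) \<in> C \<and> card (mins n (X j)) = n - j"
    and im: "C = (\<lambda>j. to_wp n (X j)) ` {1..n - 2}"
    and le: "\<And>j. j \<in> {1..n - 2} \<Longrightarrow> Suc j \<le> n - 2 \<Longrightarrow> state_le n (X j) (X (Suc j))"
    by (rule chain_states[of C "n - 2"]) (use C range in \<open>auto simp: order_complex_def\<close>)
  obtain Y where Y: "is_state n Y" "to_wp n Y = wp_top n i"
    using to_wp_surj[OF top] .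
  have cardY: "card (mins n Y) = 1"
    using card_to_wp[of n Y] Y(2) by (simp add: wp_top_def)
  define T where "T j = (if j = 0 then bot_state else if j = n - 1 then Y else X j)" for j
  have T: "is_state n (T j)" "card (mins n (T j)) = n - j" if "j \<le> n - 1" for j
    using X[of j] that Y cardY n by (auto simp: T_def is_state_bot mins_bot)
  have "state_le n (T j) (T (Suc j))" if "j < n - 1" for j
  proof (cases "j = 0")
    case True
    then show ?thesis
      using T(1)[of "Suc j"] that by (auto simp: T_def is_state_def)
  next
    case False
    then have j: "j \<in> {1..n - 2}"
      using that by auto
    show ?thesis
    proof (cases "Suc j = n - 1")
      case True
      have "to_wp n (X j) \<in> ?P"
        using X[OF j] C by (auto simp: order_complex_def)
      then have "wp_less n (to_wp n (X j)) (to_wp n Y)"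
        using Y(2) by simp
      then show ?thesis
        using wp_less_iff[of n "X j" Y] X[OF j] Y(1) True False j by (auto simp: T_def is_state_def)
    next
      case Suc: False
      then show ?thesis
        using le[OF j] False that by (simp add: T_def)
    qed
  qed
  note T_le = this
  have T0: "T 0 = bot_state"
    by (simp add: T_def)
  obtain w where w: "w \<in> chain_words n" "\<And>j. j \<le> n - 1 \<Longrightarrow> state_at w j = T j"
    by (rule word_of_chain[of n T]) (use n T0 T(1)[THEN is_state_raw] T(2) T_le in blast)+
  \<comment> \<open>For \<open>n = 1\<close> the ranks 0 and \<open>n - 1\<close> coincide and
    \<open>T\<close> returns \<open>bot_state\<close>, which then equals \<open>Y\<close>.\<close>
  have "T (n - 1) = Y"
  proof (cases "n - 1 = 0")
    case True
    then have "card (mins n bot_state) \<le> card (mins n Y)"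
      using cardY n by (simp add: mins_bot)
    then have "bot_state = Y"
      using state_le_eqI[OF raw_bot is_state_raw[OF Y(1)]] Y(1) by (simp add: is_state_def)
    then show ?thesis
      using True by (simp add: T_def)
  qed (simp add: T_def)
  then have "wp_top n (weight w) = wp_top n i"
    using chain_words_wp_top[OF w(1)] w(2)[of "n - 1"] Y(2) by simp
  then have "weight w = i"
    by (simp add: wp_top_def)
  moreover have "state_at w j = X j" if "j \<in> {1..n - 2}" for j
  proof -
    have "j \<le> n - 1" "j \<noteq> n - 1" "j \<noteq> 0"
      using that by auto
    then show ?thesis
      using w(2) by (simp add: T_def)
  qed
  then have "C = (\<lambda>j. to_wp n (state_at w j)) ` {1..n - 2}"
    unfolding im by (intro image_cong) simp_all
  ultimately show "\<exists>w\<in>?M. C = (\<lambda>j. to_wp n (state_at w j)) ` {1..n - 2}"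
    using w(1) by blast
qed

section \<open>Homology of the poset and of its intervals\<close>

theorem full_homology_free:
  "free_of_rank (class_ring :: 'k::comm_ring_1 ring)
     (reduced_homology (weighted_partitions n - {wp_bot n}) (wp_less n) (int n - 2))
     (card {w \<in> chain_words n. \<forall>j\<in>{1..n - 1}. \<not> asc_at n w j})"
proof -
  interpret order_complex_labelling "n - 1" "chain_words n" "\<lambda>w j. to_wp n (state_at w j)" "asc_at n"
    "lexord label_less" "weighted_partitions n - {wp_bot n}" "wp_less n" "\<lambda>W. n - card W"
    by (rule full_labelling)
  have deg: "int n - 2 = int (n - 1) - 1"
    using n by simp
  have "finite ascent_free"
    using finite_M unfolding ascent_free_def by (rule finite_subset[rotated]) blast
  then show ?thesis
    unfolding deg using coordinate_system_free[OF coordinate_system_top_homology]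
    unfolding ascent_free_def by blast
qed

theorem interval_homology_coordinates:
  assumes i: "i \<le> n - 1"
  obtains \<phi> where "coordinate_system
    (interval_homology (weighted_partitions n) (wp_less n) (wp_bot n) (wp_top n i) (int n - 3) ::
      ('k::comm_ring_1, _) module)
    {w \<in> chain_words n. weight w = i \<and> (\<forall>j\<in>{1..n - 2}. \<not> asc_at n w j)} \<phi>"
proof -
  let ?P = "{W \<in> weighted_partitions n. wp_less n (wp_bot n) W \<and> wp_less n W (wp_top n i)}"
  interpret order_complex_labelling "n - 2" "{w \<in> chain_words n. weight w = i}"
    "\<lambda>w j. to_wp n (state_at w j)" "asc_at n" "lexord label_less" ?P "wp_less n" "\<lambda>W. n - card W"
    by (rule interval_labelling[OF i])
  have H: "interval_homology (weighted_partitions n) (wp_less n) (wp_bot n) (wp_top n i) (int n - 3) =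
      (reduced_homology ?P (wp_less n) (int (n - 2) - 1) :: ('k, _) module)"
  \<comment> \<open>For \<open>n = 1\<close> the interval is degenerate and the required degree is
    -2; the shift in \<open>interval_homology\<close> turns this into degree -1 of the empty poset,
    in accordance with the truncated \<open>n - 2\<close>.\<close>
  proof (cases "n = 1")
    case True
    have "wp_bot n = wp_top n i"
      using True i by (simp add: wp_bot_def wp_top_def)
    moreover have P: "?P = {}"
      using rank_range True by fastforce
    ultimately show ?thesis
      unfolding interval_homology_def P using True by simp
  next
    case False
    have "wp_bot n \<noteq> wp_top n i"
    proof
      assume "wp_bot n = wp_top n i"
      then have "card (wp_bot n) = 1"
        by (simp add: wp_top_def)
      then show False
        using bot_card False by simp
    qed
    moreover have "int n - 3 = int (n - 2) - 1"
      using False n by simp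
    ultimately show ?thesis
      unfolding interval_homology_def by (simp only: if_False)
  qed
  have D: "{w \<in> chain_words n. weight w = i \<and> (\<forall>j\<in>{1..n - 2}. \<not> asc_at n w j)} = ascent_free"
    unfolding ascent_free_def by blast
  show ?thesis
    by (rule that, unfold H D, rule coordinate_system_top_homology)
qed

end

section \<open>Counting ascent-free words\<close>

text \<open>The validity of a word involves the states only through their sets of block minima, and
  a merge just deletes its larger minimum.\<close>

fun merge_word :: "nat set \<Rightarrow> label list \<Rightarrow> bool" where
  "merge_word L [] \<longleftrightarrow> card L = 1"
| "merge_word L (l # w) \<longleftrightarrow> valid_label L l \<and> merge_word (L - {fst (snd l)}) w"

abbreviation asc_chain :: "label list \<Rightarrow> bool" where
  "asc_chain \<equiv> successively ascent"

abbreviation asc_free :: "label list \<Rightarrow> bool" where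
  "asc_free \<equiv> successively (\<lambda>x y. \<not> ascent x y)"

lemma ascent_iff:
  "ascent x y \<longleftrightarrow> fst x < fst y \<or>
     fst x = fst y \<and> fst (snd x) < fst (snd y) \<and> snd (snd x) \<le> snd (snd y)"
  by (cases x, cases y) simp

lemma valid_label_iff:
  "valid_label L l \<longleftrightarrow> fst l \<in> L \<and> fst (snd l) \<in> L \<and> fst l < fst (snd l) \<and> snd (snd l) \<le> 1"
  by (cases l) simp

lemma weight_Nil [simp]: "weight [] = 0"
  and weight_Cons [simp]: "weight (l # w) = snd (snd l) + weight w"
  and weight_append [simp]: "weight (v @ w) = weight v + weight w"
  by (auto simp: weight_def split: prod.splits)

lemma merge_word_set:
  "merge_word L w \<Longrightarrow> l \<in> set w \<Longrightarrow> fst l \<in> L \<and> fst (snd l) \<in> L \<and> fst l < fst (snd l) \<and> snd (snd l) \<le> 1"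
proof (induction w arbitrary: L)
  case (Cons x w)
  then show ?case
    by (cases "l = x") (auto simp: valid_label_iff)
qed simp

lemma merge_word_length: "merge_word L w \<Longrightarrow> Suc (length w) = card L"
proof (induction w arbitrary: L)
  case (Cons l w)
  then have "Suc (length w) = card (L - {fst (snd l)})" "fst (snd l) \<in> L"
    by (auto simp: valid_label_iff)
  then show ?case
    by (metis card.infinite card_Suc_Diff1 finite_Diff2 finite.emptyI finite.insertI length_Cons nat.simps(3))
qed simp

lemma finite_merge_words:
  assumes "finite L"
  shows "finite {w. merge_word L w}"
proof (rule finite_subset)
  show "{w. merge_word L w} \<subseteq> {w. set w \<subseteq> L \<times> L \<times> {0..1} \<and> length w = card L - 1}"
    using merge_word_set merge_word_length by (force simp flip: One_nat_def)
  show "finite {w. set w \<subseteq> L \<times> L \<times> {0..1::nat} \<and> length w = card L - 1}"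
    using assms by (intro finite_lists_length_eq) auto
qed

lemma merge_word_iff_states:
  assumes "raw_state n X"
  shows "merge_word (mins n X) w \<longleftrightarrow> Suc (length w) = card (mins n X) \<and>
    (\<forall>i<length w. valid_label (mins n (foldl merge X (take i w))) (w ! i))"
  using assms
proof (induction w arbitrary: X)
  case (Cons l w)
  obtain a b u where l: "l = (a, b, u)"
    by (cases l)
  show ?case
  proof (cases "valid_label (mins n X) l")
    case True
    have raw: "raw_state n (merge X l)" and mins: "mins n (merge X l) = mins n X - {b}" and b: "b \<in> mins n X"
      using raw_merge[OF Cons.prems True] mins_merge[of n X a b u] Cons.prems True l by auto
    have card: "Suc (card (mins n X - {b})) = card (mins n X)"
      using b by (intro card.remove[symmetric]) auto
    have "merge_word (mins n X) (l # w) \<longleftrightarrow> merge_word (mins n (merge X l)) w"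
      using True l mins by simp
    also have "\<dots> \<longleftrightarrow> Suc (length (l # w)) = card (mins n X) \<and>
        (\<forall>i<length w. valid_label (mins n (foldl merge X (take (Suc i) (l # w)))) ((l # w) ! Suc i))"
      unfolding Cons.IH[OF raw] using card mins by auto
    also have "(\<forall>i<length w. valid_label (mins n (foldl merge X (take (Suc i) (l # w)))) ((l # w) ! Suc i)) \<longleftrightarrow>
        (\<forall>i<length (l # w). valid_label (mins n (foldl merge X (take i (l # w)))) ((l # w) ! i))"
      using True by (simp only: length_Cons All_less_Suc2 take_0 foldl_Nil nth_Cons_0) simp
    finally show ?thesis .
  next
    case False
    then show ?thesis
      by fastforce
  qed
qed auto

lemma chain_words_eq:
  assumes "1 \<le> n"
  shows "chain_words n = {w. merge_word {1..n} w}"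
  using merge_word_iff_states[OF raw_bot, of n] assms
  by (auto simp: chain_words_def mins_bot state_at_def)

text \<open>Labels with first entry \<open>\<alpha>\<close> delete only numbers above
  \<open>\<alpha>\<close>, so \<open>\<alpha>\<close> stays available and the prefix is valid in any
  order of distinct second entries.\<close>

lemma merge_word_append:
  assumes "\<forall>l\<in>set v. fst l = \<alpha>" "\<alpha> \<in> L"
  shows "merge_word L (v @ w) \<longleftrightarrow>
    distinct (map (\<lambda>l. fst (snd l)) v) \<and>
    (\<forall>l\<in>set v. fst (snd l) \<in> L \<and> \<alpha> < fst (snd l) \<and> snd (snd l) \<le> 1) \<and>
    merge_word (L - (\<lambda>l. fst (snd l)) ` set v) w"
  using assms
proof (induction v arbitrary: L)
  case (Cons l v)
  let ?b = "\<lambda>l::label. fst (snd l)"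
  show ?case
  proof (cases "\<alpha> < ?b l")
    case True
    then have "merge_word (L - {?b l}) (v @ w) \<longleftrightarrow> distinct (map ?b v) \<and>
        (\<forall>x\<in>set v. ?b x \<in> L - {?b l} \<and> \<alpha> < ?b x \<and> snd (snd x) \<le> 1) \<and>
        merge_word (L - {?b l} - ?b ` set v) w"
      using Cons.prems by (intro Cons.IH) auto
    moreover have "L - {?b l} - ?b ` set v = L - ?b ` set (l # v)"
      by auto
    moreover define Q where "Q = merge_word (L - ?b ` insert l (set v)) w"
    ultimately have IH: "merge_word (L - {?b l}) (v @ w) \<longleftrightarrow> distinct (map ?b v) \<and>
        (\<forall>x\<in>set v. ?b x \<in> L - {?b l} \<and> \<alpha> < ?b x \<and> snd (snd x) \<le> 1) \<and> Q"
      by simp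
    have "merge_word L ((l # v) @ w) \<longleftrightarrow> ?b l \<in> L \<and> snd (snd l) \<le> 1 \<and> merge_word (L - {?b l}) (v @ w)"
      using Cons.prems True by (simp add: valid_label_iff)
    moreover have "(\<forall>x\<in>set v. ?b x \<in> L - {?b l} \<and> \<alpha> < ?b x \<and> snd (snd x) \<le> 1) \<longleftrightarrow>
        ?b l \<notin> ?b ` set v \<and> (\<forall>x\<in>set v. ?b x \<in> L \<and> \<alpha> < ?b x \<and> snd (snd x) \<le> 1)"
      unfolding image_iff Diff_iff singleton_iff by metis
    ultimately show ?thesis
      unfolding IH Q_def[symmetric] list.map distinct.simps set_map list.set ball_simps(7)
      using True by argo
  next
    case False
    then show ?thesis
      using Cons.prems by (auto simp: valid_label_iff)
  qed
qed simp

section \<open>Ascending words with constant first entry\<close>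

definition alpha_words :: "nat \<Rightarrow> nat set \<Rightarrow> label list set" where
  "alpha_words \<alpha> K = {v. (\<forall>l\<in>set v. fst l = \<alpha> \<and> snd (snd l) \<le> 1) \<and> asc_chain v \<and>
     (\<lambda>l. fst (snd l)) ` set v = K}"

lemma asc_chain_alpha_iff:
  assumes "\<forall>l\<in>set v. fst l = \<alpha>"
  shows "asc_chain v \<longleftrightarrow>
    sorted_wrt (<) (map (\<lambda>l. fst (snd l)) v) \<and> sorted (map (\<lambda>l. snd (snd l)) v)"
proof -
  let ?R = "\<lambda>x y::label. fst (snd x) < fst (snd y) \<and> snd (snd x) \<le> snd (snd y)"
  have "asc_chain v \<longleftrightarrow> successively ?R v"
    using assms by (intro successively_cong) (auto simp: ascent_iff)
  also have "\<dots> \<longleftrightarrow> sorted_wrt ?R v"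
    by (rule successively_conv_sorted_wrt) (auto intro: transpI)
  also have "\<dots> \<longleftrightarrow> sorted_wrt (<) (map (\<lambda>l. fst (snd l)) v) \<and> sorted (map (\<lambda>l. snd (snd l)) v)"
    by (induction v) auto
  finally show ?thesis .
qed

text \<open>A weakly increasing word in 0 and 1 is determined by the number of its ones, which
  ranges from 0 to the length.\<close>

lemma sum_sorted_weights:
  fixes t :: "'a::comm_ring_1" and bs :: "nat list" and \<alpha> :: nat
  defines "A \<equiv> \<lambda>bs::nat list. {v::label list. map (\<lambda>l. fst (snd l)) v = bs \<and>
    (\<forall>l\<in>set v. fst l = \<alpha> \<and> snd (snd l) \<le> 1) \<and> sorted (map (\<lambda>l. snd (snd l)) v)}"
  shows "finite (A bs) \<and> (\<Sum>v\<in>A bs. t ^ weight v) = (\<Sum>i\<le>length bs. t ^ i)"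
proof (induction bs)
  case Nil
  have "A [] = {[]}"
    by (auto simp: A_def)
  then show ?case
    by simp
next
  case (Cons b bs)
  \<comment> \<open>If the first weight is 1, all are; otherwise the first letter is
    removed.\<close>
  let ?ones = "map (\<lambda>b. (\<alpha>, b, 1)) (b # bs)"
  have split: "A (b # bs) = insert ?ones ((#) (\<alpha>, b, 0) ` A bs)"
  proof
    show "A (b # bs) \<subseteq> insert ?ones ((#) (\<alpha>, b, 0) ` A bs)"
    proof
      fix v assume v: "v \<in> A (b # bs)"
      then obtain u v' where v': "v = (\<alpha>, b, u) # v'" "u \<le> 1"
        by (cases v) (auto simp: A_def)
      show "v \<in> insert ?ones ((#) (\<alpha>, b, 0) ` A bs)"
      proof (cases "u = 0")
        case True
        then show ?thesis
          using v v' by (auto simp: A_def)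
      next
        case False
        then have "u = 1"
          using v' by simp
        then have "\<forall>x\<in>set v'. fst x = \<alpha> \<and> snd (snd x) \<le> 1" "\<forall>x\<in>set v'. 1 \<le> snd (snd x)"
          using v v' by (auto simp: A_def)
        then have "l = (\<alpha>, fst (snd l), 1)" if "l \<in> set v'" for l
          using that by (simp add: prod_eq_iff le_antisym)
        then have "v' = map (\<lambda>l. (\<alpha>, fst (snd l), 1)) v'"
          by (simp add: map_idI[symmetric])
        also have "\<dots> = map (\<lambda>b. (\<alpha>, b, 1)) (map (\<lambda>l. fst (snd l)) v')"
          by simp
        also have "map (\<lambda>l. fst (snd l)) v' = bs"
          using v v' by (auto simp: A_def)
        finally show ?thesis
          using v' \<open>u = 1\<close> by simp
      qed
    qed
    have "sorted (map (\<lambda>l::label. snd (snd l)) ?ones)"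
      by (simp add: o_def map_replicate_const)
    then show "insert ?ones ((#) (\<alpha>, b, 0) ` A bs) \<subseteq> A (b # bs)"
      by (auto simp: A_def o_def)
  qed
  have "?ones \<notin> (#) (\<alpha>, b, 0) ` A bs"
    by auto
  moreover have "weight ?ones = Suc (length bs)"
    by (simp add: weight_def o_def sum_list_triv)
  moreover have "(\<Sum>v\<in>(#) (\<alpha>, b, 0) ` A bs. t ^ weight v) = (\<Sum>i\<le>length bs. t ^ i)"
    using Cons.IH by (subst sum.reindex) auto
  ultimately show ?case
    unfolding split using Cons.IH by simp
qed

lemma alpha_words_eq:
  assumes "finite K"
  shows "alpha_words \<alpha> K = {v. map (\<lambda>l. fst (snd l)) v = sorted_list_of_set K \<and>
    (\<forall>l\<in>set v. fst l = \<alpha> \<and> snd (snd l) \<le> 1) \<and> sorted (map (\<lambda>l. snd (snd l)) v)}"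
proof -
  have "sorted_wrt (<) (map (\<lambda>l. fst (snd l)) v) \<and> (\<lambda>l. fst (snd l)) ` set v = K \<longleftrightarrow>
      map (\<lambda>l. fst (snd l)) v = sorted_list_of_set K" for v :: "label list"
  proof
    assume *: "sorted_wrt (<) (map (\<lambda>l. fst (snd l)) v) \<and> (\<lambda>l. fst (snd l)) ` set v = K"
    show "map (\<lambda>l. fst (snd l)) v = sorted_list_of_set K"
      by (rule strict_sorted_equal) (use * assms in auto)
  next
    assume *: "map (\<lambda>l. fst (snd l)) v = sorted_list_of_set K"
    have "set (map (\<lambda>l. fst (snd l)) v) = K" "sorted_wrt (<) (map (\<lambda>l. fst (snd l)) v)"
      unfolding * using assms by simp_all
    then show "sorted_wrt (<) (map (\<lambda>l. fst (snd l)) v) \<and> (\<lambda>l. fst (snd l)) ` set v = K"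
      unfolding set_map by blast
  qed
  then show ?thesis
    unfolding alpha_words_def using asc_chain_alpha_iff[of _ \<alpha>] by (intro Collect_cong) metis
qed

lemma sum_alpha_words:
  fixes t :: "'a::comm_ring_1"
  assumes "finite K"
  shows "finite (alpha_words \<alpha> K)" "(\<Sum>v\<in>alpha_words \<alpha> K. t ^ weight v) = (\<Sum>i\<le>card K. t ^ i)"
  using sum_sorted_weights[where \<alpha> = \<alpha> and bs = "sorted_list_of_set K" and t = t] assms by (simp_all add: alpha_words_eq)

lemma length_alpha_words: "v \<in> alpha_words \<alpha> K \<Longrightarrow> length v = card K"
proof -
  assume v: "v \<in> alpha_words \<alpha> K"
  then have "sorted_wrt (<) (map (\<lambda>l. fst (snd l)) v)"
    using asc_chain_alpha_iff by (auto simp: alpha_words_def)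
  then have "distinct (map (\<lambda>l. fst (snd l)) v)"
    by (simp add: strict_sorted_iff)
  then have "card (set (map (\<lambda>l. fst (snd l)) v)) = length v"
    using distinct_card by fastforce
  then show ?thesis
    using v by (simp add: alpha_words_def)
qed

text \<open>
  The word \<open>z\<close> is empty or consists of the label \<open>(1, N, 0)\<close> with large \<open>N\<close>. All splittings of a word into an
  ascending \<open>\<alpha>\<close>-prefix and an ascent-free rest cancel in pairs, by moving the last letter of the
  longest ascending prefix, unless there is no such prefix or the whole word is ascending.
\<close>

lemma sum_splits_Cons:
  fixes l :: label and z :: "label list"
  assumes "fst l = \<alpha>" "\<forall>x\<in>set w. fst x \<le> \<alpha>" "z = [] \<or> (\<exists>c. z = [c])"
  shows "(\<Sum>i\<le>length w. (- 1) ^ i * of_bool ((\<forall>x\<in>set (take i w). fst x = \<alpha>) \<and>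
        asc_chain (l # take i w) \<and> asc_free (drop i w @ z))) =
      (of_bool (asc_free (l # w @ z)) +
       of_bool (z \<noteq> []) * (- 1) ^ length w * of_bool ((\<forall>x\<in>set w. fst x = \<alpha>) \<and> asc_chain (l # w @ z))
       :: 'a::comm_ring_1)"
  using assms(1,2)
proof (induction w arbitrary: l)
  case Nil
  then show ?case
    using assms(3) by auto
next
  case (Cons m w)
  let ?f = "\<lambda>l w i. of_bool ((\<forall>x\<in>set (take i w). fst x = \<alpha>) \<and> asc_chain (l # take i w) \<and>
    asc_free (drop i w @ z)) :: 'a"
  have "(\<Sum>i\<le>length (m # w). (- 1) ^ i * ?f l (m # w) i) =
      ?f l (m # w) 0 + (\<Sum>i\<le>length w. (- 1) ^ Suc i * ?f l (m # w) (Suc i))"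
    by (simp add: sum.atMost_Suc_shift del: sum.atMost_Suc)
  also have "(\<Sum>i\<le>length w. (- 1) ^ Suc i * ?f l (m # w) (Suc i)) =
      - of_bool (fst m = \<alpha> \<and> ascent l m) * (\<Sum>i\<le>length w. (- 1) ^ i * ?f m w i)"
    unfolding sum_distrib_left
    by (intro sum.cong refl) (cases "fst m = \<alpha> \<and> ascent l m"; auto)
  also have "?f l (m # w) 0 = of_bool (asc_free (m # w @ z))"
    by simp
  finally have eq: "(\<Sum>i\<le>length (m # w). (- 1) ^ i * ?f l (m # w) i) = of_bool (asc_free (m # w @ z)) -
      of_bool (fst m = \<alpha> \<and> ascent l m) * (\<Sum>i\<le>length w. (- 1) ^ i * ?f m w i)"
    by simp
  show ?case
  proof (cases "fst m = \<alpha>")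
    case True
    have IH: "(\<Sum>i\<le>length w. (- 1) ^ i * ?f m w i) = of_bool (asc_free (m # w @ z)) +
       of_bool (z \<noteq> []) * (- 1) ^ length w * of_bool ((\<forall>x\<in>set w. fst x = \<alpha>) \<and> asc_chain (m # w @ z))"
      using Cons.prems True by (intro Cons.IH) auto
    show ?thesis
      unfolding eq IH using True by (cases "ascent l m") auto
  next
    case False
    then have "\<not> ascent l m"
      using Cons.prems by (auto simp: ascent_iff)
    then show ?thesis
      unfolding eq using False by auto
  qed
qed

lemma asc_free_hd_greatest:
  assumes "asc_free w" "x \<in> set w"
  shows "fst x \<le> fst (hd w)"
  using assms
proof (induction w arbitrary: x)
  case (Cons l w)
  show ?case
  proof (cases "x \<in> set w")
    case True
    then have "fst x \<le> fst (hd w)" "\<not> ascent l (hd w)"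
      using Cons by (cases w; auto)+
    then show ?thesis
      by (auto simp: ascent_iff)
  qed (use Cons.prems in auto)
qed simp

text \<open>If the first entry of \<open>w\<close> is below \<open>\<alpha>\<close>, only the empty
  prefix occurs, and freeness of ascents keeps all entries below \<open>\<alpha>\<close>. If it
  equals \<open>\<alpha>\<close>, the empty prefix cancels the main term of
  \<open>sum_splits_Cons\<close>. A fully ascending word survives only with nonempty
  \<open>z\<close>, whose letter cannot be moved into the prefix.\<close>

lemma sum_splits:
  assumes w: "\<forall>x\<in>set w. fst x \<le> \<alpha>" and z: "z = [] \<or> (\<exists>c. z = [c])"
  shows "(\<Sum>i\<le>length w. (- 1) ^ i * of_bool ((\<forall>x\<in>set (take i w). fst x = \<alpha>) \<and>
        asc_chain (take i w) \<and> asc_free (drop i w @ z))) =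
      (if w = [] then 1 else of_bool (asc_free (w @ z) \<and> (\<forall>x\<in>set w. fst x < \<alpha>)) +
       of_bool (z \<noteq> []) * (- 1) ^ length w * of_bool ((\<forall>x\<in>set w. fst x = \<alpha>) \<and> asc_chain (w @ z))
       :: 'a::comm_ring_1)"
proof (cases w)
  case Nil
  then show ?thesis
    using z by auto
next
  case (Cons l v)
  let ?f = "\<lambda>w i. of_bool ((\<forall>x\<in>set (take i w). fst x = \<alpha>) \<and> asc_chain (take i w) \<and>
    asc_free (drop i w @ z)) :: 'a"
  have "(\<Sum>i\<le>length (l # v). (- 1) ^ i * ?f (l # v) i) =
      ?f (l # v) 0 + (\<Sum>i\<le>length v. (- 1) ^ Suc i * ?f (l # v) (Suc i))"
    by (simp add: sum.atMost_Suc_shift del: sum.atMost_Suc)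
  also have "(\<Sum>i\<le>length v. (- 1) ^ Suc i * ?f (l # v) (Suc i)) =
      - of_bool (fst l = \<alpha>) * (\<Sum>i\<le>length v. (- 1) ^ i * of_bool ((\<forall>x\<in>set (take i v). fst x = \<alpha>) \<and>
        asc_chain (l # take i v) \<and> asc_free (drop i v @ z)))"
    unfolding sum_distrib_left by (intro sum.cong refl) (cases "fst l = \<alpha>"; auto)
  finally have eq: "(\<Sum>i\<le>length (l # v). (- 1) ^ i * ?f (l # v) i) = of_bool (asc_free (l # v @ z)) -
      of_bool (fst l = \<alpha>) * (\<Sum>i\<le>length v. (- 1) ^ i * of_bool ((\<forall>x\<in>set (take i v). fst x = \<alpha>) \<and>
        asc_chain (l # take i v) \<and> asc_free (drop i v @ z)))"
    by simp
  show ?thesis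
  proof (cases "fst l = \<alpha>")
    case True
    have S: "(\<Sum>i\<le>length v. (- 1) ^ i * of_bool ((\<forall>x\<in>set (take i v). fst x = \<alpha>) \<and>
        asc_chain (l # take i v) \<and> asc_free (drop i v @ z))) =
      (of_bool (asc_free (l # v @ z)) +
       of_bool (z \<noteq> []) * (- 1) ^ length v * of_bool ((\<forall>x\<in>set v. fst x = \<alpha>) \<and> asc_chain (l # v @ z))
       :: 'a)"
      using w True Cons by (intro sum_splits_Cons[OF _ _ z]) auto
    show ?thesis
      unfolding Cons eq S using True by simp
  next
    case False
    then have less: "fst l < \<alpha>"
      using w Cons by auto
    have "fst x < \<alpha>" if "asc_free (l # v @ z)" "x \<in> set (l # v)" for x
      using asc_free_hd_greatest[OF that(1), of x] that(2) less by auto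
    then show ?thesis
      unfolding Cons eq using False less by auto
  qed
qed

text \<open>
  The first entries of the labels decrease weakly along an ascent-free word. Once the labels with first
  entry above \<open>\<alpha>\<close> have been used, the minima of the blocks are \<open>1, \<dots>, \<alpha>\<close> and a set \<open>B\<close> of numbers above \<open>\<alpha>\<close>;
  the rest of the word is a member of \<open>low_words z \<alpha> B\<close>.
\<close>

definition low_words :: "label list \<Rightarrow> nat \<Rightarrow> nat set \<Rightarrow> label list set" where
  "low_words z \<alpha> B =
     {w. merge_word ({1..\<alpha>} \<union> B) w \<and> asc_free (w @ z) \<and> (\<forall>l\<in>set w. fst l \<le> \<alpha>)}"

definition low_sum :: "'a::comm_ring_1 \<Rightarrow> label list \<Rightarrow> nat \<Rightarrow> nat set \<Rightarrow> 'a" where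
  "low_sum t z \<alpha> B = (\<Sum>w\<in>low_words z \<alpha> B. t ^ weight w)"

section \<open>Removing an ascending prefix\<close>

lemma alpha_chain_distinct:
  assumes "\<forall>l\<in>set v. fst l = \<alpha>" "asc_chain v"
  shows "distinct (map (\<lambda>l. fst (snd l)) v)"
  using assms asc_chain_alpha_iff by (auto simp: strict_sorted_iff)

context
  fixes t :: "'a::comm_ring_1" and z :: "label list" and \<alpha> :: nat and B :: "nat set" and X :: "label list set"
  assumes \<alpha>: "1 \<le> \<alpha>" and B: "finite B" "\<And>b. b \<in> B \<Longrightarrow> \<alpha> < b"
  defines "X \<equiv> {x. merge_word ({1..\<alpha>} \<union> B) x \<and> (\<forall>l\<in>set x. fst l \<le> \<alpha>)}"
begin

lemma finite_X: "finite X"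
  unfolding X_def using finite_merge_words[of "{1..\<alpha>} \<union> B"] B(1)
  by (auto intro: finite_subset[rotated])

lemma finite_low_words: "K \<subseteq> B \<Longrightarrow> finite (low_words z \<alpha> (B - K))"
  unfolding low_words_def using finite_merge_words[of "{1..\<alpha>} \<union> (B - K)"] B(1)
  by (auto intro: finite_subset[rotated])

lemma live_set_Diff: "K \<subseteq> B \<Longrightarrow> {1..\<alpha>} \<union> B - K = {1..\<alpha>} \<union> (B - K)"
  using B(2) by (auto simp: not_le[symmetric])

text \<open>A prefix with first entries \<open>\<alpha>\<close> consumes a subset \<open>K\<close>
  of \<open>B\<close>. Concatenation identifies triples of \<open>K\<close>, an ascending word on
  \<open>K\<close> and a low word for \<open>B - K\<close> with split points of words in
  \<open>X\<close>.\<close>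

lemma low_words_split:
  "(\<Sum>K\<in>Pow B. (- 1) ^ card K * (\<Sum>i\<le>card K. t ^ i) * low_sum t z \<alpha> (B - K)) =
   (\<Sum>x\<in>X. t ^ weight x * (\<Sum>i\<le>length x. (- 1) ^ i * of_bool ((\<forall>l\<in>set (take i x). fst l = \<alpha>) \<and>
      asc_chain (take i x) \<and> asc_free (drop i x @ z))))"
proof -
  let ?T = "Sigma (Pow B) (\<lambda>K. alpha_words \<alpha> K \<times> low_words z \<alpha> (B - K))"
  let ?P = "\<lambda>x i. (\<forall>l\<in>set (take i x). fst l = \<alpha>) \<and> asc_chain (take i x) \<and> asc_free (drop i x @ z)"
  let ?U = "{(x, i). x \<in> X \<and> i \<le> length x \<and> ?P x i}"
  let ?bs = "\<lambda>v::label list. (\<lambda>l. fst (snd l)) ` set v"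
  have finT: "finite (alpha_words \<alpha> K)" "finite (low_words z \<alpha> (B - K))" if "K \<in> Pow B" for K
    using sum_alpha_words(1)[of K] finite_low_words that B(1) finite_subset[of K B] by auto
  have "(\<Sum>K\<in>Pow B. (- 1) ^ card K * (\<Sum>i\<le>card K. t ^ i) * low_sum t z \<alpha> (B - K)) =
      (\<Sum>K\<in>Pow B. \<Sum>(v, w)\<in>alpha_words \<alpha> K \<times> low_words z \<alpha> (B - K).
        (- 1) ^ length v * t ^ weight (v @ w))"
  proof (rule sum.cong)
    fix K assume "K \<in> Pow B"
    then have "finite K"
      using B(1) finite_subset by auto
    have "(- 1) ^ card K * (\<Sum>i\<le>card K. t ^ i) * low_sum t z \<alpha> (B - K) =
        (\<Sum>v\<in>alpha_words \<alpha> K. \<Sum>w\<in>low_words z \<alpha> (B - K). (- 1) ^ card K * t ^ weight (v @ w))"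
      unfolding sum_alpha_words(2)[OF \<open>finite K\<close>, symmetric, of t \<alpha>] low_sum_def
      by (simp add: sum_distrib_left sum_distrib_right power_add mult_ac sum.swap[of _ "alpha_words \<alpha> K"])
    also have "\<dots> = (\<Sum>v\<in>alpha_words \<alpha> K. \<Sum>w\<in>low_words z \<alpha> (B - K). (- 1) ^ length v * t ^ weight (v @ w))"
      by (intro sum.cong refl) (simp only: length_alpha_words)
    finally show "(- 1) ^ card K * (\<Sum>i\<le>card K. t ^ i) * low_sum t z \<alpha> (B - K) =
        (\<Sum>(v, w)\<in>alpha_words \<alpha> K \<times> low_words z \<alpha> (B - K). (- 1) ^ length v * t ^ weight (v @ w))"
      by (simp add: sum.cartesian_product)
  qed simp
  also have "\<dots> = (\<Sum>(K, v, w)\<in>?T. (- 1) ^ length v * t ^ weight (v @ w))"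
    using B(1) finT by (subst sum.Sigma) (auto simp: split_def)
  also have "\<dots> = (\<Sum>(x, i)\<in>?U. (- 1) ^ i * t ^ weight x)"
  proof (rule sum.reindex_bij_witness[of _ "\<lambda>(x, i). (?bs (take i x), take i x, drop i x)"
        "\<lambda>(K, v, w). (v @ w, length v)"])
    fix p assume p: "p \<in> ?T"
    obtain K v w where Kvw: "p = (K, v, w)"
      by (cases p)
    have K: "K \<subseteq> B" and v: "v \<in> alpha_words \<alpha> K" and w: "w \<in> low_words z \<alpha> (B - K)"
      using p Kvw by auto
    have v': "\<forall>l\<in>set v. fst l = \<alpha>" "asc_chain v" "?bs v = K" "\<forall>l\<in>set v. snd (snd l) \<le> 1"
      using v by (auto simp: alpha_words_def)
    have "{1..\<alpha>} \<union> B - ?bs v = {1..\<alpha>} \<union> (B - K)"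
      unfolding v'(3) by (rule live_set_Diff[OF K])
    moreover have "fst (snd l) \<in> {1..\<alpha>} \<union> B \<and> \<alpha> < fst (snd l) \<and> snd (snd l) \<le> 1" if "l \<in> set v" for l
    proof -
      have "fst (snd l) \<in> B"
        using v'(3) K that by auto
      then show ?thesis
        using B(2) v'(4) that by auto
    qed
    moreover have "\<alpha> \<in> {1..\<alpha>} \<union> B"
      using \<alpha> by simp
    moreover have "merge_word ({1..\<alpha>} \<union> (B - K)) w"
      using w by (simp add: low_words_def)
    ultimately have "merge_word ({1..\<alpha>} \<union> B) (v @ w)"
      using merge_word_append[OF v'(1), of "{1..\<alpha>} \<union> B" w] alpha_chain_distinct[OF v'(1,2)] by metis
    then show "(case p of (K, v, w) \<Rightarrow> (v @ w, length v)) \<in> ?U"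
      using v' w Kvw by (auto simp: X_def low_words_def)
    show "(case case p of (K, v, w) \<Rightarrow> (v @ w, length v) of
        (x, i) \<Rightarrow> (?bs (take i x), take i x, drop i x)) = p"
      using v'(3) Kvw by simp
    show "(case case p of (K, v, w) \<Rightarrow> (v @ w, length v) of (x, i) \<Rightarrow> (- 1) ^ i * t ^ weight x) =
        (case p of (K, v, w) \<Rightarrow> (- 1) ^ length v * t ^ weight (v @ w))"
      using Kvw by simp
  next
    fix q assume q: "q \<in> ?U"
    obtain x i where xi: "q = (x, i)"
      by (cases q)
    have x: "merge_word ({1..\<alpha>} \<union> B) x" "\<forall>l\<in>set x. fst l \<le> \<alpha>" "i \<le> length x" and P: "?P x i"
      using q xi by (auto simp: X_def)
    let ?v = "take i x" and ?w = "drop i x"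
    have "\<forall>l\<in>set ?v. fst l = \<alpha>"
      using P by blast
    then have app: "(\<forall>l\<in>set ?v. fst (snd l) \<in> {1..\<alpha>} \<union> B \<and> \<alpha> < fst (snd l) \<and> snd (snd l) \<le> 1) \<and>
        merge_word ({1..\<alpha>} \<union> B - ?bs ?v) ?w"
      using merge_word_append[of ?v \<alpha> "{1..\<alpha>} \<union> B" ?w] x(1) \<alpha> by (simp del: One_nat_def)
    then have sub: "?bs ?v \<subseteq> B"
      by force
    then have "{1..\<alpha>} \<union> B - ?bs ?v = {1..\<alpha>} \<union> (B - ?bs ?v)"
      by (rule live_set_Diff)
    moreover have "\<forall>l\<in>set ?w. fst l \<le> \<alpha>"
      using x(2) set_drop_subset by fast
    ultimately have "?w \<in> low_words z \<alpha> (B - ?bs ?v)"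
      using app P by (simp add: low_words_def)
    moreover have "?v \<in> alpha_words \<alpha> (?bs ?v)"
      using app P by (simp add: alpha_words_def)
    ultimately show "(case q of (x, i) \<Rightarrow> (?bs (take i x), take i x, drop i x)) \<in> ?T"
      using sub xi by simp
    show "(case case q of (x, i) \<Rightarrow> (?bs (take i x), take i x, drop i x) of
        (K, v, w) \<Rightarrow> (v @ w, length v)) = q"
      using x(3) xi by simp
  qed
  also have "\<dots> = (\<Sum>(x, i)\<in>Sigma X (\<lambda>x. {..length x}).
      t ^ weight x * ((- 1) ^ i * of_bool (?P x i)))"
  proof (rule sum.mono_neutral_cong_left)
    show "finite (Sigma X (\<lambda>x. {..length x}))"
      using finite_X by simp
    show "?U \<subseteq> Sigma X (\<lambda>x. {..length x})"
      by auto
    show "\<forall>p\<in>Sigma X (\<lambda>x. {..length x}) - ?U.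
        (case p of (x, i) \<Rightarrow> t ^ weight x * ((- 1) ^ i * of_bool (?P x i))) = 0"
    proof
      fix p assume p: "p \<in> Sigma X (\<lambda>x. {..length x}) - ?U"
      obtain x i where xi: "p = (x, i)"
        by (cases p)
      then have "\<not> ?P x i"
        using p by blast
      then have "of_bool (?P x i) = (0 :: 'a)"
        by (simp only: of_bool_eq)
      then show "(case p of (x, i) \<Rightarrow> t ^ weight x * ((- 1) ^ i * of_bool (?P x i))) = 0"
        unfolding xi by (simp only: prod.case mult_zero_right)
    qed
    fix p assume p: "p \<in> ?U"
    obtain x i where xi: "p = (x, i)"
      by (cases p)
    then have "?P x i"
      using p by blast
    then show "(case p of (x, i) \<Rightarrow> (- 1) ^ i * t ^ weight x) =
        (case p of (x, i) \<Rightarrow> t ^ weight x * ((- 1) ^ i * of_bool (?P x i)))"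
      unfolding xi by simp
  qed
  also have "\<dots> = (\<Sum>x\<in>X. t ^ weight x * (\<Sum>i\<le>length x. (- 1) ^ i * of_bool (?P x i)))"
    unfolding sum_distrib_left by (rule sum.Sigma[symmetric]) (use finite_X in auto)
  finally show ?thesis .
qed

text \<open>Of the alternating sum over split points only ascent-free words without first entry
  \<open>\<alpha>\<close> remain. For them \<open>\<alpha>\<close> is just another number that has
  to be consumed, so it joins \<open>B\<close>.\<close>

lemma low_recurrence_Suc:
  assumes z: "z = [] \<or> z = [(1, N, 0)]" and "1 < \<alpha>"
  shows "(\<Sum>K\<in>Pow B. (- 1) ^ card K * (\<Sum>i\<le>card K. t ^ i) * low_sum t z \<alpha> (B - K)) =
    low_sum t z (\<alpha> - 1) (insert \<alpha> B)"
proof -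
  have eq: "(\<Sum>i\<le>length x. (- 1) ^ i * of_bool ((\<forall>l\<in>set (take i x). fst l = \<alpha>) \<and>
      asc_chain (take i x) \<and> asc_free (drop i x @ z))) =
      (of_bool (asc_free (x @ z) \<and> (\<forall>l\<in>set x. fst l < \<alpha>)) :: 'a)" if x: "x \<in> X" for x
  proof -
    \<comment> \<open>As \<open>\<alpha>\<close> is at least 2, some merge remains, so
      \<open>x\<close> has a last letter; it cannot ascend into first entry 1.\<close>
    have "Suc (length x) = card ({1..\<alpha>} \<union> B)"
      using x merge_word_length by (auto simp: X_def)
    moreover have "card {1..\<alpha>} \<le> card ({1..\<alpha>} \<union> B)"
      using B(1) by (intro card_mono) auto
    ultimately have ne: "x \<noteq> []"
      using assms(2) by auto
    have "\<not> (\<forall>l\<in>set x. fst l = \<alpha>) \<or> \<not> asc_chain (x @ z)" if "z \<noteq> []"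
    proof -
      have "z = [(1, N, 0)]"
        using z that by simp
      then have "asc_chain (x @ z) \<Longrightarrow> ascent (last x) (1, N, 0)"
        using ne by (simp add: successively_append_iff)
      moreover have "(\<forall>l\<in>set x. fst l = \<alpha>) \<Longrightarrow> fst (last x) = \<alpha>"
        using ne by simp
      ultimately show ?thesis
        using assms(2) by (auto simp: ascent_iff)
    qed
    then have zero: "of_bool (z \<noteq> []) * (- 1) ^ length x *
        of_bool ((\<forall>l\<in>set x. fst l = \<alpha>) \<and> asc_chain (x @ z)) = (0 :: 'a)"
      by auto
    have le: "\<forall>l\<in>set x. fst l \<le> \<alpha>" and z1: "z = [] \<or> (\<exists>c. z = [c])"
      using x z by (auto simp: X_def)
    show ?thesis
      unfolding sum_splits[OF le z1] zero using ne by (simp only: if_False add_0_right)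
  qed
  have L: "{1..\<alpha> - 1} \<union> insert \<alpha> B = {1..\<alpha>} \<union> B"
    using assms(2) by auto
  have "(\<Sum>x\<in>X. t ^ weight x * of_bool (asc_free (x @ z) \<and> (\<forall>l\<in>set x. fst l < \<alpha>))) =
      (\<Sum>x\<in>low_words z (\<alpha> - 1) (insert \<alpha> B). t ^ weight x)"
    unfolding low_words_def L using finite_X
    by (intro sum.mono_neutral_cong_right) (use assms(2) in \<open>auto simp: X_def less_eq_Suc_le\<close>)
  moreover have "(\<Sum>x\<in>X. t ^ weight x * (\<Sum>i\<le>length x. (- 1) ^ i *
      of_bool ((\<forall>l\<in>set (take i x). fst l = \<alpha>) \<and> asc_chain (take i x) \<and> asc_free (drop i x @ z)))) =
      (\<Sum>x\<in>X. t ^ weight x * of_bool (asc_free (x @ z) \<and> (\<forall>l\<in>set x. fst l < \<alpha>)))"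
    by (intro sum.cong refl) (simp only: eq)
  ultimately show ?thesis
    unfolding low_words_split by (simp only: low_sum_def)
qed

lemma X_1:
  assumes "\<alpha> = 1" "x \<in> X"
  shows "\<forall>l\<in>set x. fst l = 1" "(\<lambda>l. fst (snd l)) ` set x = B"
proof -
  let ?bs = "(\<lambda>l. fst (snd l)) ` set x"
  have L: "{1..\<alpha>} \<union> B = insert 1 B" "1 \<notin> B"
    using assms(1) B(2) by fastforce+
  have x: "merge_word (insert 1 B) x" "\<forall>l\<in>set x. fst l \<le> 1"
    using assms unfolding X_def L(1) by auto
  have "fst l = 1" if "l \<in> set x" for l
  proof -
    have "fst l \<in> insert 1 B" "fst l \<le> 1"
      using merge_word_set[OF x(1) that] x(2) that by auto
    then show ?thesis
      using B(2)[of "fst l"] assms(1) by auto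
  qed
  then show all: "\<forall>l\<in>set x. fst l = 1"
    by blast
  have *: "\<forall>l\<in>set x. fst (snd l) \<in> insert 1 B \<and> 1 < fst (snd l)" "card (insert 1 B - ?bs) = 1"
    using merge_word_append[OF all, of "insert 1 B" "[]"] x(1) by auto
  then have "?bs \<subseteq> B" "1 \<notin> ?bs"
    by auto
  moreover from this have "insert 1 B - ?bs = insert 1 (B - ?bs)"
    by auto
  then have "card (B - ?bs) = 0"
    using *(2) L(2) B(1) by simp
  then have "B - ?bs = {}"
    using B(1) by simp
  ultimately show "?bs = B"
    by blast
qed

text \<open>No first entry is below 1, so only the exceptional terms of \<open>sum_splits\<close>
  remain: the empty word if \<open>z\<close> is empty, and otherwise the one ascending word, whose
  weights must all be 0 because it ascends into a label of weight 0.\<close>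

lemma low_recurrence_1:
  assumes z: "z = [] \<or> z = [(1, N, 0)] \<and> (\<forall>b\<in>B. b < N)" and "\<alpha> = 1"
  shows "(\<Sum>K\<in>Pow B. (- 1) ^ card K * (\<Sum>i\<le>card K. t ^ i) * low_sum t z \<alpha> (B - K)) =
    (if z = [] then 0 else - 1) ^ card B"
proof -
  have x1: "\<forall>l\<in>set x. fst l = 1" "(\<lambda>l. fst (snd l)) ` set x = B" if "x \<in> X" for x
    using X_1[OF assms(2) that] .
  have z1: "z = [] \<or> (\<exists>c. z = [c])"
    using z by auto
  have L: "{1..\<alpha>} \<union> B = insert 1 B" "1 \<notin> B"
    using assms(2) B(2) by fastforce+
  have eq: "(\<Sum>i\<le>length x. (- 1) ^ i * of_bool ((\<forall>l\<in>set (take i x). fst l = \<alpha>) \<and>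
      asc_chain (take i x) \<and> asc_free (drop i x @ z))) =
      (if z = [] then of_bool (x = []) else (- 1) ^ length x * of_bool (asc_chain (x @ z)) :: 'a)"
    if x: "x \<in> X" for x
  proof -
    have le: "\<forall>l\<in>set x. fst l \<le> \<alpha>"
      using x by (simp add: X_def)
    have all: "(\<forall>l\<in>set x. fst l = \<alpha>) \<longleftrightarrow> True"
      using x1(1)[OF x] assms(2) by simp
    show ?thesis
    proof (cases "x = []")
      case True
      then show ?thesis
        unfolding sum_splits[OF le z1] using z by auto
    next
      case False
      then have "hd x \<in> set x" "fst (hd x) = \<alpha>"
        using all by simp_all
      then have lt: "(\<forall>l\<in>set x. fst l < \<alpha>) \<longleftrightarrow> False"
        by auto
      show ?thesis
        unfolding sum_splits[OF le z1] all lt using False by simp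
    qed
  qed
  have split: "(\<Sum>K\<in>Pow B. (- 1) ^ card K * (\<Sum>i\<le>card K. t ^ i) * low_sum t z \<alpha> (B - K)) =
      (\<Sum>x\<in>X. t ^ weight x *
        (if z = [] then of_bool (x = []) else (- 1) ^ length x * of_bool (asc_chain (x @ z))))"
    unfolding low_words_split by (intro sum.cong refl) (simp only: eq)
  show ?thesis
  proof (cases "z = []")
    case True
    have "(\<Sum>x\<in>X. t ^ weight x * of_bool (x = [])) = (\<Sum>x\<in>X. if x = [] then 1 else 0 :: 'a)"
      by (intro sum.cong) auto
    also have "\<dots> = of_bool ([] \<in> X)"
      using finite_X by simp
    also have "[] \<in> X \<longleftrightarrow> B = {}"
      unfolding X_def L(1) using L(2) B(1) by (auto simp: card_insert_if)
    finally show ?thesis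
      unfolding split using True B(1) by (cases "B = {}") (auto simp: power_0_left)
  next
    case False
    then have zN: "z = [(1, N, 0)]" "\<forall>b\<in>B. b < N"
      using z by auto
    \<comment> \<open>The merges into 1 in increasing order, all with weight 0; since
      \<open>N\<close> exceeds \<open>B\<close>, the last step into \<open>z\<close> ascends
      too.\<close>
    define y :: "label list" where "y = map (\<lambda>b. (1, b, 0)) (sorted_list_of_set B)"
    have y: "y \<in> X" "asc_chain (y @ z)" "length y = card B" "weight y = 0"
    proof -
      have y1: "\<forall>l\<in>set y. fst l = 1"
        by (auto simp: y_def)
      have mb: "map (\<lambda>l. fst (snd l)) y = sorted_list_of_set B"
        by (simp add: y_def o_def)
      have "(\<lambda>l. fst (snd l)) ` set y = B"
        using arg_cong[OF mb, of set] B(1) by simp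
      then have "merge_word (insert 1 B) (y @ [])"
        unfolding merge_word_append[OF y1 insertI1] using mb B L(2) assms(2)
        by (auto simp: y_def insert_Diff_if)
      then show "y \<in> X"
        unfolding X_def L(1) using y1 assms(2) by simp
      have "\<forall>l\<in>set (y @ z). fst l = 1"
        using y1 zN by auto
      moreover have "map (\<lambda>l. fst (snd l)) (y @ z) = sorted_list_of_set B @ [N]"
        using mb zN by simp
      moreover have "map (\<lambda>l. snd (snd l)) (y @ z) = replicate (Suc (length (sorted_list_of_set B))) 0"
        using zN by (simp add: y_def o_def map_replicate_const replicate_append_same)
      moreover have "sorted_wrt (<) (sorted_list_of_set B @ [N])"
        using zN(2) B(1) by (simp add: sorted_wrt_append)
      ultimately show "asc_chain (y @ z)"
        using asc_chain_alpha_iff[of "y @ z" 1] by (simp only: sorted_replicate)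
      show "length y = card B"
        by (simp add: y_def)
      show "weight y = 0"
        by (simp add: y_def weight_def o_def)
    qed
    have uniq: "x = y" if x: "x \<in> X" "asc_chain (x @ z)" for x
    proof -
      have "\<forall>l\<in>set (x @ z). fst l = 1"
        using x1(1)[OF x(1)] zN by auto
      then have s: "sorted_wrt (<) (map (\<lambda>l. fst (snd l)) (x @ z))"
        "sorted (map (\<lambda>l. snd (snd l)) (x @ z))"
        using asc_chain_alpha_iff x(2) by blast+
      have "l = (1, fst (snd l), 0)" if "l \<in> set x" for l
        using s(2) zN that x1(1)[OF x(1)] by (auto simp: sorted_append prod_eq_iff)
      then have "x = map (\<lambda>l. (1, fst (snd l), 0)) x"
        by (simp add: map_idI[symmetric])
      also have "\<dots> = map (\<lambda>b. (1, b, 0)) (map (\<lambda>l. fst (snd l)) x)"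
        by simp
      also have "map (\<lambda>l. fst (snd l)) x = sorted_list_of_set B"
        by (rule strict_sorted_equal) (use s(1) x1(2)[OF x(1)] B(1) in \<open>auto simp: sorted_wrt_append\<close>)
      finally show ?thesis
        by (simp add: y_def)
    qed
    have "(\<Sum>x\<in>X. t ^ weight x * ((- 1) ^ length x * of_bool (asc_chain (x @ z)))) =
        (\<Sum>x\<in>{y}. t ^ weight x * ((- 1) ^ length x * of_bool (asc_chain (x @ z))))"
      using finite_X y(1) uniq by (intro sum.mono_neutral_right) auto
    then show ?thesis
      unfolding split using False y by simp
  qed
qed

end

text \<open>The recurrence solved for its term with empty \<open>K\<close>. The clause for 0 encodes
  the right side of \<open>low_recurrence_1\<close> with \<open>m = card B + 1\<close>, where
  \<open>s\<close> is 0 or -1, so that the case of \<open>\<alpha> = 1\<close> has the same shape as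
  the others.\<close>

function low_count :: "'a::comm_ring_1 \<Rightarrow> 'a \<Rightarrow> nat \<Rightarrow> nat \<Rightarrow> 'a" where
  "low_count s t 0 m = s ^ (m - 1)"
| "low_count s t (Suc \<alpha>) m = low_count s t \<alpha> (Suc m) -
     (\<Sum>k\<in>{1..m}. of_nat (m choose k) * ((- 1) ^ k * (\<Sum>i\<le>k. t ^ i) * low_count s t (Suc \<alpha>) (m - k)))"
  by pat_completeness auto
termination
  by (relation "measures [\<lambda>(s, t, \<alpha>, m). \<alpha>, \<lambda>(s, t, \<alpha>, m). m]") auto

declare low_count.simps [simp del]

lemma sum_Pow_card:
  fixes f :: "nat \<Rightarrow> 'a::comm_ring_1"
  assumes "finite B"
  shows "(\<Sum>K\<in>Pow B. f (card K)) = (\<Sum>k\<le>card B. of_nat (card B choose k) * f k)"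
proof -
  have "(\<Sum>K\<in>Pow B. f (card K)) = (\<Sum>k\<le>card B. \<Sum>K\<in>{K \<in> Pow B. card K = k}. f (card K))"
    using assms by (intro sum.group[symmetric]) (auto intro: card_mono)
  also have "\<dots> = (\<Sum>k\<le>card B. of_nat (card B choose k) * f k)"
  proof (rule sum.cong)
    fix k
    have "(\<Sum>K\<in>{K \<in> Pow B. card K = k}. f (card K)) = of_nat (card {K. K \<subseteq> B \<and> card K = k}) * f k"
      by simp
    then show "(\<Sum>K\<in>{K \<in> Pow B. card K = k}. f (card K)) = of_nat (card B choose k) * f k"
      using n_subsets[OF assms] by simp
  qed simp
  finally show ?thesis .
qed

lemma low_count_unique:
  fixes t :: "'a::comm_ring_1"
  assumes B: "finite B"
    and rec: "(\<Sum>K\<in>Pow B. (- 1) ^ card K * (\<Sum>i\<le>card K. t ^ i) * g (B - K)) = low_count s t \<alpha> (Suc (card B))"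
    and IH: "\<And>K. K \<subseteq> B \<Longrightarrow> K \<noteq> {} \<Longrightarrow> g (B - K) = low_count s t (Suc \<alpha>) (card (B - K))"
  shows "g B = low_count s t (Suc \<alpha>) (card B)"
proof -
  define f where "f k = (if k = 0 then 0 else (- 1) ^ k * (\<Sum>i\<le>k. t ^ i) * low_count s t (Suc \<alpha>) (card B - k))" for k
  have "(\<Sum>K\<in>Pow B. (- 1) ^ card K * (\<Sum>i\<le>card K. t ^ i) * g (B - K)) =
      g B + (\<Sum>K\<in>Pow B - {{}}. (- 1) ^ card K * (\<Sum>i\<le>card K. t ^ i) * g (B - K))"
    using B by (subst sum.remove[of _ "{}"]) auto
  also have "(\<Sum>K\<in>Pow B - {{}}. (- 1) ^ card K * (\<Sum>i\<le>card K. t ^ i) * g (B - K)) =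
      (\<Sum>K\<in>Pow B. f (card K))"
  proof (rule sum.mono_neutral_cong_left)
    show "\<forall>K\<in>Pow B - (Pow B - {{}}). f (card K) = 0"
      by (auto simp: f_def)
    fix K assume K: "K \<in> Pow B - {{}}"
    then have "finite K" "K \<noteq> {}" "K \<subseteq> B"
      using B finite_subset by auto
    then show "(- 1) ^ card K * (\<Sum>i\<le>card K. t ^ i) * g (B - K) = f (card K)"
      using IH[of K] by (simp add: f_def card_Diff_subset)
  qed (use B in auto)
  also have "\<dots> = (\<Sum>k\<in>{1..card B}. of_nat (card B choose k) *
      ((- 1) ^ k * (\<Sum>i\<le>k. t ^ i) * low_count s t (Suc \<alpha>) (card B - k)))"
    unfolding sum_Pow_card[OF B]
    by (intro sum.mono_neutral_cong_right) (auto simp: f_def)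
  finally show ?thesis
    unfolding rec low_count.simps(2)[of s t \<alpha> "card B"] by (simp add: algebra_simps)
qed

text \<open>Outer induction on \<open>\<alpha>\<close>, inner induction on the size of
  \<open>B\<close>: the recurrence leads to the same \<open>\<alpha>\<close> with a smaller set and
  to the preceding \<open>\<alpha>\<close> with one more element.\<close>

lemma low_sum_eq_low_count:
  fixes t :: "'a::comm_ring_1"
  assumes "1 \<le> \<alpha>" and z: "z = [] \<or> z = [(1, N, 0)] \<and> (\<forall>b\<in>B. b < N) \<and> \<alpha> < N"
    and "finite B" "\<And>b. b \<in> B \<Longrightarrow> \<alpha> < b"
  shows "low_sum t z \<alpha> B = low_count (if z = [] then 0 else - 1) t \<alpha> (card B)"
proof -
  define s :: 'a where "s = (if z = [] then 0 else - 1)"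
  have "low_sum t z \<alpha> B = low_count s t \<alpha> (card B)"
    using assms
  proof (induction \<alpha> arbitrary: B rule: nat_induct_at_least)
    case base
    then show ?case
    proof (induction "card B" arbitrary: B rule: less_induct)
      case less
      have "(\<Sum>K\<in>Pow B. (- 1) ^ card K * (\<Sum>i\<le>card K. t ^ i) * low_sum t z 1 (B - K)) =
          low_count s t 0 (Suc (card B))"
        unfolding s_def low_count.simps(1) diff_Suc_1
        by (rule low_recurrence_1[where N = N]) (use less.prems in auto)
      moreover have "low_sum t z 1 (B - K) = low_count s t (Suc 0) (card (B - K))" if "K \<subseteq> B" "K \<noteq> {}" for K
      proof -
        have "card (B - K) < card B"
          using that less.prems by (intro psubset_card_mono) auto
        then show ?thesis
          using less.hyps[of "B - K"] less.prems by auto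
      qed
      ultimately show ?case
        using low_count_unique[of B t "low_sum t z 1" s 0] less.prems by simp
    qed
  next
    case (Suc \<alpha>)
    from Suc.prems show ?case
    proof (induction "card B" arbitrary: B rule: less_induct)
      case less
      have "(\<Sum>K\<in>Pow B. (- 1) ^ card K * (\<Sum>i\<le>card K. t ^ i) * low_sum t z (Suc \<alpha>) (B - K)) =
          low_sum t z \<alpha> (insert (Suc \<alpha>) B)"
        using low_recurrence_Suc[where \<alpha> = "Suc \<alpha>" and N = N and z = z and B = B and t = t]
          less.prems Suc.hyps by auto
      also have "\<dots> = low_count s t \<alpha> (card (insert (Suc \<alpha>) B))"
        by (rule Suc.IH) (use less.prems in \<open>auto simp: less_Suc_eq_le dest: Suc_lessD\<close>)
      also have "card (insert (Suc \<alpha>) B) = Suc (card B)"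
        using less.prems by (subst card_insert_disjoint) auto
      finally have "(\<Sum>K\<in>Pow B. (- 1) ^ card K * (\<Sum>i\<le>card K. t ^ i) * low_sum t z (Suc \<alpha>) (B - K)) =
          low_count s t \<alpha> (Suc (card B))" .
      moreover have "low_sum t z (Suc \<alpha>) (B - K) = low_count s t (Suc \<alpha>) (card (B - K))"
        if "K \<subseteq> B" "K \<noteq> {}" for K
      proof -
        have "card (B - K) < card B"
          using that less.prems by (intro psubset_card_mono) auto
        then show ?thesis
          using less.hyps[of "B - K"] less.prems by auto
      qed
      ultimately show ?case
        using low_count_unique[of B t "low_sum t z (Suc \<alpha>)" s \<alpha>] less.prems by simp
    qed
  qed
  then show ?thesis
    by (simp add: s_def)
qed

text \<open>
  With \<open>\<Phi>\<^sub>\<alpha>\<close> the linear functional \<open>z\<^sup>m \<mapsto> low_count s t \<alpha> m\<close>, the recurrence reads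
  \<open>\<Phi>\<^bsub>\<alpha>+1\<^esub> (q (z - 1) - t q (z - t)) = (1 - t) \<Phi>\<^sub>\<alpha> (z q)\<close>. The polynomials \<open>forest_poly\<close> are chosen so that
  the operator on the left maps each of them to \<open>(1 - t) z\<close> times the preceding one.
\<close>

definition umbral :: "(nat \<Rightarrow> 'a::comm_ring_1) \<Rightarrow> 'a poly \<Rightarrow> 'a" where
  "umbral g p = (\<Sum>i\<le>degree p. coeff p i * g i)"

lemma umbral_eq: "degree p \<le> N \<Longrightarrow> umbral g p = (\<Sum>i\<le>N. coeff p i * g i)"
  unfolding umbral_def by (intro sum.mono_neutral_left) (auto simp: coeff_eq_0)

lemma umbral_add: "umbral g (p + q) = umbral g p + umbral g q"
proof -
  let ?N = "max (degree p) (degree q)"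
  have "degree (p + q) \<le> ?N" "degree p \<le> ?N" "degree q \<le> ?N"
    by (auto intro: degree_add_le_max)
  then show ?thesis
    by (simp add: umbral_eq[of _ ?N] sum.distrib algebra_simps)
qed

lemma umbral_smult: "umbral g (Polynomial.smult c p) = c * umbral g p"
  using umbral_eq[of "Polynomial.smult c p" "degree p" g]
  by (simp add: umbral_def sum_distrib_left mult.assoc degree_smult_le)

lemma umbral_sum: "umbral g (\<Sum>x\<in>A. f x) = (\<Sum>x\<in>A. umbral g (f x))"
proof -
  have "umbral g 0 = 0"
    by (simp add: umbral_def)
  then show ?thesis
    by (induction A rule: infinite_finite_induct) (simp_all add: umbral_add)
qed

lemma umbral_monom: "umbral g (monom 1 m) = g m"
proof -
  have "umbral g (monom 1 m) = (\<Sum>i\<le>m. coeff (monom 1 m) i * g i)"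
    by (rule umbral_eq) (rule degree_monom_le)
  also have "\<dots> = (\<Sum>i\<le>m. if i = m then g m else 0)"
    by (intro sum.cong) auto
  finally show ?thesis
    by simp
qed

definition shift_diff :: "'a::comm_ring_1 \<Rightarrow> 'a poly \<Rightarrow> 'a poly" where
  "shift_diff t q = pcompose q [:- 1, 1:] - Polynomial.smult t (pcompose q [:- t, 1:])"

lemma smult_sum_right: "Polynomial.smult c (\<Sum>i\<in>A. f i) = (\<Sum>i\<in>A. Polynomial.smult c (f i))"
  by (induction A rule: infinite_finite_induct) (simp_all add: smult_add_right)

lemma pCons_0_sum: "pCons 0 (\<Sum>i\<in>A. f i) = (\<Sum>i\<in>A. pCons 0 (f i :: 'a::comm_ring_1 poly))"
proof (induction A rule: infinite_finite_induct)
  case (insert x A)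
  have add: "pCons 0 (p + q) = pCons 0 p + pCons 0 q" for p q :: "'a poly"
    by simp
  show ?case
    by (simp only: sum.insert[OF insert.hyps] add insert.IH)
qed simp_all

lemma pcompose_power: "pcompose (p ^ m) q = pcompose p q ^ m" for p :: "'a::comm_ring_1 poly"
  by (induction m) (simp_all add: pcompose_mult pcompose_1)

lemma const_power: "[:c:] ^ k = [:c ^ k :: 'a::comm_ring_1:]"
  by (induction k) (simp_all add: one_pCons)

lemma pcompose_shift_monom:
  "pcompose (monom 1 m) [:- c, 1:] =
    (\<Sum>k\<le>m. Polynomial.smult (of_nat (m choose k) * (- c) ^ k) (monom 1 (m - k)) :: 'a::comm_ring_1 poly)"
proof -
  have "pcompose (monom 1 m) [:- c, 1:] = ([:- c:] + monom 1 1) ^ m"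
    by (simp add: monom_altdef pcompose_power pcompose_pCons)
  also have "\<dots> = (\<Sum>k\<le>m. of_nat (m choose k) * [:- c:] ^ k * monom 1 1 ^ (m - k))"
    by (rule binomial_ring)
  also have "\<dots> = (\<Sum>k\<le>m. Polynomial.smult (of_nat (m choose k) * (- c) ^ k) (monom 1 (m - k)))"
    by (intro sum.cong) (simp_all add: monom_power const_power of_nat_poly mult.commute)
  finally show ?thesis .
qed

text \<open>On a monomial both translations are expanded binomially. The coefficients combine to
  \<open>1 - t ^ Suc k\<close>, which is \<open>1 - t\<close> times the geometric sum in the
  recurrence. Linearity does the rest.\<close>

lemma umbral_shift_diff:
  fixes s t :: "'a::comm_ring_1"
  shows "umbral (low_count s t (Suc \<alpha>)) (shift_diff t q) = (1 - t) * umbral (low_count s t \<alpha>) (pCons 0 q)"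
proof -
  have mono: "umbral (low_count s t (Suc \<alpha>)) (shift_diff t (monom 1 m)) =
      (1 - t) * umbral (low_count s t \<alpha>) (pCons 0 (monom 1 m))" for m
  proof -
    let ?g = "low_count s t (Suc \<alpha>)"
    have "shift_diff t (monom 1 m) =
        (\<Sum>k\<le>m. Polynomial.smult (of_nat (m choose k) * (- 1) ^ k * (1 - t ^ Suc k)) (monom 1 (m - k)))"
      unfolding shift_diff_def pcompose_shift_monom smult_sum_right sum_subtractf[symmetric]
      by (intro sum.cong refl)
        (simp add: smult_diff_left[symmetric] power_minus[of t] algebra_simps)
    also have "\<dots> = (\<Sum>k\<le>m. Polynomial.smult ((1 - t) * (of_nat (m choose k) * ((- 1) ^ k * (\<Sum>i\<le>k. t ^ i))))
        (monom 1 (m - k)))"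
      by (intro sum.cong refl) (simp only: one_diff_power_eq lessThan_Suc_atMost mult_ac)
    finally have "umbral ?g (shift_diff t (monom 1 m)) =
        (\<Sum>k\<le>m. (1 - t) * (of_nat (m choose k) * ((- 1) ^ k * (\<Sum>i\<le>k. t ^ i))) * ?g (m - k))"
      by (simp add: umbral_sum umbral_smult umbral_monom)
    also have "\<dots> = (1 - t) * (\<Sum>k\<le>m. of_nat (m choose k) * ((- 1) ^ k * (\<Sum>i\<le>k. t ^ i) * ?g (m - k)))"
      by (simp add: sum_distrib_left mult_ac)
    also have "(\<Sum>k\<le>m. of_nat (m choose k) * ((- 1) ^ k * (\<Sum>i\<le>k. t ^ i) * ?g (m - k))) =
        ?g m + (\<Sum>k\<in>{1..m}. of_nat (m choose k) * ((- 1) ^ k * (\<Sum>i\<le>k. t ^ i) * ?g (m - k)))"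
    proof -
      have "{..m} = insert 0 {1..m}"
        by auto
      then show ?thesis
        by simp
    qed
    also have "\<dots> = low_count s t \<alpha> (Suc m)"
      unfolding low_count.simps(2)[of s t \<alpha> m] by simp
    also have "\<dots> = umbral (low_count s t \<alpha>) (pCons 0 (monom 1 m))"
      by (simp add: monom_Suc[symmetric] umbral_monom)
    finally show ?thesis .
  qed
  have "q = (\<Sum>i\<le>degree q. Polynomial.smult (coeff q i) (monom 1 i))"
    by (simp add: smult_monom poly_as_sum_of_monoms)
  then obtain A :: "nat set" and c where q: "q = (\<Sum>i\<in>A. Polynomial.smult (c i) (monom 1 i))"
    by blast
  have "shift_diff t q = (\<Sum>i\<in>A. Polynomial.smult (c i) (shift_diff t (monom 1 i)))"
    unfolding q shift_diff_def
    by (simp add: pcompose_sum pcompose_smult smult_sum_right sum_subtractf smult_diff_right mult.commute)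
  moreover have "pCons 0 q = (\<Sum>i\<in>A. Polynomial.smult (c i) (pCons 0 (monom 1 i)))"
    unfolding q pCons_0_sum by simp
  ultimately show ?thesis
    by (simp only: umbral_sum umbral_smult mono sum_distrib_left mult_ac)
qed

definition forest_poly :: "'a::comm_ring_1 \<Rightarrow> nat \<Rightarrow> 'a poly" where
  "forest_poly t n = (\<Prod>j\<in>{1..<n}. [:of_nat j + t * of_nat (n - j), 1:])"

text \<open>Both translations of the product for \<open>Suc n\<close> contain the product for
  \<open>n\<close>: moving by 1 shifts the index range to start at 0, moving by \<open>t\<close>
  keeps it and ends at \<open>n\<close>. The extra factors z + t n and z + n leave (z + t n) - t (z
  + n) = (1 - t) z.\<close>

lemma shift_diff_forest_poly:
  fixes t :: "'a::idom"
  assumes "1 \<le> n"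
  shows "shift_diff t (forest_poly t (Suc n)) = Polynomial.smult (1 - t) (pCons 0 (forest_poly t n))"
proof -
  have "pcompose (forest_poly t (Suc n)) [:- 1, 1:] =
      (\<Prod>j\<in>{1..<Suc n}. [:of_nat (j - 1) + t * of_nat (n - (j - 1)), 1:])"
    unfolding forest_poly_def pcompose_prod
    by (intro prod.cong refl) (auto simp: pcompose_pCons of_nat_diff algebra_simps)
  also have "\<dots> = (\<Prod>j\<in>{0..<n}. [:of_nat j + t * of_nat (n - j), 1:])"
    by (rule prod.reindex_bij_witness[of _ Suc "\<lambda>j. j - 1"]) auto
  also have "\<dots> = [:t * of_nat n, 1:] * forest_poly t n"
    unfolding forest_poly_def using assms by (subst prod.atLeast_Suc_lessThan) auto
  finally have 1: "pcompose (forest_poly t (Suc n)) [:- 1, 1:] = [:t * of_nat n, 1:] * forest_poly t n" .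
  have "pcompose (forest_poly t (Suc n)) [:- t, 1:] =
      (\<Prod>j\<in>{1..<Suc n}. [:of_nat j + t * of_nat (n - j), 1:])"
    unfolding forest_poly_def pcompose_prod
    by (intro prod.cong refl) (auto simp: pcompose_pCons of_nat_diff algebra_simps)
  also have "\<dots> = forest_poly t n * [:of_nat n, 1:]"
    unfolding forest_poly_def using assms by (subst prod.atLeastLessThan_Suc) auto
  finally have 2: "pcompose (forest_poly t (Suc n)) [:- t, 1:] = forest_poly t n * [:of_nat n, 1:]" .
  have "shift_diff t (forest_poly t (Suc n)) =
      ([:t * of_nat n, 1:] - Polynomial.smult t [:of_nat n, 1:]) * forest_poly t n"
    unfolding shift_diff_def 1 2
    by (simp only: left_diff_distrib mult_smult_left mult.commute[of "forest_poly t n"])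
  also have "[:t * of_nat n, 1:] - Polynomial.smult t [:of_nat n, 1:] = [:0, 1 - t:]"
    by simp
  finally show ?thesis
    by simp
qed

text \<open>The functionals are moved down from \<open>n\<close> to 0: 1 at level \<open>n\<close>
  becomes z at level \<open>n - 1\<close>, then z times successive products
  \<open>forest_poly\<close>. At level 0 the power z^(m+1) is sent to \<open>s ^ m\<close>, which
  amounts to evaluation at \<open>s\<close>.\<close>

lemma low_count_closed_form:
  fixes s t :: "'a::idom"
  assumes "t \<noteq> 1" "1 \<le> n"
  shows "low_count s t n 0 = (\<Prod>j\<in>{1..<n}. of_nat j + t * of_nat (n - j) + s)"
proof -
  \<comment> \<open>Here \<open>1 - t\<close> is cancelled, which uses \<open>t \<noteq> 1\<close>
    in an integral domain.\<close>
  have step: "umbral (low_count s t (Suc \<alpha>)) (pCons 0 (forest_poly t k)) =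
      umbral (low_count s t \<alpha>) (pCons 0 (forest_poly t (Suc k)))" if "1 \<le> k" for \<alpha> k
  proof -
    have "(1 - t) * umbral (low_count s t (Suc \<alpha>)) (pCons 0 (forest_poly t k)) =
        umbral (low_count s t (Suc \<alpha>)) (shift_diff t (forest_poly t (Suc k)))"
      unfolding shift_diff_forest_poly[OF that] by (rule umbral_smult[symmetric])
    also have "\<dots> = (1 - t) * umbral (low_count s t \<alpha>) (pCons 0 (forest_poly t (Suc k)))"
      by (rule umbral_shift_diff)
    finally have eq: "(1 - t) * umbral (low_count s t (Suc \<alpha>)) (pCons 0 (forest_poly t k)) =
        (1 - t) * umbral (low_count s t \<alpha>) (pCons 0 (forest_poly t (Suc k)))" .
    have "1 - t \<noteq> 0"
      using assms(1) by auto
    then show ?thesis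
      by (rule mult_left_cancel[THEN iffD1]) (rule eq)
  qed
  have chain: "umbral (low_count s t (n - Suc k)) (pCons 0 (forest_poly t (Suc k))) =
      umbral (low_count s t (n - 1)) (pCons 0 (forest_poly t 1))" if "k < n" for k
    using that
  proof (induction k)
    case (Suc k)
    then have "n - Suc k = Suc (n - Suc (Suc k))"
      by simp
    then show ?case
      using step[of "Suc k" "n - Suc (Suc k)"] Suc by simp
  qed simp
  obtain k where k: "n = Suc k"
    using assms(2) by (cases n) auto
  have "low_count s t n 0 = low_count s t k 1"
    unfolding k low_count.simps(2)[of s t k 0] by simp
  also have "\<dots> = umbral (low_count s t (n - 1)) (pCons 0 (forest_poly t 1))"
  proof -
    have "pCons 0 (forest_poly t 1) = monom 1 1"
      by (simp add: forest_poly_def monom_Suc)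
    then show ?thesis
      by (simp add: umbral_monom k)
  qed
  also have "\<dots> = umbral (low_count s t 0) (pCons 0 (forest_poly t n))"
    using chain[of k] k by simp
  also have "\<dots> = poly (forest_poly t n) s"
  proof -
    let ?q = "forest_poly t n"
    have "umbral (low_count s t 0) (pCons 0 ?q) = (\<Sum>i\<le>Suc (degree ?q). coeff (pCons 0 ?q) i * low_count s t 0 i)"
      by (rule umbral_eq) (rule degree_pCons_le)
    also have "\<dots> = (\<Sum>i\<le>degree ?q. coeff ?q i * s ^ i)"
      by (subst sum.atMost_Suc_shift) (simp add: low_count.simps(1))
    finally show ?thesis
      by (simp add: poly_altdef)
  qed
  also have "\<dots> = (\<Prod>j\<in>{1..<n}. of_nat j + t * of_nat (n - j) + s)"
    by (simp add: forest_poly_def poly_prod)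
  finally show ?thesis .
qed

section \<open>Counting forests by descents and roots\<close>

text \<open>Pairs are again node and parent; the roots are the elements of
  \<open>V - Domain E\<close>. Reaching a root from every node excludes cycles.\<close>

definition forests :: "'a set \<Rightarrow> ('a \<times> 'a) set set" where
  "forests V = {E. E \<subseteq> V \<times> V \<and> single_valued E \<and> (\<forall>v\<in>V. \<exists>r\<in>V - Domain E. (v, r) \<in> E\<^sup>*)}"

definition root :: "'a set \<Rightarrow> ('a \<times> 'a) set \<Rightarrow> 'a \<Rightarrow> 'a" where
  "root V E v = (SOME r. r \<in> V - Domain E \<and> (v, r) \<in> E\<^sup>*)"

lemma root:
  assumes "E \<in> forests V" "v \<in> V"
  shows "root V E v \<in> V - Domain E" "(v, root V E v) \<in> E\<^sup>*"
proof -
  have "\<exists>r. r \<in> V - Domain E \<and> (v, r) \<in> E\<^sup>*"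
    using assms by (auto simp: forests_def)
  from someI_ex[OF this] show "root V E v \<in> V - Domain E" "(v, root V E v) \<in> E\<^sup>*"
    by (auto simp: root_def)
qed

text \<open>With a unique parent a walk can never leave a cycle. A node on a cycle therefore reaches
  no root.\<close>

lemma cycle_invariant:
  assumes "single_valued E" "(v, v) \<in> E\<^sup>+" "(v, w) \<in> E\<^sup>*"
  shows "(w, w) \<in> E\<^sup>+"
  using assms(3,2)
proof (induction rule: converse_rtrancl_induct)
  case (step v x)
  obtain y where "(v, y) \<in> E" "(y, v) \<in> E\<^sup>*"
    using step.prems tranclD by metis
  then have "(x, v) \<in> E\<^sup>*"
    using assms(1) step.hyps(1) by (metis single_valuedD)
  then have "(x, x) \<in> E\<^sup>+"
    using step.hyps(1) by (rule rtrancl_into_trancl1)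
  then show ?case
    by (rule step.IH)
qed

lemma forest_acyclic:
  assumes "E \<in> forests V"
  shows "(v, v) \<notin> E\<^sup>+"
proof
  assume v: "(v, v) \<in> E\<^sup>+"
  then have "v \<in> V"
    using assms tranclD[OF v] by (auto simp: forests_def)
  then have "(root V E v, root V E v) \<in> E\<^sup>+"
    using cycle_invariant[OF _ v root(2)[OF assms]] assms by (simp add: forests_def)
  then show False
    using root(1)[OF assms \<open>v \<in> V\<close>] tranclD by fastforce
qed

lemma rooted_tree_iff: "rooted_tree V r E \<longleftrightarrow> E \<in> forests V \<and> V - Domain E = {r}"
proof
  assume t: "rooted_tree V r E"
  then have "Domain E = V - {r}"
    by (fastforce simp: rooted_tree_def)
  moreover have "single_valued E"
    using t unfolding rooted_tree_def single_valued_def by blast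
  ultimately show "E \<in> forests V \<and> V - Domain E = {r}"
    using t by (auto simp: rooted_tree_def forests_def)
next
  assume *: "E \<in> forests V \<and> V - Domain E = {r}"
  then have D: "Domain E = V - {r}" "r \<in> V"
    by (auto simp: forests_def)
  have "\<exists>!p. (v, p) \<in> E" if "v \<in> V - {r}" for v
    using that D(1) * by (auto simp: forests_def single_valued_def)
  moreover have "E \<subseteq> (V - {r}) \<times> V"
    using D(1) * by (fastforce simp: forests_def)
  ultimately show "rooted_tree V r E"
    using * D(2) by (auto simp: rooted_tree_def forests_def)
qed

lemma finite_forests: "finite V \<Longrightarrow> finite (forests V)"
  unfolding forests_def by (rule finite_subset[of _ "Pow (V \<times> V)"]) auto

text \<open>The new node \<open>a\<close> gets the parent \<open>p\<close>, or becomes a root for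
  \<open>None\<close>, and the former roots in \<open>S\<close> become its children.\<close>

definition attach :: "'a \<Rightarrow> ('a \<times> 'a) set \<Rightarrow> 'a option \<Rightarrow> 'a set \<Rightarrow> ('a \<times> 'a) set" where
  "attach a E p S = E \<union> (\<lambda>s. (s, a)) ` S \<union> (\<lambda>p. (a, p)) ` set_option p"

context
  fixes V :: "'a::linorder set" and a :: 'a
  assumes V: "finite V" and a: "\<And>v. v \<in> V \<Longrightarrow> a < v"
begin

lemma a_notin: "a \<notin> V"
  using a by blast

text \<open>If \<open>a\<close> hangs below \<open>p\<close>, the root of the tree of
  \<open>p\<close> must not become a child of \<open>a\<close>, as this would close a cycle.\<close>

definition free_roots :: "('a \<times> 'a) set \<Rightarrow> 'a option \<Rightarrow> 'a set" where
  "free_roots E p = (V - Domain E) - root V E ` set_option p"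

context
  fixes E p S
  assumes E: "E \<in> forests V" and p: "set_option p \<subseteq> V" and S: "S \<subseteq> free_roots E p"
begin

lemma Domain_attach: "insert a V - Domain (attach a E p S) =
    (V - Domain E - S) \<union> (if p = None then {a} else {})"
  using E S a_notin by (cases p) (auto simp: attach_def forests_def free_roots_def)

lemma attach_forest: "attach a E p S \<in> forests (insert a V)"
proof -
  let ?F = "attach a E p S"
  have EV: "E \<subseteq> V \<times> V" "single_valued E"
    using E by (auto simp: forests_def)
  have SV: "S \<subseteq> V" "S \<inter> Domain E = {}"
    using S by (auto simp: free_roots_def)
  have "?F \<subseteq> insert a V \<times> insert a V"
    using EV SV p by (auto simp: attach_def)
  moreover have "single_valued ?F"
    unfolding attach_def using EV SV a_notin
    by (cases p) (auto simp: single_valued_def)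
  moreover have sub: "E\<^sup>* \<subseteq> ?F\<^sup>*"
    by (rule rtrancl_mono) (auto simp: attach_def)
  have reach_a: "\<exists>r\<in>insert a V - Domain ?F. (a, r) \<in> ?F\<^sup>*"
  proof (cases p)
    case None
    then show ?thesis
      unfolding Domain_attach by auto
  next
    case (Some q)
    then have q: "q \<in> V" "root V E q \<notin> S"
      using p S by (auto simp: free_roots_def)
    have "(a, q) \<in> ?F"
      using Some by (simp add: attach_def)
    moreover have "(q, root V E q) \<in> ?F\<^sup>*"
      using root(2)[OF E q(1)] sub by blast
    moreover have "root V E q \<in> insert a V - Domain ?F"
      unfolding Domain_attach using root(1)[OF E q(1)] q(2) by blast
    ultimately show ?thesis
      by (meson converse_rtrancl_into_rtrancl)
  qed
  moreover have "\<exists>r\<in>insert a V - Domain ?F. (v, r) \<in> ?F\<^sup>*" if v: "v \<in> V" for v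
  proof (cases "root V E v \<in> S")
    case True
    have "(v, root V E v) \<in> ?F\<^sup>*"
      using root(2)[OF E v] sub by blast
    moreover have "(root V E v, a) \<in> ?F"
      using True by (simp add: attach_def)
    ultimately have "(v, a) \<in> ?F\<^sup>*"
      by (rule rtrancl_into_rtrancl)
    then show ?thesis
      using reach_a by (meson rtrancl_trans)
  next
    case False
    then have "root V E v \<in> insert a V - Domain ?F"
      unfolding Domain_attach using root(1)[OF E v] by blast
    then show ?thesis
      using root(2)[OF E v] sub by blast
  qed
  ultimately show ?thesis
    unfolding forests_def by blast
qed

text \<open>Since \<open>a\<close> is smallest, it is a descent as soon as it has a parent, while
  its children are never descents.\<close>

lemma descents_attach:
  "card (descents (attach a E p S)) = card (descents E) + (if p = None then 0 else 1)"
proof -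
  have EV: "E \<subseteq> V \<times> V" and SV: "S \<subseteq> V"
    using E S by (auto simp: forests_def free_roots_def)
  have "descents (attach a E p S) = descents E \<union> (if p = None then {} else {a})"
    unfolding descents_def attach_def using SV a p by (cases p) (auto dest: less_asym)
  moreover have "descents E \<subseteq> V"
    using EV by (auto simp: descents_def)
  then have "finite (descents E)" "a \<notin> descents E"
    using V finite_subset a_notin by auto
  ultimately show ?thesis
    by simp
qed

lemma detach_attach:
  "{(v, w) \<in> attach a E p S. v \<noteq> a \<and> w \<noteq> a} = E" "{s. (s, a) \<in> attach a E p S} = S"
  "{q. (a, q) \<in> attach a E p S} = set_option p"
proof -
  have EV: "E \<subseteq> V \<times> V" and SV: "S \<subseteq> V"
    using E S by (auto simp: forests_def free_roots_def)
  have na: "v \<noteq> a" if "v \<in> V" for v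
    using a_notin that by blast
  show "{(v, w) \<in> attach a E p S. v \<noteq> a \<and> w \<noteq> a} = E"
    using EV na by (auto simp: attach_def)
  show "{s. (s, a) \<in> attach a E p S} = S"
    using EV na p by (auto simp: attach_def)
  show "{q. (a, q) \<in> attach a E p S} = set_option p"
    using EV SV na by (auto simp: attach_def)
qed

end

text \<open>Every former path either avoids \<open>a\<close> or reaches a node whose parent was
  \<open>a\<close>, and such a node is a root after the removal. A child of \<open>a\<close> that is
  the root of the tree of \<open>p\<close> would give a cycle in \<open>F\<close>.\<close>

lemma detach_forest:
  assumes F: "F \<in> forests (insert a V)"
  obtains E p S where "E \<in> forests V" "set_option p \<subseteq> V" "S \<subseteq> free_roots E p" "attach a E p S = F"
proof -
  define E where "E = {(v, w) \<in> F. v \<noteq> a \<and> w \<noteq> a}"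
  define S where "S = {s. (s, a) \<in> F}"
  define p where "p = (if a \<in> Domain F then Some (SOME q. (a, q) \<in> F) else None)"
  have FV: "F \<subseteq> insert a V \<times> insert a V" and sv: "single_valued F"
    using F by (auto simp: forests_def)
  have noloop: "(a, a) \<notin> F"
    using forest_acyclic[OF F, of a] by blast
  have SV: "S \<subseteq> V"
    using FV noloop by (auto simp: S_def)
  have p_iff: "(a, q) \<in> F \<longleftrightarrow> p = Some q" for q
  proof
    assume q: "(a, q) \<in> F"
    then have "(a, SOME q. (a, q) \<in> F) \<in> F"
      by (rule someI)
    then show "p = Some q"
      using sv q by (auto simp: p_def dest: single_valuedD)
  next
    assume "p = Some q"
    then have "a \<in> Domain F" "q = (SOME q. (a, q) \<in> F)"
      by (auto simp: p_def split: if_splits)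
    then show "(a, q) \<in> F"
      by (auto intro: someI)
  qed
  have pV: "set_option p \<subseteq> V"
  proof
    fix q assume "q \<in> set_option p"
    then have "(a, q) \<in> F"
      using p_iff by (simp add: elem_set)
    then show "q \<in> V"
      using FV noloop by auto
  qed
  have S_D: "s \<notin> Domain E" if "s \<in> S" for s
    using that sv by (auto simp: E_def S_def dest: single_valuedD)
  have "\<exists>r\<in>V - Domain E. (v, r) \<in> E\<^sup>*" if v: "v \<in> V" for v
  proof -
    obtain r where r: "r \<in> insert a V - Domain F" "(v, r) \<in> F\<^sup>*"
      using root[OF F, of v] v by blast
    from r(2) v show ?thesis
    proof (induction rule: converse_rtrancl_induct)
      case base
      then show ?case
        using r(1) by (auto simp: E_def)
    next
      case (step v w)
      show ?case
      proof (cases "w = a")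
        case True
        then have "v \<notin> Domain E"
          using S_D step.hyps(1) by (simp add: S_def)
        then show ?thesis
          using step.prems by blast
      next
        case False
        then have "w \<in> V" "(v, w) \<in> E"
          using FV step.hyps(1) step.prems a_notin by (auto simp: E_def)
        then show ?thesis
          using step.IH by (meson converse_rtrancl_into_rtrancl)
      qed
    qed
  qed
  moreover have "E \<subseteq> V \<times> V"
    using FV by (auto simp: E_def)
  moreover have "single_valued E"
    using sv by (auto simp: E_def single_valued_def)
  ultimately have E: "E \<in> forests V"
    by (simp add: forests_def)
  have "root V E q \<notin> S" if q: "q \<in> set_option p" for q
  proof
    assume "root V E q \<in> S"
    then have "(root V E q, a) \<in> F"
      by (simp add: S_def)
    moreover have "(a, q) \<in> F"
      using q p_iff by (simp add: elem_set)
    moreover have "(q, root V E q) \<in> E\<^sup>*"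
      using root(2)[OF E] q pV by blast
    then have "(q, root V E q) \<in> F\<^sup>*"
      using rtrancl_mono[of E F] by (auto simp: E_def)
    ultimately have "(a, a) \<in> F\<^sup>+"
      by (metis rtrancl_into_trancl2 trancl_into_trancl)
    then show False
      using forest_acyclic[OF F] by blast
  qed
  then have "S \<subseteq> free_roots E p"
    using SV S_D by (auto simp: free_roots_def)
  moreover have "attach a E p S = F"
    unfolding attach_def using p_iff noloop by (auto simp: E_def S_def elem_set)
  ultimately show ?thesis
    using that E pV by blast
qed

end

text \<open>All roots but one are marked by \<open>z\<close>, so that \<open>z = 0\<close> selects
  the trees.\<close>

definition forest_sum :: "'b::comm_ring_1 \<Rightarrow> 'a::linorder set \<Rightarrow> 'b \<Rightarrow> 'b" where
  "forest_sum t V z = (\<Sum>E\<in>forests V. t ^ card (descents E) * z ^ (card (V - Domain E) - 1))"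

lemma sum_Pow_power:
  fixes z :: "'b::comm_ring_1"
  assumes "finite R"
  shows "(\<Sum>S\<in>Pow R. z ^ (card R - card S)) = (1 + z) ^ card R"
  unfolding sum_Pow_card[OF assms, of "\<lambda>k. z ^ (card R - k)"] by (simp add: binomial_ring)

text \<open>For a forest with r roots, summing over \<open>S\<close> gives (1 + z)^r if
  \<open>a\<close> is a root, and t (1 + z)^(r-1) for each of the \<open>card V\<close> possible
  parents, as one root is then forbidden. The common factor (1 + z)^(r-1) belongs to the forest sum
  at \<open>1 + z\<close>.\<close>

lemma forest_sum_insert:
  fixes V :: "'a::linorder set" and t z :: "'b::comm_ring_1"
  assumes V: "finite V" "V \<noteq> {}" and a: "\<And>v. v \<in> V \<Longrightarrow> a < v"
  shows "forest_sum t (insert a V) z = (1 + z + t * of_nat (card V)) * forest_sum t V (1 + z)"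
proof -
  let ?P = "insert None (Some ` V)"
  let ?T = "Sigma (forests V) (\<lambda>E. Sigma ?P (\<lambda>p. Pow (free_roots V E p)))"
  let ?w = "\<lambda>F. t ^ card (descents F) * z ^ (card (insert a V - Domain F) - 1)"
  have P: "p \<in> ?P \<longleftrightarrow> set_option p \<subseteq> V" for p
    by (cases p) auto
  have free: "finite (free_roots V E p)" for E p
    using V by (auto simp: free_roots_def[OF V(1) a])
  have "forest_sum t (insert a V) z = (\<Sum>(E, p, S)\<in>?T. ?w (attach a E p S))"
    unfolding forest_sum_def
  proof (rule sum.reindex_bij_betw[symmetric, of "\<lambda>(E, p, S). attach a E p S" ?T, THEN trans])
    show "bij_betw (\<lambda>(E, p, S). attach a E p S) ?T (forests (insert a V))"
      unfolding bij_betw_def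
    proof
      show "inj_on (\<lambda>(E, p, S). attach a E p S) ?T"
      proof (rule inj_onI)
        fix x y assume x: "x \<in> ?T" and y: "y \<in> ?T"
          and eq: "(case x of (E, p, S) \<Rightarrow> attach a E p S) = (case y of (E, p, S) \<Rightarrow> attach a E p S)"
        obtain E p S E' p' S' where xy: "x = (E, p, S)" "y = (E', p', S')"
          by (cases x, cases y)
        have 1: "E \<in> forests V" "set_option p \<subseteq> V" "S \<subseteq> free_roots V E p"
          and 2: "E' \<in> forests V" "set_option p' \<subseteq> V" "S' \<subseteq> free_roots V E' p'"
          using x y xy P by auto
        have "set_option p = set_option p'"
          using detach_attach(3)[OF V(1) a 1] detach_attach(3)[OF V(1) a 2] eq xy by simp
        then have "p = p'"
          by (cases p; cases p') auto
        then show "x = y"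
          using detach_attach(1,2)[OF V(1) a 1] detach_attach(1,2)[OF V(1) a 2] eq xy by simp
      qed
      show "(\<lambda>(E, p, S). attach a E p S) ` ?T = forests (insert a V)"
      proof
        show "(\<lambda>(E, p, S). attach a E p S) ` ?T \<subseteq> forests (insert a V)"
          using attach_forest[OF V(1) a] P by auto
        show "forests (insert a V) \<subseteq> (\<lambda>(E, p, S). attach a E p S) ` ?T"
        proof
          fix F assume "F \<in> forests (insert a V)"
          then obtain E p S where *: "E \<in> forests V" "set_option p \<subseteq> V"
            "S \<subseteq> free_roots V E p" "attach a E p S = F"
            using detach_forest[OF V(1) a] by metis
          then have "(E, p, S) \<in> ?T"
            using P by auto
          then show "F \<in> (\<lambda>(E, p, S). attach a E p S) ` ?T"
            using *(4) by (intro image_eqI[of _ _ "(E, p, S)"]) auto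
        qed
      qed
    qed
  qed (auto intro!: sum.cong)
  also have "\<dots> = (\<Sum>E\<in>forests V. \<Sum>(p, S)\<in>Sigma ?P (\<lambda>p. Pow (free_roots V E p)). ?w (attach a E p S))"
    using V finite_forests free by (subst sum.Sigma) (auto simp: split_def)
  also have "\<dots> = (\<Sum>E\<in>forests V. (1 + z + t * of_nat (card V)) *
      (t ^ card (descents E) * (1 + z) ^ (card (V - Domain E) - 1)))"
  proof (rule sum.cong)
    fix E assume E: "E \<in> forests V"
    let ?R = "V - Domain E" and ?d = "t ^ card (descents E)"
    have "finite ?R" "?R \<noteq> {}"
      using V E by (auto simp: forests_def)
    then have R: "card ?R = Suc (card ?R - 1)" "finite ?R"
      by (auto simp: card_gt_0_iff)
    have none: "(\<Sum>S\<in>Pow (free_roots V E None). ?w (attach a E None S)) = ?d * (1 + z) ^ card ?R"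
    proof -
      have fr: "free_roots V E None = ?R"
        by (simp add: free_roots_def[OF V(1) a])
      have "?w (attach a E None S) = ?d * z ^ (card ?R - card S)" if "S \<in> Pow ?R" for S
      proof -
        have S: "S \<subseteq> free_roots V E None" "finite S"
          using that fr finite_subset[OF _ R(2)] by auto
        \<comment> \<open>Here \<open>a\<close> itself is an additional root, which compensates for
          the unmarked one.\<close>
        have "card (?R - S \<union> {a}) = Suc (card ?R - card S)"
          using R(2) S a fr by (subst card_Un_disjoint) (auto simp: card_Diff_subset)
        then show ?thesis
          using Domain_attach[OF V(1) a E _ S(1)] descents_attach[OF V(1) a E _ S(1)] by simp
      qed
      then have "(\<Sum>S\<in>Pow ?R. ?w (attach a E None S)) = (\<Sum>S\<in>Pow ?R. ?d * z ^ (card ?R - card S))"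
        by (intro sum.cong refl) blast
      then show ?thesis
        unfolding fr by (simp add: sum_distrib_left[symmetric] sum_Pow_power[OF R(2)])
    qed
    have some: "(\<Sum>S\<in>Pow (free_roots V E (Some q)). ?w (attach a E (Some q) S)) =
        t * ?d * (1 + z) ^ (card ?R - 1)" if q: "q \<in> V" for q
    proof -
      let ?Q = "?R - {root V E q}"
      have fr: "free_roots V E (Some q) = ?Q"
        by (simp add: free_roots_def[OF V(1) a])
      have Q: "card ?Q = card ?R - 1" "finite ?Q"
        using root(1)[OF E q] R(2) by (auto simp: card_Diff_singleton)
      have "?w (attach a E (Some q) S) = t * ?d * z ^ (card ?Q - card S)" if "S \<in> Pow ?Q" for S
      proof -
        have S: "S \<subseteq> free_roots V E (Some q)" "finite S" "S \<subseteq> ?R"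
          using that fr finite_subset[of S ?R] R(2) by auto
        have "card (?R - S) - 1 = card ?Q - card S"
          using Q(1) S by (simp add: card_Diff_subset)
        then show ?thesis
          using Domain_attach[OF V(1) a E _ S(1)] descents_attach[OF V(1) a E _ S(1)] q by simp
      qed
      then have "(\<Sum>S\<in>Pow ?Q. ?w (attach a E (Some q) S)) =
          (\<Sum>S\<in>Pow ?Q. t * ?d * z ^ (card ?Q - card S))"
        by (intro sum.cong refl) blast
      then show ?thesis
        unfolding fr sum_distrib_left[symmetric] sum_Pow_power[OF Q(2)] unfolding Q(1) .
    qed
    have "(\<Sum>(p, S)\<in>Sigma ?P (\<lambda>p. Pow (free_roots V E p)). ?w (attach a E p S)) =
        (\<Sum>p\<in>?P. \<Sum>S\<in>Pow (free_roots V E p). ?w (attach a E p S))"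
      using V free by (subst sum.Sigma) auto
    also have "\<dots> = ?d * (1 + z) ^ card ?R + (\<Sum>p\<in>Some ` V. \<Sum>S\<in>Pow (free_roots V E p). ?w (attach a E p S))"
      using V none by (subst sum.insert) auto
    also have "(\<Sum>p\<in>Some ` V. \<Sum>S\<in>Pow (free_roots V E p). ?w (attach a E p S)) =
        (\<Sum>q\<in>V. t * ?d * (1 + z) ^ (card ?R - 1))"
    proof -
      have "inj_on Some V"
        by simp
      then show ?thesis
        by (simp only: sum.reindex o_def) (intro sum.cong refl some)
    qed
    also have "?d * (1 + z) ^ card ?R + \<dots> =
        (1 + z + t * of_nat (card V)) * (?d * (1 + z) ^ (card ?R - 1))"
      by (subst R(1)) (simp add: algebra_simps)
    finally show "(\<Sum>(p, S)\<in>Sigma ?P (\<lambda>p. Pow (free_roots V E p)). ?w (attach a E p S)) =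
        (1 + z + t * of_nat (card V)) * (?d * (1 + z) ^ (card ?R - 1))" .
  qed simp
  finally show ?thesis
    by (simp add: forest_sum_def sum_distrib_left)
qed

text \<open>Replacing \<open>z\<close> by \<open>1 + z\<close> raises the index \<open>j\<close> of
  each factor by 1; the factor from the insertion supplies \<open>j = 1\<close>.\<close>

lemma forest_sum_closed_form:
  fixes t z :: "'b::comm_ring_1"
  assumes "finite V" "V \<noteq> {}"
  shows "forest_sum t V z = (\<Prod>j\<in>{1..<card V}. of_nat j + t * of_nat (card V - j) + z)"
  using assms
proof (induction V arbitrary: z rule: finite_linorder_min_induct)
  case (insert a V)
  show ?case
  proof (cases "V = {}")
    case True
    have "forests {a} = {{}}"
    proof -
      have "E = {}" if "E \<in> forests {a}" for E
        using that root(1)[OF that, of a] by (auto simp: forests_def)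
      moreover have "{} \<in> forests {a}"
        by (simp add: forests_def)
      ultimately show ?thesis
        by blast
    qed
    then show ?thesis
      using True by (simp add: forest_sum_def descents_def)
  next
    case False
    have card: "card (insert a V) = Suc (card V)"
      using insert by (subst card_insert_disjoint) auto
    have pos: "1 \<le> card V"
      using False insert.hyps by (simp add: Suc_le_eq card_gt_0_iff)
    have "(\<Prod>j\<in>{1..<card V}. of_nat j + t * of_nat (card V - j) + (1 + z)) =
        (\<Prod>j\<in>{2..<Suc (card V)}. of_nat j + t * of_nat (Suc (card V) - j) + z)"
      by (rule prod.reindex_bij_witness[of _ "\<lambda>j. j - 1" Suc]) (auto simp: algebra_simps of_nat_diff)
    moreover have "(\<Prod>j\<in>{1..<Suc (card V)}. of_nat j + t * of_nat (Suc (card V) - j) + z) =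
        (1 + t * of_nat (card V) + z) * (\<Prod>j\<in>{2..<Suc (card V)}. of_nat j + t * of_nat (Suc (card V) - j) + z)"
      using pos by (subst prod.atLeast_Suc_lessThan) (auto simp: numeral_2_eq_2)
    ultimately show ?thesis
      unfolding card using forest_sum_insert[of V a t z] insert False
      by (simp add: algebra_simps)
  qed
qed simp

section \<open>The ranks\<close>

text \<open>An indeterminate in the role of \<open>t\<close>: it differs from 1, its coefficients
  count words by weight and trees by descents, and evaluation at 1 gives total numbers.\<close>

definition tx :: "int poly" where
  "tx = [:0, 1:]"

lemma tx_power: "tx ^ k = monom 1 k"
  by (simp add: tx_def monom_altdef)

lemma coeff_sum_tx:
  assumes "finite A"
  shows "coeff (\<Sum>x\<in>A. tx ^ f x) i = int (card {x \<in> A. f x = i})"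
proof -
  have "coeff (\<Sum>x\<in>A. tx ^ f x) i = (\<Sum>x\<in>A. if f x = i then 1 else 0)"
    by (simp add: coeff_sum tx_power)
  also have "\<dots> = (\<Sum>x\<in>{x \<in> A. f x = i}. 1)"
    by (rule sum.inter_filter[OF assms, symmetric])
  finally show ?thesis
    by simp
qed

lemma poly_sum_tx: "poly (\<Sum>x\<in>A. tx ^ f x) 1 = int (card A)"
  by (simp add: poly_sum tx_def)

lemma low_sum_closed_form:
  assumes "1 \<le> n" "z = [] \<or> z = [(1, n + 1, 0)]"
  shows "low_sum tx z n {} = (\<Prod>j\<in>{1..<n}. of_nat j + tx * of_nat (n - j) + (if z = [] then 0 else - 1))"
proof -
  have "tx \<noteq> 1"
    by (simp add: tx_def one_pCons)
  then show ?thesis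
    using low_sum_eq_low_count[of n z "n + 1" "{}" tx] low_count_closed_form[of tx n] assms by auto
qed

lemma poly_low_sum_closed_form:
  "poly (\<Prod>j\<in>{1..<n}. of_nat j + tx * of_nat (n - j) + c) 1 = (int n + poly c 1) ^ (n - 1)"
proof -
  have "poly (\<Prod>j\<in>{1..<n}. of_nat j + tx * of_nat (n - j) + c) 1 = (\<Prod>j\<in>{1..<n}. int n + poly c 1)"
    unfolding poly_prod by (intro prod.cong) (auto simp: tx_def of_nat_poly of_nat_diff)
  then show ?thesis
    by simp
qed

text \<open>With all of \<open>{1..n}\<close> on the low side and \<open>B\<close> empty, the bound
  on first entries holds for every word.\<close>

lemma low_words_eq:
  assumes "1 \<le> n"
  shows "low_words z n {} = {w \<in> chain_words n. asc_free (w @ z)}"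
  unfolding low_words_def chain_words_eq[OF assms] using merge_word_set by fastforce

text \<open>Appending the artificial label adds exactly the comparison at position
  \<open>n - 1\<close>.\<close>

lemma asc_free_iff:
  assumes "w \<in> chain_words n"
  shows "asc_free w \<longleftrightarrow> (\<forall>j\<in>{1..n - 2}. \<not> asc_at n w j)"
    "asc_free (w @ [(1, n + 1, 0)]) \<longleftrightarrow> (\<forall>j\<in>{1..n - 1}. \<not> asc_at n w j)"
proof -
  have len: "length w = n - 1"
    using assms by (simp add: chain_words_def)
  have shift: "(\<forall>i. Suc i < m \<longrightarrow> P i) \<longleftrightarrow> (\<forall>j\<in>{1..m - 1}. P (j - 1))" for P m
  proof
    assume *: "\<forall>j\<in>{1..m - 1}. P (j - 1)"
    show "\<forall>i. Suc i < m \<longrightarrow> P i"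
    proof (intro allI impI)
      fix i assume "Suc i < m"
      then have "Suc i \<in> {1..m - 1}"
        by auto
      then show "P i"
        using * by fastforce
    qed
  qed auto
  have at: "asc_at n w j \<longleftrightarrow> ascent (w ! (j - 1)) (w ! Suc (j - 1))" if "j \<in> {1..n - 2}" for j
    using that by (auto simp: asc_at_def label_at_def)
  show "asc_free w \<longleftrightarrow> (\<forall>j\<in>{1..n - 2}. \<not> asc_at n w j)"
    unfolding successively_conv_nth len shift using at by (simp add: numeral_2_eq_2)
  have "asc_at n w j \<longleftrightarrow>
      ascent ((w @ [(1, n + 1, 0)]) ! (j - 1)) ((w @ [(1, n + 1, 0)]) ! Suc (j - 1))"
    if "j \<in> {1..n - 1}" for j
    using that len by (auto simp: asc_at_def label_at_def nth_append)
  then show "asc_free (w @ [(1, n + 1, 0)]) \<longleftrightarrow> (\<forall>j\<in>{1..n - 1}. \<not> asc_at n w j)"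
    unfolding successively_conv_nth shift by (simp add: len)
qed

lemma finite_ascent_free_words: "1 \<le> n \<Longrightarrow> finite {w \<in> chain_words n. asc_free (w @ z)}"
  using finite_chain_words by simp

lemma card_ascent_free_full:
  assumes "1 \<le> n"
  shows "card {w \<in> chain_words n. \<forall>j\<in>{1..n - 1}. \<not> asc_at n w j} = (n - 1) ^ (n - 1)"
proof -
  let ?z = "[(1, n + 1, 0)]"
  have D: "{w \<in> chain_words n. \<forall>j\<in>{1..n - 1}. \<not> asc_at n w j} = low_words ?z n {}"
    unfolding low_words_eq[OF assms] using asc_free_iff(2) by blast
  have "int (card (low_words ?z n {})) = poly (low_sum tx ?z n {}) 1"
    unfolding low_sum_def poly_sum_tx ..
  \<comment> \<open>At \<open>tx = 1\<close> each of the \<open>n - 1\<close> factors equals n + s,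
    here with s = -1.\<close>
  also have "\<dots> = (int n - 1) ^ (n - 1)"
    unfolding low_sum_closed_form[OF assms disjI2[OF refl]] poly_low_sum_closed_form by simp
  also have "\<dots> = int ((n - 1) ^ (n - 1))"
    using assms by (simp add: of_nat_diff)
  finally show ?thesis
    unfolding D by (simp only: of_nat_eq_iff)
qed

definition interval_words :: "nat \<Rightarrow> nat \<Rightarrow> label list set" where
  "interval_words n i = {w \<in> chain_words n. weight w = i \<and> (\<forall>j\<in>{1..n - 2}. \<not> asc_at n w j)}"

lemma interval_words_eq:
  assumes "1 \<le> n"
  shows "interval_words n i = {w \<in> low_words [] n {}. weight w = i}"
  unfolding low_words_eq[OF assms] interval_words_def using asc_free_iff(1) by auto

lemma finite_low: "1 \<le> n \<Longrightarrow> finite (low_words z n {})"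
  using finite_ascent_free_words by (simp add: low_words_eq)

text \<open>Words by weight and trees by descents have the same generating polynomial: the closed
  form for \<open>s = 0\<close> is the forest sum at \<open>z = 0\<close>. Comparing coefficients
  gives the equality.\<close>

lemma card_interval_words:
  assumes n: "1 \<le> n"
  shows "card (interval_words n i) = card (trees_with_descents n i)"
proof -
  let ?T = "{E \<in> forests {1..n}. card ({1..n} - Domain E) - 1 = 0}"
  have T: "trees_with_descents n i = (\<lambda>E. (THE r. {1..n} - Domain E = {r}, E)) `
      {E \<in> ?T. card (descents E) = i}"
  proof -
    \<comment> \<open>Truncated subtraction would also admit forests without roots; these are
      excluded because \<open>n\<close> is at least 1.\<close>
    have one: "card ({1..n} - Domain E) - 1 = 0 \<longleftrightarrow> (\<exists>r. {1..n} - Domain E = {r})"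
      if "E \<in> forests {1..n}" for E
    proof -
      have "{1..n} - Domain E \<noteq> {}"
        using root(1)[OF that, of 1] n by auto
      then have "card ({1..n} - Domain E) \<noteq> 0"
        by simp
      then have "card ({1..n} - Domain E) - 1 = 0 \<longleftrightarrow> card ({1..n} - Domain E) = 1"
        by linarith
      then show ?thesis
        by (simp add: card_1_singleton_iff)
    qed
    show ?thesis
    proof
      show "trees_with_descents n i \<subseteq> (\<lambda>E. (THE r. {1..n} - Domain E = {r}, E)) `
          {E \<in> ?T. card (descents E) = i}"
      proof
        fix x assume "x \<in> trees_with_descents n i"
        then obtain r E where x: "x = (r, E)" "E \<in> forests {1..n}" "{1..n} - Domain E = {r}"
          "card (descents E) = i"
          by (auto simp: trees_with_descents_def rooted_tree_iff)
        then show "x \<in> (\<lambda>E. (THE r. {1..n} - Domain E = {r}, E)) ` {E \<in> ?T. card (descents E) = i}"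
          by (intro image_eqI[of _ _ E]) auto
      qed
      show "(\<lambda>E. (THE r. {1..n} - Domain E = {r}, E)) ` {E \<in> ?T. card (descents E) = i} \<subseteq>
          trees_with_descents n i"
      proof (rule image_subsetI)
        fix E assume E: "E \<in> {E \<in> ?T. card (descents E) = i}"
        then obtain r where r: "{1..n} - Domain E = {r}"
          using one by blast
        then have "(THE r. {1..n} - Domain E = {r}) = r"
          by (intro the_equality) simp_all
        then show "(THE r. {1..n} - Domain E = {r}, E) \<in> trees_with_descents n i"
          using E r by (simp add: trees_with_descents_def rooted_tree_iff)
      qed
    qed
  qed
  have fin: "finite (forests {1..n})"
    by (simp add: finite_forests)
  have "(\<Sum>E\<in>?T. tx ^ card (descents E)) = forest_sum tx {1..n} 0"
    unfolding forest_sum_def using fin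
    by (intro sum.mono_neutral_cong_left) (auto simp: power_0_left)
  also have "\<dots> = low_sum tx [] n {}"
    using forest_sum_closed_form[of "{1..n}" tx 0] low_sum_closed_form[OF n, of "[]"] n by simp
  finally have eq: "(\<Sum>E\<in>?T. tx ^ card (descents E)) = (\<Sum>w\<in>low_words [] n {}. tx ^ weight w)"
    by (simp add: low_sum_def)
  have "int (card (interval_words n i)) = coeff (\<Sum>w\<in>low_words [] n {}. tx ^ weight w) i"
    unfolding interval_words_eq[OF n] by (rule coeff_sum_tx[symmetric]) (rule finite_low[OF n])
  also have "\<dots> = int (card {E \<in> ?T. card (descents E) = i})"
    unfolding eq[symmetric] by (rule coeff_sum_tx) (use fin in simp)
  also have "card {E \<in> ?T. card (descents E) = i} = card (trees_with_descents n i)"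
    unfolding T by (rule card_image[symmetric]) (simp add: inj_on_def)
  finally show ?thesis
    by simp
qed

text \<open>Every letter adds at most 1, so the weights of all ascent-free words lie in
  \<open>{0..n - 1}\<close> and the sets for the single intervals exhaust them. Their total is the
  value at 1.\<close>

lemma card_Sigma_interval_words:
  assumes n: "1 \<le> n"
  shows "card (Sigma {0..n - 1} (interval_words n)) = n ^ (n - 1)"
proof -
  have weight: "weight w \<le> n - 1" if "w \<in> low_words [] n {}" for w
  proof -
    have w: "merge_word {1..n} w"
      using that by (simp add: low_words_def)
    have "weight w \<le> length w"
      using merge_word_set[OF w] by (induction w) (auto, fastforce)
    then show ?thesis
      using merge_word_length[OF w] by simp
  qed
  have "card (Sigma {0..n - 1} (interval_words n)) = (\<Sum>i\<in>{0..n - 1}. card {w \<in> low_words [] n {}. weight w = i})"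
    using interval_words_eq[OF n] finite_low[OF n, of "[]"] by (subst card_SigmaI) auto
  also have "\<dots> = card (low_words [] n {})"
    using finite_low[OF n, of "[]"] weight
    unfolding card_eq_sum by (intro sum.group) auto
  also have "int \<dots> = poly (low_sum tx [] n {}) 1"
    unfolding low_sum_def poly_sum_tx ..
  also have "\<dots> = int (n ^ (n - 1))"
    unfolding low_sum_closed_form[OF n disjI1[OF refl]] poly_low_sum_closed_form by simp
  finally show ?thesis
    by (simp only: of_nat_eq_iff)
qed

theorem corollary3p7:
  fixes n :: nat
  assumes "n \<ge> 1"
    and "field (class_ring :: 'k::comm_ring_1 ring) \<or> (class_ring :: 'k ring) \<simeq> \<Z>"
  shows
    "free_of_rank (class_ring :: 'k ring)
       (reduced_homology (weighted_partitions n - {wp_bot n}) (wp_less n) (int n - 2))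
       ((n - 1) ^ (n - 1)) \<and>
     (\<forall>i\<in>{0..n - 1}. free_of_rank (class_ring :: 'k ring)
       (interval_homology (weighted_partitions n) (wp_less n) (wp_bot n) (wp_top n i) (int n - 3))
       (card (trees_with_descents n i))) \<and>
     free_of_rank (class_ring :: 'k ring)
       (direct_sum_module {0..n - 1} (\<lambda>i.
          interval_homology (weighted_partitions n) (wp_less n) (wp_bot n) (wp_top n i) (int n - 3)))
       (n ^ (n - 1))"
proof -
  let ?H = "\<lambda>i. interval_homology (weighted_partitions n) (wp_less n) (wp_bot n) (wp_top n i) (int n - 3) ::
    ('k, _) module"
  have "\<exists>\<phi>. coordinate_system (?H i) (interval_words n i) \<phi>" if "i \<in> {0..n - 1}" for i
    unfolding interval_words_def
    by (rule interval_homology_coordinates[OF assms(1), of i]) (use that in auto)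
  then obtain \<phi> where \<phi>: "\<And>i. i \<in> {0..n - 1} \<Longrightarrow> coordinate_system (?H i) (interval_words n i) (\<phi> i)"
    by metis
  have fin: "finite (interval_words n i)" for i
    using interval_words_eq[OF assms(1)] finite_low[OF assms(1)] by simp
  have "free_of_rank (class_ring :: 'k ring) (?H i) (card (trees_with_descents n i))"
    if "i \<in> {0..n - 1}" for i
    using coordinate_system_free[OF \<phi>[OF that] fin] card_interval_words[OF assms(1)] by simp
  moreover have "free_of_rank (class_ring :: 'k ring) (direct_sum_module {0..n - 1} ?H) (n ^ (n - 1))"
    using coordinate_system_free[OF coordinate_system_direct_sum[of "{0..n - 1}" ?H "interval_words n" \<phi>,
          OF finite_atLeastAtMost \<phi>]
        finite_SigmaI[OF finite_atLeastAtMost fin]]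
    unfolding card_Sigma_interval_words[OF assms(1)] .
  moreover have "free_of_rank (class_ring :: 'k ring)
      (reduced_homology (weighted_partitions n - {wp_bot n}) (wp_less n) (int n - 2)) ((n - 1) ^ (n - 1))"
    using full_homology_free[OF assms(1)] unfolding card_ascent_free_full[OF assms(1)] .
  ultimately show ?thesis
    by blast
qed

end
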